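(* Let $X$ be a complex Banach space, let $A:D(A)\subset X\to X$ be a closed linear operator with nonempty resolvent set, and let $f$ be a complex-valued function holomorphic on an open set (of the Riemann sphere) containing $\sigma(A)\cup\{\infty\}$. If $f$ is univalent (injective), then $\sigma_{bd}(f(A))=f(\sigma_{bd}(A))$.
   Context: $f(A)$ is the bounded operator on $X$ given by Taylor's operational calculus: $f(A)=f(\infty)I+\frac{1}{2\pi i}\int_{\partial D} f(\lambda)(\lambda I-A)^{-1}\,d\lambda$, where $D$ is an unbounded Cauchy domain (boundary consisting of finitely many disjoint closed rectifiable Jordan curves, positively oriented with respect to $D$, and $D$ containing a neighbourhood of $\infty$) with $\sigma(A)\subset D$ and whose closure lies in the domain of holomorphy of $f$. For a closed linear operator $T:D(T)\subset X\to X$, write $N(T)$, $R(T)$ for its nullspace and range and $\sigma(T)$ for its spectrum. Ascent: $a(T)=\inf\{n\in\mathbb N: N(T^n)=N(T^{n+1})\}$; descent: $\delta(T)=\inf\{n\in\mathbb N: R(T^n)=R(T^{n+1})\}$ (with $\inf\emptyset=\infty$, $\mathbb N=\{0,1,2,\dots\}$, and $T^n$ defined on its natural domain). $T$ is Drazin invertible if $a(T)$ and $\delta(T)$ are both finite. The Drazin spectrum is $\sigma_{D}(T)=\{\lambda\in\mathbb C: T-\lambda I\text{ is not Drazin invertible}\}$, and the B-discrete spectrum is $\sigma_{bd}(T)=\sigma(T)\setminus\sigma_D(T)$. *)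

theory Defs
  imports "HOL-Complex_Analysis.Complex_Analysis" "HOL-Library.Extended_Nat"
begin

section \<open>Complex Banach spaces\<close>

class complex_banach = banach +
  fixes scaleC :: "complex \<Rightarrow> 'a \<Rightarrow> 'a"  (infixr \<open>*\<^sub>C\<close> 75)
  assumes scaleC_add_right: "c *\<^sub>C (x + y) = c *\<^sub>C x + c *\<^sub>C y"
    and scaleC_add_left: "(c + d) *\<^sub>C x = c *\<^sub>C x + d *\<^sub>C x"
    and scaleC_scaleC: "c *\<^sub>C (d *\<^sub>C x) = (c * d) *\<^sub>C x"
    and scaleC_of_real: "complex_of_real r *\<^sub>C x = r *\<^sub>R x"
    and norm_scaleC: "norm (c *\<^sub>C x) = cmod c * norm x"
begin

lemma scaleC_scaleR_commute: "c *\<^sub>C (r *\<^sub>R x) = r *\<^sub>R (c *\<^sub>C x)"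
  by (simp flip: scaleC_of_real add: scaleC_scaleC mult.commute)

end

lemma bounded_linear_scaleC: "bounded_linear (\<lambda>x :: 'a :: complex_banach. c *\<^sub>C x)"
  by (rule bounded_linear_intro [where K = "cmod c"])
    (simp_all add: scaleC_add_right scaleC_scaleR_commute norm_scaleC mult.commute)

text \<open>The type of bounded operators consists of the real-linear ones; every operator used below
  is complex linear. Scalars act pointwise.\<close>

instantiation blinfun :: (real_normed_vector, complex_banach) complex_banach
begin

definition scaleC_blinfun :: "complex \<Rightarrow> 'a \<Rightarrow>\<^sub>L 'b \<Rightarrow> 'a \<Rightarrow>\<^sub>L 'b"
  where "scaleC_blinfun c T = Blinfun (\<lambda>x. c *\<^sub>C blinfun_apply T x)"

lemma blinfun_apply_scaleC: "blinfun_apply (c *\<^sub>C T) x = c *\<^sub>C blinfun_apply T x"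
  for T :: "'a \<Rightarrow>\<^sub>L 'b"
  unfolding scaleC_blinfun_def
  by (simp add: bounded_linear_Blinfun_apply
      bounded_linear_compose [OF bounded_linear_scaleC blinfun.bounded_linear_right])

lemma norm_scaleC_blinfun_le: "norm (c *\<^sub>C T) \<le> cmod c * norm T" for T :: "'a \<Rightarrow>\<^sub>L 'b"
proof (rule norm_blinfun_bound)
  fix x
  show "norm (blinfun_apply (c *\<^sub>C T) x) \<le> cmod c * norm T * norm x"
    using mult_left_mono [OF norm_blinfun [of T x], of "cmod c"]
    by (simp add: blinfun_apply_scaleC norm_scaleC mult.assoc)
qed simp

instance
proof
  fix c d :: complex and r :: real and S T :: "'a \<Rightarrow>\<^sub>L 'b"
  show "c *\<^sub>C (S + T) = c *\<^sub>C S + c *\<^sub>C T"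
    by (rule blinfun_eqI) (simp add: blinfun_apply_scaleC blinfun.add_left scaleC_add_right)
  show "(c + d) *\<^sub>C T = c *\<^sub>C T + d *\<^sub>C T"
    by (rule blinfun_eqI) (simp add: blinfun_apply_scaleC blinfun.add_left scaleC_add_left)
  show assoc: "c *\<^sub>C (d *\<^sub>C T) = (c * d) *\<^sub>C T" for c d
    by (rule blinfun_eqI) (simp add: blinfun_apply_scaleC scaleC_scaleC)
  show real: "complex_of_real r *\<^sub>C T = r *\<^sub>R T" for r
    by (rule blinfun_eqI) (simp add: blinfun_apply_scaleC blinfun.scaleR_left scaleC_of_real)
  show "norm (c *\<^sub>C T) = cmod c * norm T"
  proof (cases "c = 0")
    case True
    then show ?thesis using real [of 0] by simp
  next
    case False
    have "inverse c *\<^sub>C (c *\<^sub>C T) = T"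
      using False real [of 1] by (simp add: assoc)
    then have "norm T \<le> cmod (inverse c) * norm (c *\<^sub>C T)"
      using norm_scaleC_blinfun_le [of "inverse c" "c *\<^sub>C T"] by simp
    then have "cmod c * norm T \<le> norm (c *\<^sub>C T)"
      using False by (simp add: norm_inverse norm_divide field_simps)
    then show ?thesis using norm_scaleC_blinfun_le [of c T] by simp
  qed
qed

end

section \<open>Closed operators, resolvent and spectrum\<close>

text \<open>An operator is given by its domain \<open>D\<close> and a total function \<open>T\<close>; the values of \<open>T\<close>
  outside \<open>D\<close> never matter. A bounded operator is the case \<open>D = UNIV\<close>.\<close>

definition closed_operator :: "'a::complex_banach set \<Rightarrow> ('a \<Rightarrow> 'a) \<Rightarrow> bool"
  where "closed_operator D T \<longleftrightarrow>
    0 \<in> D \<and>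
    (\<forall>x\<in>D. \<forall>y\<in>D. x + y \<in> D \<and> T (x + y) = T x + T y) \<and>
    (\<forall>c. \<forall>x\<in>D. c *\<^sub>C x \<in> D \<and> T (c *\<^sub>C x) = c *\<^sub>C T x) \<and>
    closed ((\<lambda>x. (x, T x)) ` D)"

definition resolvent_set :: "'a::complex_banach set \<Rightarrow> ('a \<Rightarrow> 'a) \<Rightarrow> complex set"
  where "resolvent_set D T =
    {c. bij_betw (\<lambda>x. c *\<^sub>C x - T x) D UNIV \<and>
        bounded_linear (inv_into D (\<lambda>x. c *\<^sub>C x - T x))}"

definition spectrum :: "'a::complex_banach set \<Rightarrow> ('a \<Rightarrow> 'a) \<Rightarrow> complex set"
  where "spectrum D T = - resolvent_set D T"

text \<open>The resolvent \<open>(c I - T)\<^sup>-\<^sup>1\<close>, meaningful for \<open>c\<close> in the resolvent set.\<close>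

definition resolvent ::
    "'a::complex_banach set \<Rightarrow> ('a \<Rightarrow> 'a) \<Rightarrow> complex \<Rightarrow> 'a \<Rightarrow>\<^sub>L 'a"
  where "resolvent D T c = Blinfun (inv_into D (\<lambda>x. c *\<^sub>C x - T x))"

section \<open>Ascent, descent, Drazin spectrum, B-discrete spectrum\<close>

text \<open>The natural domain of the power \<open>T\<^sup>n\<close>.\<close>

definition pow_dom :: "'a set \<Rightarrow> ('a \<Rightarrow> 'a) \<Rightarrow> nat \<Rightarrow> 'a set"
  where "pow_dom D T n = {x. \<forall>k<n. (T ^^ k) x \<in> D}"

definition pow_null :: "'a::zero set \<Rightarrow> ('a \<Rightarrow> 'a) \<Rightarrow> nat \<Rightarrow> 'a set"
  where "pow_null D T n = {x \<in> pow_dom D T n. (T ^^ n) x = 0}"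

definition pow_range :: "'a set \<Rightarrow> ('a \<Rightarrow> 'a) \<Rightarrow> nat \<Rightarrow> 'a set"
  where "pow_range D T n = (T ^^ n) ` pow_dom D T n"

definition ascent :: "'a::zero set \<Rightarrow> ('a \<Rightarrow> 'a) \<Rightarrow> enat"
  where "ascent D T = Inf {enat n | n. pow_null D T n = pow_null D T (Suc n)}"

definition descent :: "'a set \<Rightarrow> ('a \<Rightarrow> 'a) \<Rightarrow> enat"
  where "descent D T = Inf {enat n | n. pow_range D T n = pow_range D T (Suc n)}"

definition drazin_invertible :: "'a::zero set \<Rightarrow> ('a \<Rightarrow> 'a) \<Rightarrow> bool"
  where "drazin_invertible D T \<longleftrightarrow> ascent D T < \<infinity> \<and> descent D T < \<infinity>"

definition drazin_spectrum :: "'a::complex_banach set \<Rightarrow> ('a \<Rightarrow> 'a) \<Rightarrow> complex set"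
  where "drazin_spectrum D T = {c. \<not> drazin_invertible D (\<lambda>x. T x - c *\<^sub>C x)}"

definition b_discrete_spectrum :: "'a::complex_banach set \<Rightarrow> ('a \<Rightarrow> 'a) \<Rightarrow> complex set"
  where "b_discrete_spectrum D T = spectrum D T - drazin_spectrum D T"

section \<open>Integration along rectifiable curves\<close>

text \<open>For a nonempty compact interval \<open>k\<close> of reals, \<open>Inf k\<close> and \<open>Sup k\<close> are its endpoints.\<close>

definition rectifiable_path :: "(real \<Rightarrow> complex) \<Rightarrow> bool"
  where "rectifiable_path g \<longleftrightarrow> path g \<and>
    (\<exists>B. \<forall>d. d division_of {0..1} \<longrightarrow> (\<Sum>k\<in>d. dist (g (Inf k)) (g (Sup k))) \<le> B)"

text \<open>The integral of \<open>F z\<close> with respect to \<open>dz\<close> along \<open>g\<close>, as the limit of Riemann--Stieltjes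
  sums when the mesh tends to 0 (in norm). The library's contour integral needs piecewise
  continuously differentiable paths and complex-valued integrands. The condition \<open>fine\<close> says
  that each interval lies in the ball of radius \<open>d\<close> around its tag.\<close>

definition has_path_integral ::
    "(complex \<Rightarrow> 'b::complex_banach) \<Rightarrow> 'b \<Rightarrow> (real \<Rightarrow> complex) \<Rightarrow> bool"
  where "has_path_integral F I g \<longleftrightarrow>
    (\<forall>e>0. \<exists>d>0. \<forall>p. p tagged_division_of {0..1} \<and> (\<lambda>t. ball t d) fine p \<longrightarrow>
       norm ((\<Sum>(t, k)\<in>p. (g (Sup k) - g (Inf k)) *\<^sub>C F (g t)) - I) < e)"

definition path_integral :: "(real \<Rightarrow> complex) \<Rightarrow> (complex \<Rightarrow> 'b::complex_banach) \<Rightarrow> 'b"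
  where "path_integral g F = (THE I. has_path_integral F I g)"

section \<open>Taylor's operational calculus\<close>

text \<open>\<open>C\<close> is the set of (parametrised) boundary curves of \<open>D\<close>. Positive orientation with respect
  to an unbounded \<open>D\<close> means that the boundary winds 0 times around the points of \<open>D\<close> and \<open>-1\<close>
  times around the points outside the closure; e.g. the boundary of the exterior of a disc is
  traversed clockwise. \<open>D\<close> need not be connected.\<close>

definition unbounded_cauchy_domain :: "complex set \<Rightarrow> (real \<Rightarrow> complex) set \<Rightarrow> bool"
  where "unbounded_cauchy_domain D C \<longleftrightarrow>
    open D \<and> (\<forall>\<^sub>F z in at_infinity. z \<in> D) \<and>
    finite C \<and>
    (\<forall>g\<in>C. simple_path g \<and> pathfinish g = pathstart g \<and> rectifiable_path g) \<and>
    pairwise (\<lambda>g h. disjnt (path_image g) (path_image h)) C \<and>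
    frontier D = (\<Union>g\<in>C. path_image g) \<and>
    (\<forall>z\<in>D. (\<Sum>g\<in>C. winding_number g z) = 0) \<and>
    (\<forall>z\<in>- closure D. (\<Sum>g\<in>C. winding_number g z) = -1)"

text \<open>A function on a neighbourhood of \<open>\<infinity>\<close> in the Riemann sphere is given by its restriction \<open>f\<close>
  to the finite points together with its value \<open>finf\<close> at \<open>\<infinity>\<close>; \<open>w = 1 / z\<close> is the chart at \<open>\<infinity>\<close>.\<close>

definition holomorphic_at_infinity :: "(complex \<Rightarrow> complex) \<Rightarrow> complex \<Rightarrow> bool"
  where "holomorphic_at_infinity f finf \<longleftrightarrow>
    (\<lambda>w. if w = 0 then finf else f (inverse w)) analytic_on {0}"

definition taylor_calculus ::
    "'a::complex_banach set \<Rightarrow> ('a \<Rightarrow> 'a) \<Rightarrow> (complex \<Rightarrow> complex) \<Rightarrow> complex \<Rightarrow>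
     (real \<Rightarrow> complex) set \<Rightarrow> 'a \<Rightarrow>\<^sub>L 'a"
  where "taylor_calculus domA A f finf C =
    finf *\<^sub>C id_blinfun +
    (1 / (2 * complex_of_real pi * \<i>)) *\<^sub>C
      (\<Sum>g\<in>C. path_integral g (\<lambda>z. f z *\<^sub>C resolvent domA A z))"

end

(*
  Write R z for the resolvent of A and J F for the integral of F over the boundary of D divided by
  2 pi i, so that f(A) = f(\<infinity>) I + J (f R). Two Liouville arguments in the style of Dixon give
  J ((f z - f w) / (z - w)) = f w - f(\<infinity>) and J R = 0; with the resolvent identity and the
  interchange of integrals they make f \<mapsto> f(A) multiplicative without a second contour.
  If f is univalent and \<mu> lies outside the closure of D, then for \<kappa> in the closure of D the
  function g z = (f z - f \<kappa>) (z - \<mu>) / (z - \<kappa>) is invertible, hence f(A) - f \<kappa> is the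
  composition of the commuting operators g(A), which is invertible, and (A - \<kappa>) (A - \<mu>)^-1,
  whose powers have the same null spaces and ranges as those of A - \<kappa>. Likewise f(A) - f(\<infinity>) is an
  invertible operator times (A - \<mu>)^-1, which is injective; if its descent is finite, it is
  bijective and f(\<infinity>) is not in the spectrum.
*)

theory Submission
  imports Defs
begin

section \<open>Riemann--Stieltjes sums\<close>

text \<open>The obstacle is the contour: its curves are merely rectifiable, and their position is
  known only through winding numbers, so no contour can be deformed. The one integral that is
  evaluated directly is that of \<open>1 / (z - \<zeta>)\<close>; everything else about integrals is
  uniform approximation by Riemann-Stieltjes sums, and the remaining Cauchy theory is extracted from
  Liouville arguments. The second of these concerns operator-valued functions. It works with a
  third-order expansion at each point, which the resolvent and a Cauchy transform both provide
  explicitly.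

  The point \<open>\<mu>\<close> is taken outside the closure of \<open>D\<close>, not merely in the
  resolvent set, so that functions with a pole at \<open>\<mu>\<close> belong to the calculus. It
  exists because \<open>f\<close> would otherwise be entire with a finite limit at infinity, hence
  constant. The bounded inverse theorem enters because at \<open>f(\<infinity>)\<close> finite
  descent yields only a bijection, while the resolvent set asks for a bounded inverse.\<close>

instantiation complex :: complex_banach
begin
definition scaleC_complex :: "complex \<Rightarrow> complex \<Rightarrow> complex"
  where "scaleC_complex c x = c * x"
instance
  by standard (simp_all add: scaleC_complex_def algebra_simps norm_mult scaleR_conv_of_real)
end

interpretation scaleC: additive "\<lambda>x. (c::complex) *\<^sub>C (x::'a::complex_banach)"
  by standard (rule scaleC_add_right)
interpretation scaleC_left: additive "\<lambda>c. (c::complex) *\<^sub>C (x::'a::complex_banach)"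
  by standard (rule scaleC_add_left)

lemma scaleC_one [simp]: "1 *\<^sub>C (x::'a::complex_banach) = x"
  using scaleC_of_real [of 1 x] by simp

lemma scaleC_zero_left [simp]: "0 *\<^sub>C (x::'a::complex_banach) = 0"
  using scaleC_of_real [of 0 x] by simp

lemma scaleC_zero_right [simp]: "c *\<^sub>C (0::'a::complex_banach) = 0"
  by (rule scaleC.zero)

lemma scaleC_eq_0_iff [simp]: "c *\<^sub>C (x::'a::complex_banach) = 0 \<longleftrightarrow> c = 0 \<or> x = 0"
  by (metis mult_eq_0_iff norm_eq_zero norm_scaleC)

lemma bounded_bilinear_scaleC: "bounded_bilinear (\<lambda>c (x::'a::complex_banach). c *\<^sub>C x)"
proof (standard, goal_cases)
  case (3 r a b)
  then show ?case
    by (simp flip: scaleC_of_real add: scaleC_scaleC scaleC_complex_def)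
next
  case 5
  then show ?case by (intro exI [of _ 1]) (simp add: norm_scaleC)
qed (simp_all add: scaleC_add_left scaleC_add_right scaleC_scaleR_commute)

lemmas continuous_on_scaleC [continuous_intros] =
  bounded_bilinear.continuous_on [OF bounded_bilinear_scaleC]
lemmas tendsto_scaleC [tendsto_intros] =
  bounded_bilinear.tendsto [OF bounded_bilinear_scaleC]

lemma scaleC_minus_left: "(- c) *\<^sub>C (x::'a::complex_banach) = - (c *\<^sub>C x)"
  by (rule scaleC_left.minus)
lemma scaleC_minus_right: "c *\<^sub>C (- x::'a::complex_banach) = - (c *\<^sub>C x)"
  by (rule scaleC.minus)
lemma scaleC_diff_left: "(c - d) *\<^sub>C (x::'a::complex_banach) = c *\<^sub>C x - d *\<^sub>C x"
  by (rule scaleC_left.diff)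
lemma scaleC_diff_right: "c *\<^sub>C (x - y::'a::complex_banach) = c *\<^sub>C x - c *\<^sub>C y"
  by (rule scaleC.diff)

definition rs_sum :: "(real \<Rightarrow> complex) \<Rightarrow> (real \<times> real set) set \<Rightarrow> (complex \<Rightarrow> 'b::complex_banach) \<Rightarrow> 'b"
  where "rs_sum g p F = (\<Sum>(t, k)\<in>p. (g (Sup k) - g (Inf k)) *\<^sub>C F (g t))"

definition variation_le :: "(real \<Rightarrow> complex) \<Rightarrow> real \<Rightarrow> bool"
  where "variation_le g B \<longleftrightarrow>
    (\<forall>d. d division_of {0..1} \<longrightarrow> (\<Sum>k\<in>d. dist (g (Inf k)) (g (Sup k))) \<le> B)"

lemma variation_le_nonneg: "variation_le g B \<Longrightarrow> 0 \<le> B"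
  using division_of_self [of "0::real" 1]
  unfolding variation_le_def
  by (smt (verit) sum_nonneg zero_le_dist box_real(2) cbox_interval division_of_self atLeastatMost_empty_iff)

lemma variation_le_tagged:
  assumes "variation_le g B" "p tagged_division_of {0..1}"
  shows "(\<Sum>(t, k)\<in>p. cmod (g (Sup k) - g (Inf k))) \<le> B"
proof -
  have ne: "k \<noteq> {}" if "(t, k) \<in> p" for t k
    using that assms(2) by blast
  \<comment> \<open>The values \<open>Sup {}\<close> and \<open>Inf {}\<close> are arbitrary, and
    the side condition of the next step also covers the empty box; hence the guard. Two tags can
    share an interval only if it is degenerate, and then its increment is 0.\<close>
  have "(\<Sum>(t, k)\<in>p. cmod (g (Sup k) - g (Inf k)))
      = (\<Sum>(t, k)\<in>p. if k = {} then 0 else cmod (g (Sup k) - g (Inf k)))"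
    using ne by (intro sum.cong) auto
  also have "\<dots> = (\<Sum>k\<in>snd ` p. if k = {} then 0 else cmod (g (Sup k) - g (Inf k)))"
    by (rule sum.over_tagged_division_lemma [OF assms(2)]) auto
  also have "\<dots> = (\<Sum>k\<in>snd ` p. cmod (g (Sup k) - g (Inf k)))"
    using ne by (intro sum.cong) auto
  also have "\<dots> \<le> B"
    using assms division_of_tagged_division [OF assms(2)]
    by (auto simp: variation_le_def dist_norm norm_minus_commute)
  finally show ?thesis .
qed

text \<open>Intersecting with \<open>{a..b}\<close> amounts to clamping both endpoints by
  \<open>\<lambda>x. max a (min b x)\<close>. If the intervals are disjoint, both endpoints clamp to
  the same value, in agreement with the value 0 given to the empty set.\<close>

lemma interval_increment_inter:
  fixes a b c d :: real and g :: "real \<Rightarrow> complex"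
  assumes "a \<le> b" "c \<le> d"
  defines "\<Delta> \<equiv> \<lambda>k. if k = {} then 0 else g (Sup k) - g (Inf k)"
  shows "\<Delta> ({a..b} \<inter> {c..d}) = g (max a (min b d)) - g (max a (min b c))"
proof (cases "max a c \<le> min b d")
  case True
  then have "{a..b} \<inter> {c..d} = {max a c..min b d}" by auto
  with True assms show ?thesis by (auto simp: \<Delta>_def max_def min_def)
next
  case False
  then have "{a..b} \<inter> {c..d} = {}" by auto
  moreover have "max a (min b d) = max a (min b c)" using False assms by (auto simp: max_def min_def)
  ultimately show ?thesis by (simp add: \<Delta>_def)
qed

lemma tagged_division_of_real_interval:
  fixes a b :: real
  assumes "p tagged_division_of {a..b}" "(t, k) \<in> p"
  obtains c d where "k = {c..d}" "c \<le> d" "a \<le> c" "d \<le> b" "t \<in> {c..d}"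
proof -
  obtain c d where k: "k = cbox c d" using tagged_division_ofD(4) [OF assms] by blast
  have "t \<in> k" "k \<subseteq> {a..b}" using tagged_division_ofD(2,3) [OF assms] by auto
  with k that show ?thesis by (auto simp: cbox_interval)
qed

text \<open>After clamping, the left-hand side is a sum of increments of one function over a
  division, and it telescopes.\<close>

lemma increment_refine:
  fixes g :: "real \<Rightarrow> complex"
  assumes p: "p tagged_division_of {0..1}" and "0 \<le> a" "a \<le> b" "b \<le> 1"
  defines "\<Delta> \<equiv> \<lambda>k. if k = {} then 0 else g (Sup k) - g (Inf k)"
  shows "(\<Sum>(s, l)\<in>p. \<Delta> ({a..b} \<inter> l)) = \<Delta> {a..b}"
proof -
  define h where "h = (\<lambda>x. g (max a (min b x)))"
  have "(\<Sum>(s, l)\<in>p. \<Delta> ({a..b} \<inter> l)) = (\<Sum>(s, l)\<in>p. h (Sup l) - h (Inf l))"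
  proof (rule sum.cong [OF refl], clarify)
    fix s l assume "(s, l) \<in> p"
    then obtain c d where "l = {c..d}" "c \<le> d" by (rule tagged_division_of_real_interval [OF p])
    then show "\<Delta> ({a..b} \<inter> l) = h (Sup l) - h (Inf l)"
      using interval_increment_inter [of a b c d g] \<open>a \<le> b\<close> unfolding h_def \<Delta>_def by (simp only: cSup_atLeastAtMost cInf_atLeastAtMost)
  qed
  also have "\<dots> = h 1 - h 0" by (rule additive_tagged_division_1 [OF _ p]) simp
  also have "max a (min b 1) = b" "max a (min b 0) = a" using assms(2-4) by (auto simp: max_def min_def)
  then have "h 1 - h 0 = \<Delta> {a..b}" using assms(3) by (simp add: h_def \<Delta>_def)
  finally show ?thesis .
qed

text \<open>The nonempty intersections form a single division of \<open>{0..1}\<close>, to which the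
  bound applies. Passing from pairs to sets may identify several pairs, but a set that arises twice
  has empty interior and hence increment 0.\<close>

lemma variation_le_refine:
  fixes g :: "real \<Rightarrow> complex"
  assumes g: "variation_le g B" and p: "p tagged_division_of {0..1}" and q: "q tagged_division_of {0..1}"
  defines "\<Delta> \<equiv> \<lambda>k. if k = {} then 0 else g (Sup k) - g (Inf k)"
  shows "(\<Sum>(t, k)\<in>p. \<Sum>(s, l)\<in>q. cmod (\<Delta> (k \<inter> l))) \<le> B"
proof -
  let ?P = "snd ` p" and ?Q = "snd ` q"
  have P: "?P division_of {0..1}" and Q: "?Q division_of {0..1}"
    using division_of_tagged_division p q by auto
  have fin: "finite ?P" "finite ?Q" using P Q by auto
  have deg: "\<Delta> k = 0" if "k = {a..b}" "interior k = {}" for k and a b :: real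
    using that by (cases "a < b") (auto simp: \<Delta>_def not_less)
  have ivl: "\<exists>a b::real. k = {a..b}" if "k \<in> ?P \<or> k \<in> ?Q" for k
    using that P Q by (metis division_ofD(4) cbox_interval)
  have ivl2: "\<exists>a b::real. k \<inter> l = {a..b}" if "k \<in> ?P" "l \<in> ?Q" for k l
    using ivl that by (metis Int_atLeastAtMost)
  have "(\<Sum>(t, k)\<in>p. \<Sum>(s, l)\<in>q. cmod (\<Delta> (k \<inter> l))) = (\<Sum>(t, k)\<in>p. \<Sum>l\<in>?Q. cmod (\<Delta> (k \<inter> l)))"
  proof (rule sum.cong [OF refl], clarify)
    fix t k assume "(t, k) \<in> p"
    then have k: "k \<in> ?P" by force
    show "(\<Sum>(s, l)\<in>q. cmod (\<Delta> (k \<inter> l))) = (\<Sum>l\<in>?Q. cmod (\<Delta> (k \<inter> l)))"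
    proof (rule sum.over_tagged_division_lemma [OF q])
      fix u v :: real assume "box u v = {}"
      then have "interior (k \<inter> cbox u v) = {}" by simp
      then show "cmod (\<Delta> (k \<inter> cbox u v)) = 0"
        using deg ivl [of k] k by (metis Int_atLeastAtMost cbox_interval norm_zero)
    qed
  qed
  also have "\<dots> = (\<Sum>k\<in>?P. \<Sum>l\<in>?Q. cmod (\<Delta> (k \<inter> l)))"
  proof (rule sum.over_tagged_division_lemma [OF p])
    fix u v :: real assume "box u v = {}"
    then have "interior (cbox u v \<inter> l) = {}" for l by simp
    then show "(\<Sum>l\<in>?Q. cmod (\<Delta> (cbox u v \<inter> l))) = 0"
      using deg ivl by (intro sum.neutral) (metis Int_atLeastAtMost cbox_interval norm_zero)
  qed
  also have "\<dots> = (\<Sum>(k, l)\<in>?P \<times> ?Q. cmod (\<Delta> (k \<inter> l)))"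
    by (simp add: sum.cartesian_product)
  also have "\<dots> = (\<Sum>m\<in>(\<lambda>(k, l). k \<inter> l) ` (?P \<times> ?Q). cmod (\<Delta> m))"
  proof (subst sum.reindex_nontrivial)
    fix x y
    assume x: "x \<in> ?P \<times> ?Q" and y: "y \<in> ?P \<times> ?Q" and "x \<noteq> y"
      and eq: "(case x of (k, l) \<Rightarrow> k \<inter> l) = (case y of (k, l) \<Rightarrow> k \<inter> l)"
    obtain k l k' l' where [simp]: "x = (k, l)" "y = (k', l')" by (cases x, cases y)
    have kl: "k \<in> ?P" "k' \<in> ?P" "l \<in> ?Q" "l' \<in> ?Q" "k \<inter> l = k' \<inter> l'" using x y eq by auto
    have "interior k \<inter> interior k' = {} \<or> interior l \<inter> interior l' = {}"
      using \<open>x \<noteq> y\<close> division_ofD(5) [OF P kl(1,2)] division_ofD(5) [OF Q kl(3,4)] by auto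
    moreover have "interior (k \<inter> l) \<subseteq> interior k \<inter> interior k'" "interior (k \<inter> l) \<subseteq> interior l \<inter> interior l'"
      using kl(5) by (metis inf.bounded_iff interior_mono inf_le1 inf_le2)+
    ultimately have "interior (k \<inter> l) = {}" by blast
    then have "\<Delta> (k \<inter> l) = 0"
      using deg ivl2 [OF kl(1,3)] by blast
    then show "cmod (\<Delta> (case x of (k, l) \<Rightarrow> k \<inter> l)) = 0"
      by simp
  qed (use fin in \<open>auto simp: case_prod_unfold\<close>)
  also have "\<dots> = (\<Sum>m\<in>{k \<inter> l |k l. k \<in> ?P \<and> l \<in> ?Q \<and> k \<inter> l \<noteq> {}}. cmod (\<Delta> m))"
    using fin by (intro sum.mono_neutral_right) (auto simp: \<Delta>_def)
  also have "\<dots> = (\<Sum>m\<in>{k \<inter> l |k l. k \<in> ?P \<and> l \<in> ?Q \<and> k \<inter> l \<noteq> {}}. dist (g (Inf m)) (g (Sup m)))"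
    by (intro sum.cong) (auto simp: \<Delta>_def dist_norm norm_minus_commute)
  also have "\<dots> \<le> B"
    using g division_inter [OF P Q] unfolding variation_le_def by simp
  finally show ?thesis .
qed

text \<open>On the common refinement both sums have the same increments and differ only in the tags,
  and tags are compared only where their intervals meet. Existence, error bounds and uniformity of
  integrals all rest on this estimate.\<close>

lemma rs_sum_diff_le:
  assumes g: "variation_le g B" and p: "p tagged_division_of {0..1}" and q: "q tagged_division_of {0..1}"
    and osc: "\<And>t k s l. (t, k) \<in> p \<Longrightarrow> (s, l) \<in> q \<Longrightarrow> k \<inter> l \<noteq> {} \<Longrightarrow> norm (F (g t) - F (g s)) \<le> e"
    and "0 \<le> e"
  shows "norm (rs_sum g p F - rs_sum g q F) \<le> e * B"
proof -
  define \<Delta> where "\<Delta> = (\<lambda>k. if k = {} then 0 else g (Sup k) - g (Inf k))"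
  have ref: "(\<Sum>(s, l)\<in>q. \<Delta> (k \<inter> l)) = g (Sup k) - g (Inf k)"
    if p: "p tagged_division_of {0..1}" and q: "q tagged_division_of {0..1}" and tk: "(t, k) \<in> p" for p q t k
  proof -
    obtain a b where "k = {a..b}" "a \<le> b" "0 \<le> a" "b \<le> 1"
      using tk by (rule tagged_division_of_real_interval [OF p])
    then show ?thesis using increment_refine [OF q, of a b g] by (simp add: \<Delta>_def)
  qed
  have "rs_sum g p F = (\<Sum>(t, k)\<in>p. \<Sum>(s, l)\<in>q. \<Delta> (k \<inter> l) *\<^sub>C F (g t))"
    unfolding rs_sum_def
    by (intro sum.cong) (auto simp: ref [OF p q, symmetric] scaleC_left.sum case_prod_unfold)
  moreover have "rs_sum g q F = (\<Sum>(s, l)\<in>q. \<Sum>(t, k)\<in>p. \<Delta> (k \<inter> l) *\<^sub>C F (g s))"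
    unfolding rs_sum_def
    by (intro sum.cong) (auto simp: ref [OF q p, symmetric] scaleC_left.sum case_prod_unfold Int_commute)
  then have "rs_sum g q F = (\<Sum>(t, k)\<in>p. \<Sum>(s, l)\<in>q. \<Delta> (k \<inter> l) *\<^sub>C F (g s))"
    by (simp add: case_prod_unfold sum.swap [of _ p q])
  ultimately have "rs_sum g p F - rs_sum g q F
      = (\<Sum>(t, k)\<in>p. \<Sum>(s, l)\<in>q. \<Delta> (k \<inter> l) *\<^sub>C (F (g t) - F (g s)))"
    by (simp add: scaleC_diff_right sum_subtractf case_prod_unfold)
  also have "norm \<dots> \<le> (\<Sum>(t, k)\<in>p. \<Sum>(s, l)\<in>q. e * cmod (\<Delta> (k \<inter> l)))"
  proof (intro sum_norm_le, clarify, intro sum_norm_le, clarify)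
    fix t k s l assume "(t, k) \<in> p" "(s, l) \<in> q"
    then show "norm (\<Delta> (k \<inter> l) *\<^sub>C (F (g t) - F (g s))) \<le> e * cmod (\<Delta> (k \<inter> l))"
      using osc [of t k s l] by (cases "k \<inter> l = {}") (auto simp: \<Delta>_def norm_scaleC mult.commute mult_right_mono)
  qed
  also have "\<dots> = e * (\<Sum>(t, k)\<in>p. \<Sum>(s, l)\<in>q. cmod (\<Delta> (k \<inter> l)))"
    by (simp add: sum_distrib_left case_prod_unfold)
  also have "\<dots> \<le> e * B"
    using variation_le_refine [OF g p q] \<open>0 \<le> e\<close> by (simp add: \<Delta>_def mult_left_mono)
  finally show ?thesis .
qed

section \<open>Path integrals\<close>

lemma fine_tagged_division_exists:
  assumes "0 < (d::real)"
  obtains p where "p tagged_division_of {0..1::real}" "(\<lambda>t. ball t d) fine p"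
  using fine_division_exists_real [of "\<lambda>t. ball t d" 0 1] assms gauge_ball by metis

lemma has_path_integral_tendsto:
  "has_path_integral F I g \<longleftrightarrow>
    (\<forall>e>0. \<exists>d>0. \<forall>p. p tagged_division_of {0..1} \<and> (\<lambda>t. ball t d) fine p \<longrightarrow> norm (rs_sum g p F - I) < e)"
  unfolding has_path_integral_def rs_sum_def ..

lemma has_path_integralE:
  assumes "has_path_integral F I g" "0 < e"
  obtains d where "0 < d" "\<And>p. p tagged_division_of {0..1} \<Longrightarrow> (\<lambda>t. ball t d) fine p \<Longrightarrow>
      norm (rs_sum g p F - I) < e"
proof -
  from assms(1) [unfolded has_path_integral_tendsto, rule_format, OF assms(2)]
  obtain d where d: "d > 0" "\<forall>p. p tagged_division_of {0..1} \<and> (\<lambda>t. ball t d) fine p \<longrightarrow> norm (rs_sum g p F - I) < e"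
    by (elim exE conjE) (rule that)
  show ?thesis by (rule that [OF d(1)], rule d(2) [rule_format], rule conjI)
qed

lemma fine_ball_mono:
  assumes "(\<lambda>t. ball t d) fine p" "d \<le> d'"
  shows "(\<lambda>t. ball t d') fine p"
  using assms subset_ball unfolding fine_def by blast

lemma has_path_integral_unique:
  assumes "has_path_integral F I g" "has_path_integral F J g"
  shows "I = J"
proof (rule ccontr)
  assume "I \<noteq> J"
  then have e: "norm (I - J) / 2 > 0" by simp
  obtain d1 where d1: "d1 > 0" "\<And>p. p tagged_division_of {0..1} \<Longrightarrow> (\<lambda>t. ball t d1) fine p \<Longrightarrow>
      norm (rs_sum g p F - I) < norm (I - J) / 2"
    by (rule has_path_integralE [OF assms(1) e]) (rule that)
  obtain d2 where d2: "d2 > 0" "\<And>p. p tagged_division_of {0..1} \<Longrightarrow> (\<lambda>t. ball t d2) fine p \<Longrightarrow>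
      norm (rs_sum g p F - J) < norm (I - J) / 2"
    by (rule has_path_integralE [OF assms(2) e]) (rule that)
  obtain p where p: "p tagged_division_of {0..1::real}" "(\<lambda>t. ball t (min d1 d2)) fine p"
    using fine_tagged_division_exists d1(1) d2(1) by (metis min_less_iff_conj)
  have "(\<lambda>t. ball t d1) fine p" "(\<lambda>t. ball t d2) fine p"
    using fine_ball_mono [OF p(2)] by simp_all
  then have "norm (rs_sum g p F - I) < norm (I - J) / 2" "norm (rs_sum g p F - J) < norm (I - J) / 2"
    using d1 d2 p by auto
  moreover have "I - J = (rs_sum g p F - J) - (rs_sum g p F - I)" by simp
  ultimately show False by (smt (verit) field_sum_of_halves norm_triangle_ineq4)
qed

lemma path_integral_eqI: "has_path_integral F I g \<Longrightarrow> path_integral g F = I"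
  unfolding path_integral_def by (blast intro: has_path_integral_unique the_equality)

text \<open>A common point of two fine intervals lies within \<open>d\<close> of both tags. This is
  the origin of the factor 2 in the oscillation hypotheses.\<close>

lemma fine_tags_close:
  assumes p: "p tagged_division_of {0..1::real}" "(\<lambda>t. ball t d) fine p"
    and q: "q tagged_division_of {0..1}" "(\<lambda>t. ball t d) fine q"
    and "(t, k) \<in> p" "(s, l) \<in> q" "k \<inter> l \<noteq> {}"
  shows "t \<in> {0..1}" "s \<in> {0..1}" "\<bar>t - s\<bar> < 2 * d"
proof -
  show "t \<in> {0..1}" "s \<in> {0..1}"
    using tag_in_interval [OF p(1)] tag_in_interval [OF q(1)] assms(5,6) by auto
  obtain x where "x \<in> k" "x \<in> l" using assms by blast
  then have "x \<in> ball t d" "x \<in> ball s d"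
    using fineD [OF p(2) assms(5)] fineD [OF q(2) assms(6)] by blast+
  then show "\<bar>t - s\<bar> < 2 * d" by (auto simp: dist_real_def)
qed

text \<open>The bound involves \<open>F\<close> only through its oscillation along \<open>g\<close>,
  so it is uniform over any family of integrands with a common modulus of continuity.\<close>

lemma rs_sum_close:
  assumes g: "variation_le g B" and I: "has_path_integral F I g"
    and osc: "\<And>t s. t \<in> {0..1} \<Longrightarrow> s \<in> {0..1} \<Longrightarrow> \<bar>t - s\<bar> < 2 * d \<Longrightarrow> norm (F (g t) - F (g s)) \<le> e"
    and "0 < d" "0 \<le> e"
    and p: "p tagged_division_of {0..1}" "(\<lambda>t. ball t d) fine p"
  shows "norm (rs_sum g p F - I) \<le> e * B"
proof (rule field_le_epsilon)
  fix r :: real assume r: "0 < r"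
  obtain d' where d': "d' > 0" "\<And>p. p tagged_division_of {0..1} \<Longrightarrow> (\<lambda>t. ball t d') fine p \<Longrightarrow>
      norm (rs_sum g p F - I) < r"
    by (rule has_path_integralE [OF I r]) (rule that)
  obtain q where q: "q tagged_division_of {0..1::real}" "(\<lambda>t. ball t (min d d')) fine q"
    using fine_tagged_division_exists d'(1) \<open>0 < d\<close> by (metis min_less_iff_conj)
  then have q': "(\<lambda>t. ball t d) fine q" "(\<lambda>t. ball t d') fine q" using fine_ball_mono [OF q(2)] by simp_all
  have "norm (rs_sum g p F - rs_sum g q F) \<le> e * B"
  proof (rule rs_sum_diff_le [OF g p(1) q(1) _ \<open>0 \<le> e\<close>])
    fix t k s l assume "(t, k) \<in> p" "(s, l) \<in> q" "k \<inter> l \<noteq> {}"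
    then show "norm (F (g t) - F (g s)) \<le> e"
      using fine_tags_close [OF p q(1) q'(1)] osc by blast
  qed
  moreover have "norm (rs_sum g q F - I) < r" using d' q q' by blast
  ultimately show "norm (rs_sum g p F - I) \<le> e * B + r"
    using norm_triangle_ineq [of "rs_sum g p F - rs_sum g q F" "rs_sum g q F - I"] by simp
qed

lemma path_uniform_modulus:
  assumes "path g" "continuous_on (path_image g) F" "0 < (e::real)"
  obtains d where "0 < d" "\<And>t s. t \<in> {0..1} \<Longrightarrow> s \<in> {0..1} \<Longrightarrow> \<bar>t - s\<bar> < 2 * d \<Longrightarrow> norm (F (g t) - F (g s)) \<le> e"
proof -
  have "continuous_on {0..1} (F \<circ> g)"
    using assms by (intro continuous_on_compose) (auto simp: path_def path_image_def)
  then have "uniformly_continuous_on {0..1} (F \<circ> g)"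
    by (intro compact_uniformly_continuous) auto
  then obtain d where "0 < d" "\<And>t s. t \<in> {0..1} \<Longrightarrow> s \<in> {0..1} \<Longrightarrow> dist s t < d \<Longrightarrow> dist (F (g s)) (F (g t)) < e"
    using assms(3) unfolding uniformly_continuous_on_def comp_def by metis
  then show ?thesis
    by (intro that [of "d/2"]) (auto simp: dist_norm less_eq_real_def)
qed

lemma has_path_integral_exists:
  fixes F :: "complex \<Rightarrow> 'b::complex_banach"
  assumes g: "path g" "variation_le g B" and F: "continuous_on (path_image g) F"
  shows "\<exists>I. has_path_integral F I g"
proof -
  have B: "0 \<le> B" using g variation_le_nonneg by blast
  have "\<exists>p. p tagged_division_of {0..1::real} \<and> (\<lambda>t. ball t (1 / real (Suc n))) fine p" for n
    by (rule fine_tagged_division_exists [of "1 / real (Suc n)"]) auto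
  then obtain p where p: "\<And>n. p n tagged_division_of {0..1::real}"
      "\<And>n. (\<lambda>t. ball t (1 / real (Suc n))) fine p n" by metis
  have close: "\<exists>d>0. \<forall>q q' :: (real \<times> real set) set. q tagged_division_of {0..1} \<and> (\<lambda>t. ball t d) fine q \<and>
      q' tagged_division_of {0..1} \<and> (\<lambda>t. ball t d) fine q' \<longrightarrow> norm (rs_sum g q F - rs_sum g q' F) < e"
    if "0 < e" for e
  proof -
    \<comment> \<open>Dividing by \<open>B + 1\<close> instead of \<open>B\<close> covers a curve of
      variation 0 and makes the final estimate strict.\<close>
    have e': "0 < e / (B + 1)" using that B by simp
    obtain d where d: "0 < d" "\<And>t s. t \<in> {0..1} \<Longrightarrow> s \<in> {0..1} \<Longrightarrow> \<bar>t - s\<bar> < 2 * d \<Longrightarrow> norm (F (g t) - F (g s)) \<le> e / (B + 1)"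
      using path_uniform_modulus [OF g(1) F e'] by blast
    have "e / (B + 1) * B < e" using B that by (simp add: field_simps)
    moreover have "norm (rs_sum g q F - rs_sum g q' F) \<le> e / (B + 1) * B"
      if q: "q tagged_division_of {0..1}" "(\<lambda>t. ball t d) fine q" "q' tagged_division_of {0..1}" "(\<lambda>t. ball t d) fine q'" for q q' :: "(real \<times> real set) set"
    proof (rule rs_sum_diff_le [OF g(2) q(1) q(3)])
      fix t k s l assume "(t, k) \<in> q" "(s, l) \<in> q'" "k \<inter> l \<noteq> {}"
      then show "norm (F (g t) - F (g s)) \<le> e / (B + 1)"
        using fine_tags_close [OF q] d(2) by blast
    qed (use e' in simp)
    ultimately show ?thesis using d(1) by (intro exI [of _ d]) (auto intro: order.strict_trans1)
  qed
  have fine_mono: "(\<lambda>t. ball t d) fine p n" if "1 / real (Suc N) \<le> d" "N \<le> n" for n N d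
  proof -
    have "1 / real (Suc n) \<le> 1 / real (Suc N)" using that by (simp add: frac_le)
    then have "1 / real (Suc n) \<le> d" using that by linarith
    then show ?thesis by (rule fine_ball_mono [OF p(2)])
  qed
  have "Cauchy (\<lambda>n. rs_sum g (p n) F)"
  proof (rule CauchyI)
    fix e :: real assume "0 < e"
    from close [OF this] obtain d where d: "d > 0" "\<forall>q q' :: (real \<times> real set) set. q tagged_division_of {0..1} \<and> (\<lambda>t. ball t d) fine q \<and>
      q' tagged_division_of {0..1} \<and> (\<lambda>t. ball t d) fine q' \<longrightarrow> norm (rs_sum g q F - rs_sum g q' F) < e"
      by (elim exE conjE) (rule that)
    obtain N where "1 / real (Suc N) < d" using d(1) nat_approx_posE by blast
    then show "\<exists>M. \<forall>m\<ge>M. \<forall>n\<ge>M. norm (rs_sum g (p m) F - rs_sum g (p n) F) < e"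
      using fine_mono [of N d] p(1)
      by (intro exI [of _ N] allI impI d(2) [rule_format] conjI) auto
  qed
  then obtain I where I: "(\<lambda>n. rs_sum g (p n) F) \<longlonglongrightarrow> I"
    using Cauchy_convergent_iff convergent_def by blast
  have "has_path_integral F I g"
    unfolding has_path_integral_def rs_sum_def [symmetric]
  proof (intro allI impI)
    fix e :: real assume "0 < e"
    then have "0 < e / 2" by simp
    from close [OF this] obtain d where d: "d > 0" "\<forall>q q' :: (real \<times> real set) set. q tagged_division_of {0..1} \<and> (\<lambda>t. ball t d) fine q \<and>
      q' tagged_division_of {0..1} \<and> (\<lambda>t. ball t d) fine q' \<longrightarrow> norm (rs_sum g q F - rs_sum g q' F) < e / 2"
      by (elim exE conjE) (rule that)
    obtain N where N: "1 / real (Suc N) < d" using d(1) nat_approx_posE by blast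
    show "\<exists>d>0. \<forall>p. p tagged_division_of {0..1} \<and> (\<lambda>t. ball t d) fine p \<longrightarrow> norm (rs_sum g p F - I) < e"
    proof (intro exI [of _ d] conjI allI impI d(1))
      fix q :: "(real \<times> real set) set" assume q: "q tagged_division_of {0..1} \<and> (\<lambda>t. ball t d) fine q"
      have "(\<lambda>n. norm (rs_sum g q F - rs_sum g (p n) F)) \<longlonglongrightarrow> norm (rs_sum g q F - I)"
        by (intro tendsto_intros I)
      moreover have "norm (rs_sum g q F - rs_sum g (p n) F) \<le> e / 2" if "n \<ge> N" for n
        using d(2) [rule_format, of q "p n"] q p(1) fine_mono [OF less_imp_le [OF N] that] by (simp add: less_imp_le)
      then have "\<forall>\<^sub>F n in sequentially. norm (rs_sum g q F - rs_sum g (p n) F) \<le> e / 2"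
        using eventually_sequentially by blast
      ultimately have "norm (rs_sum g q F - I) \<le> e / 2"
        by (rule tendsto_upperbound) simp
      then show "norm (rs_sum g q F - I) < e" using \<open>0 < e\<close> by simp
    qed
  qed
  then show ?thesis ..
qed

lemma rs_sum_add: "rs_sum g p (\<lambda>z. F z + G z) = rs_sum g p F + rs_sum g p G"
  unfolding rs_sum_def by (simp add: case_prod_unfold scaleC_add_right sum.distrib)

lemma rs_sum_map:
  assumes "linear \<Psi>" "\<And>c x. \<Psi> (c *\<^sub>C x) = c *\<^sub>C \<Psi> x"
  shows "rs_sum g p (\<lambda>z. \<Psi> (F z)) = \<Psi> (rs_sum g p F)"
  unfolding rs_sum_def by (simp add: case_prod_unfold assms linear_sum [OF assms(1)])

lemma rs_sum_norm_le:
  assumes "variation_le g B" "p tagged_division_of {0..1}" "\<And>z. z \<in> path_image g \<Longrightarrow> norm (F z) \<le> M"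
  shows "norm (rs_sum g p F) \<le> M * B"
proof -
  have "norm (rs_sum g p F) \<le> (\<Sum>(t, k)\<in>p. M * cmod (g (Sup k) - g (Inf k)))"
    unfolding rs_sum_def
  proof (intro sum_norm_le, clarify)
    fix t k assume "(t, k) \<in> p"
    then have "t \<in> {0..1}" by (rule tag_in_interval [OF assms(2)])
    then show "norm ((g (Sup k) - g (Inf k)) *\<^sub>C F (g t)) \<le> M * cmod (g (Sup k) - g (Inf k))"
      using assms(3) [of "g t"] by (simp add: norm_scaleC mult.commute mult_right_mono path_image_def)
  qed
  also have "\<dots> = M * (\<Sum>(t, k)\<in>p. cmod (g (Sup k) - g (Inf k)))"
    by (simp add: sum_distrib_left case_prod_unfold)
  also have "\<dots> \<le> M * B"
  proof (rule mult_left_mono [OF variation_le_tagged [OF assms(1,2)]])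
    have "g 0 \<in> path_image g" by (simp add: path_image_def)
    then show "0 \<le> M" using assms(3) norm_ge_zero order_trans by blast
  qed
  finally show ?thesis .
qed

lemma has_path_integral_approx:
  assumes "has_path_integral F I g" "0 < e" "0 < d"
  obtains p where "p tagged_division_of {0..1::real}" "(\<lambda>t. ball t d) fine p" "norm (rs_sum g p F - I) < e"
proof -
  obtain d' where d': "d' > 0" "\<And>p. p tagged_division_of {0..1} \<Longrightarrow> (\<lambda>t. ball t d') fine p \<Longrightarrow>
      norm (rs_sum g p F - I) < e"
    by (rule has_path_integralE [OF assms(1,2)]) (rule that)
  obtain q where q: "q tagged_division_of {0..1::real}" "(\<lambda>t. ball t (min d d')) fine q"
    using fine_tagged_division_exists d'(1) \<open>0 < d\<close> by (metis min_less_iff_conj)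
  then have "(\<lambda>t. ball t d) fine q" "(\<lambda>t. ball t d') fine q" using fine_ball_mono [OF q(2)] by simp_all
  with d' q that show ?thesis by blast
qed

lemma has_path_integral_add:
  assumes "has_path_integral F I g" "has_path_integral G J g"
  shows "has_path_integral (\<lambda>z. F z + G z) (I + J) g"
  unfolding has_path_integral_tendsto
proof (intro allI impI)
  fix e :: real assume "0 < e"
  then have e: "0 < e / 2" by simp
  obtain d1 where d1: "d1 > 0" "\<And>p. p tagged_division_of {0..1} \<Longrightarrow> (\<lambda>t. ball t d1) fine p \<Longrightarrow>
      norm (rs_sum g p F - I) < e / 2"
    by (rule has_path_integralE [OF assms(1) e]) (rule that)
  obtain d2 where d2: "d2 > 0" "\<And>p. p tagged_division_of {0..1} \<Longrightarrow> (\<lambda>t. ball t d2) fine p \<Longrightarrow>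
      norm (rs_sum g p G - J) < e / 2"
    by (rule has_path_integralE [OF assms(2) e]) (rule that)
  show "\<exists>d>0. \<forall>p. p tagged_division_of {0..1} \<and> (\<lambda>t. ball t d) fine p \<longrightarrow>
      norm (rs_sum g p (\<lambda>z. F z + G z) - (I + J)) < e"
  proof (intro exI [of _ "min d1 d2"] conjI allI impI)
    fix p :: "(real \<times> real set) set" assume p: "p tagged_division_of {0..1} \<and> (\<lambda>t. ball t (min d1 d2)) fine p"
    then have "(\<lambda>t. ball t d1) fine p" "(\<lambda>t. ball t d2) fine p"
      using fine_ball_mono [of "min d1 d2" p] by simp_all
    then have "norm (rs_sum g p F - I) < e / 2" "norm (rs_sum g p G - J) < e / 2"
      using d1 d2 p by auto
    then show "norm (rs_sum g p (\<lambda>z. F z + G z) - (I + J)) < e"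
      unfolding rs_sum_add using norm_diff_triangle_ineq [of "rs_sum g p F" "rs_sum g p G" I J] by simp
  qed (use d1 d2 in auto)
qed

text \<open>\<open>bounded_linear\<close> means real linearity, while the increments of
  \<open>g\<close> are complex scalars; complex homogeneity is therefore asked for
  separately.\<close>

lemma has_path_integral_map:
  assumes "has_path_integral F I g" "bounded_linear \<Psi>" "\<And>c x. \<Psi> (c *\<^sub>C x) = c *\<^sub>C \<Psi> x"
  shows "has_path_integral (\<lambda>z. \<Psi> (F z)) (\<Psi> I) g"
  unfolding has_path_integral_tendsto
proof (intro allI impI)
  fix e :: real assume "0 < e"
  interpret \<Psi>: bounded_linear \<Psi> by fact
  obtain K where K: "0 < K" "\<And>x. norm (\<Psi> x) \<le> norm x * K" using \<Psi>.pos_bounded by blast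
  then have e: "0 < e / K" using \<open>0 < e\<close> by simp
  obtain d where d: "d > 0" "\<And>p. p tagged_division_of {0..1} \<Longrightarrow> (\<lambda>t. ball t d) fine p \<Longrightarrow>
      norm (rs_sum g p F - I) < e / K"
    by (rule has_path_integralE [OF assms(1) e]) (rule that)
  have "norm (rs_sum g p (\<lambda>z. \<Psi> (F z)) - \<Psi> I) < e" if "norm (rs_sum g p F - I) < e / K" for p
  proof -
    have "rs_sum g p (\<lambda>z. \<Psi> (F z)) - \<Psi> I = \<Psi> (rs_sum g p F - I)"
      by (simp add: rs_sum_map [OF \<Psi>.linear_axioms assms(3)] \<Psi>.diff)
    also have "norm \<dots> \<le> norm (rs_sum g p F - I) * K" by (rule K)
    also have "\<dots> < e" using that K by (simp add: field_simps)
    finally show ?thesis .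
  qed
  then show "\<exists>d>0. \<forall>p. p tagged_division_of {0..1} \<and> (\<lambda>t. ball t d) fine p \<longrightarrow>
      norm (rs_sum g p (\<lambda>z. \<Psi> (F z)) - \<Psi> I) < e"
    using d by blast
qed

lemma has_path_integral_norm_le:
  assumes "has_path_integral F I g" "variation_le g B" "\<And>z. z \<in> path_image g \<Longrightarrow> norm (F z) \<le> M"
  shows "norm I \<le> M * B"
proof (rule field_le_epsilon)
  fix e :: real assume "0 < e"
  obtain p where "p tagged_division_of {0..1::real}" "norm (rs_sum g p F - I) < e"
    by (rule has_path_integral_approx [OF assms(1) \<open>0 < e\<close> zero_less_one]) (rule that)
  note p = this
  have "norm (rs_sum g p F) \<le> M * B" by (rule rs_sum_norm_le [OF assms(2) p(1) assms(3)])
  moreover have "norm I \<le> norm (rs_sum g p F) + norm (rs_sum g p F - I)"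
    using norm_triangle_ineq4 [of "rs_sum g p F" "rs_sum g p F - I"] by simp
  ultimately show "norm I \<le> M * B + e" using p(2) by linarith
qed

lemma has_path_integral_cong:
  assumes "\<And>z. z \<in> path_image g \<Longrightarrow> F z = G z"
  shows "has_path_integral F I g \<longleftrightarrow> has_path_integral G I g"
proof -
  have "rs_sum g p F = rs_sum g p G" if "p tagged_division_of {0..1}" for p
    unfolding rs_sum_def
  proof (rule sum.cong [OF refl], clarify)
    fix t k assume "(t, k) \<in> p"
    then have "t \<in> {0..1}" by (rule tag_in_interval [OF that])
    then show "(g (Sup k) - g (Inf k)) *\<^sub>C F (g t) = (g (Sup k) - g (Inf k)) *\<^sub>C G (g t)"
      using assms by (simp add: path_image_def)
  qed
  then show ?thesis unfolding has_path_integral_tendsto by (simp cong: conj_cong imp_cong)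
qed

section \<open>Parameters and iterated integrals\<close>

lemma rectifiable_pathD:
  assumes "rectifiable_path g"
  shows "path g" and "\<exists>B. variation_le g B"
  using assms unfolding rectifiable_path_def variation_le_def by auto

lemma has_path_integral_path_integral:
  assumes "rectifiable_path g" "continuous_on (path_image g) F"
  shows "has_path_integral F (path_integral g F) g"
  using has_path_integral_exists rectifiable_pathD [OF assms(1)] assms(2) path_integral_eqI by metis

lemma fine_tagged_sequence_exists:
  obtains p where "\<And>n. p n tagged_division_of {0..1::real}"
    "\<And>n. (\<lambda>t. ball t (1 / real (Suc n))) fine p n"
proof -
  have "\<exists>p. p tagged_division_of {0..1::real} \<and> (\<lambda>t. ball t (1 / real (Suc n))) fine p" for n
    by (rule fine_tagged_division_exists [of "1 / real (Suc n)"]) auto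
  then show ?thesis using that by metis
qed

lemma continuous_on_slice:
  assumes "continuous_on (A \<times> S) (\<lambda>(z, w). G z w)"
  shows "w \<in> S \<Longrightarrow> continuous_on A (\<lambda>z. G z w)" and "z \<in> A \<Longrightarrow> continuous_on S (\<lambda>w. G z w)"
proof -
  show "continuous_on A (\<lambda>z. G z w)" if "w \<in> S"
  proof -
    have "continuous_on A ((\<lambda>(z, w). G z w) \<circ> (\<lambda>z. (z, w)))"
      by (intro continuous_on_compose continuous_intros continuous_on_subset [OF assms]) (use that in auto)
    then show ?thesis by (simp add: comp_def)
  qed
  show "continuous_on S (\<lambda>w. G z w)" if "z \<in> A"
  proof -
    have "continuous_on S ((\<lambda>(z, w). G z w) \<circ> (\<lambda>w. (z, w)))"
      by (intro continuous_on_compose continuous_intros continuous_on_subset [OF assms]) (use that in auto)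
    then show ?thesis by (simp add: comp_def)
  qed
qed

text \<open>The pullback to the compact set \<open>{0..1} \<times> S\<close> is uniformly
  continuous, which gives one modulus of continuity for all parameters. Continuity and holomorphy in
  a parameter and the interchange of integrals are all read off from this convergence.\<close>

lemma rs_sum_uniform_limit:
  fixes G :: "complex \<Rightarrow> 'c::metric_space \<Rightarrow> 'b::complex_banach"
  assumes g: "rectifiable_path g" and S: "compact S"
    and G: "continuous_on (path_image g \<times> S) (\<lambda>(z, w). G z w)"
    and p: "\<And>n. p n tagged_division_of {0..1::real}" "\<And>n. (\<lambda>t. ball t (1 / real (Suc n))) fine p n"
  shows "uniform_limit S (\<lambda>n w. rs_sum g (p n) (\<lambda>z. G z w)) (\<lambda>w. path_integral g (\<lambda>z. G z w)) sequentially"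
proof (rule uniform_limitI)
  fix e :: real assume "0 < e"
  obtain B where B: "variation_le g B" using rectifiable_pathD [OF g] by blast
  have B0: "0 \<le> B" using B variation_le_nonneg by blast
  have "continuous_on ({0..1} \<times> S) ((\<lambda>(z, w). G z w) \<circ> (\<lambda>(t, w). (g t, w)))"
  proof (rule continuous_on_compose)
    have "continuous_on {0..1} g" using rectifiable_pathD(1) [OF g] by (simp add: path_def)
    then show "continuous_on ({0..1} \<times> S) (\<lambda>(t, w). (g t, w))"
      unfolding case_prod_unfold
      by (intro continuous_intros continuous_on_compose2 [where f = fst and g = g]) auto
    show "continuous_on ((\<lambda>(t, w). (g t, w)) ` ({0..1} \<times> S)) (\<lambda>(z, w). G z w)"
      by (rule continuous_on_subset [OF G]) (auto simp: path_image_def)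
  qed
  then have "uniformly_continuous_on ({0..1} \<times> S) ((\<lambda>(z, w). G z w) \<circ> (\<lambda>(t, w). (g t, w)))"
    by (intro compact_uniformly_continuous compact_Times S) auto
  moreover have e': "0 < e / (B + 1)" using \<open>0 < e\<close> B0 by simp
  ultimately obtain d where d: "0 < d" "\<forall>x\<in>{0..1}\<times>S. \<forall>x'\<in>{0..1}\<times>S. dist x' x < d \<longrightarrow>
      dist (((\<lambda>(z, w). G z w) \<circ> (\<lambda>(t, w). (g t, w))) x') (((\<lambda>(z, w). G z w) \<circ> (\<lambda>(t, w). (g t, w))) x) < e / (B + 1)"
    unfolding uniformly_continuous_on_def by blast
  have osc: "norm (G (g t) w - G (g s) w) \<le> e / (B + 1)"
    if "t \<in> {0..1}" "s \<in> {0..1}" "\<bar>t - s\<bar> < d" "w \<in> S" for t s w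
    using d(2) [rule_format, of "(s, w)" "(t, w)"] that by (simp add: dist_Pair_Pair dist_norm)
  \<comment> \<open>Half of \<open>d\<close>, because tags of intersecting fine intervals are only
    known to be within twice the radius of each other.\<close>
  obtain N where N: "1 / real (Suc N) < d / 2" using d(1) nat_approx_posE [of "d / 2"] by auto
  have "dist (rs_sum g (p n) (\<lambda>z. G z w)) (path_integral g (\<lambda>z. G z w)) < e" if "n \<ge> N" "w \<in> S" for n w
  proof -
    have "1 / real (Suc n) \<le> 1 / real (Suc N)" using that by (simp add: frac_le)
    then have n: "1 / real (Suc n) < d / 2" using N by linarith
    have "continuous_on (path_image g) (\<lambda>z. G z w)"
      by (rule continuous_on_slice(1) [OF G that(2)])
    then have "norm (rs_sum g (p n) (\<lambda>z. G z w) - path_integral g (\<lambda>z. G z w)) \<le> e / (B + 1) * B"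
    proof (intro rs_sum_close [OF B _ _ _ _ p])
      show "norm (G (g t) w - G (g s) w) \<le> e / (B + 1)"
        if "t \<in> {0..1}" "s \<in> {0..1}" "\<bar>t - s\<bar> < 2 * (1 / real (Suc n))" for t s
        using osc [of t s w] that n \<open>w \<in> S\<close> by auto
    qed (use e' g in \<open>auto intro: has_path_integral_path_integral\<close>)
    also have "\<dots> < e" using B0 \<open>0 < e\<close> by (simp add: field_simps)
    finally show ?thesis by (simp add: dist_norm)
  qed
  then show "\<forall>\<^sub>F n in sequentially. \<forall>w\<in>S. dist (rs_sum g (p n) (\<lambda>z. G z w)) (path_integral g (\<lambda>z. G z w)) < e"
    unfolding eventually_sequentially by blast
qed

lemma rs_sum_LIMSEQ:
  assumes g: "rectifiable_path g" and F: "continuous_on (path_image g) F"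
    and p: "\<And>n. p n tagged_division_of {0..1::real}" "\<And>n. (\<lambda>t. ball t (1 / real (Suc n))) fine p n"
  shows "(\<lambda>n. rs_sum g (p n) F) \<longlonglongrightarrow> path_integral g F"
proof -
  \<comment> \<open>A one-point parameter space turns uniform into ordinary convergence.\<close>
  have "continuous_on (path_image g \<times> {0::real}) (\<lambda>(z, w). F z)"
    unfolding case_prod_unfold by (rule continuous_on_compose2 [OF F]) (auto intro!: continuous_intros)
  from rs_sum_uniform_limit [OF g _ this p] show ?thesis
    by (auto dest: tendsto_uniform_limitI [where x = 0])
qed

lemma continuous_on_rs_sum:
  assumes "continuous_on (path_image g \<times> S) (\<lambda>(z, w). G z w)" "p tagged_division_of {0..1::real}"
  shows "continuous_on S (\<lambda>w. rs_sum g p (\<lambda>z. G z w))"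
  unfolding rs_sum_def case_prod_unfold
proof (intro continuous_intros)
  fix x assume x: "x \<in> p"
  then have "g (fst x) \<in> path_image g" 
    using assms(2) tag_in_interval [of p _ "fst x" "snd x"] by (auto simp: path_image_def)
  then show "continuous_on S (\<lambda>w. G (g (fst x)) w)"
    by (rule continuous_on_slice(2) [OF assms(1)])
qed

lemma path_integral_continuous_param:
  fixes G :: "complex \<Rightarrow> 'c::metric_space \<Rightarrow> 'b::complex_banach"
  assumes g: "rectifiable_path g" and S: "compact S"
    and G: "continuous_on (path_image g \<times> S) (\<lambda>(z, w). G z w)"
  shows "continuous_on S (\<lambda>w. path_integral g (\<lambda>z. G z w))"
proof -
  obtain p where p: "\<And>n. p n tagged_division_of {0..1::real}"
    "\<And>n. (\<lambda>t. ball t (1 / real (Suc n))) fine p n" by (rule fine_tagged_sequence_exists) (rule that)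
  show ?thesis
    by (rule uniform_limit_theorem [OF _ rs_sum_uniform_limit [OF g S G p]])
      (auto intro: always_eventually continuous_on_rs_sum [OF G p(1)])
qed

text \<open>Weierstrass' theorem: on a closed disc the integral is a uniform limit of
  Riemann-Stieltjes sums, each of them a finite linear combination of the holomorphic functions
  \<open>G (g t)\<close>.\<close>

lemma path_integral_holomorphic_param:
  fixes G :: "complex \<Rightarrow> complex \<Rightarrow> complex"
  assumes g: "rectifiable_path g" and S: "open S"
    and G: "continuous_on (path_image g \<times> S) (\<lambda>(z, w). G z w)"
    and hol: "\<And>z. z \<in> path_image g \<Longrightarrow> G z holomorphic_on S"
  shows "(\<lambda>w. path_integral g (\<lambda>z. G z w)) holomorphic_on S"
proof -
  obtain p where p: "\<And>n. p n tagged_division_of {0..1::real}"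
    "\<And>n. (\<lambda>t. ball t (1 / real (Suc n))) fine p n" by (rule fine_tagged_sequence_exists) (rule that)
  have "(\<lambda>w. path_integral g (\<lambda>z. G z w)) field_differentiable (at w0)" if "w0 \<in> S" for w0
  proof -
    obtain r where r: "r > 0" "cball w0 r \<subseteq> S" using S \<open>w0 \<in> S\<close> by (meson open_contains_cball)
    have G': "continuous_on (path_image g \<times> cball w0 r) (\<lambda>(z, w). G z w)"
      by (rule continuous_on_subset [OF G]) (use r in auto)
    have "rs_sum g (p n) (\<lambda>z. G z w) = (\<Sum>(t, k)\<in>p n. (g (Sup k) - g (Inf k)) * G (g t) w)" for n w
      by (simp add: rs_sum_def scaleC_complex_def)
    moreover have "(\<lambda>w. \<Sum>(t, k)\<in>p n. (g (Sup k) - g (Inf k)) * G (g t) w) holomorphic_on ball w0 r" for n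
      unfolding case_prod_unfold
    proof (intro holomorphic_intros)
      fix x assume "x \<in> p n"
      then have "g (fst x) \<in> path_image g" 
        using p(1) [of n] tag_in_interval [of "p n" _ "fst x" "snd x"] by (auto simp: path_image_def)
      then show "(\<lambda>w. G (g (fst x)) w) holomorphic_on ball w0 r"
        using hol r ball_subset_cball by (meson holomorphic_on_subset order_trans)
    qed
    ultimately have "(\<lambda>w. rs_sum g (p n) (\<lambda>z. G z w)) holomorphic_on ball w0 r" for n
      by simp
    then have "\<forall>\<^sub>F n in sequentially. continuous_on (cball w0 r) (\<lambda>w. rs_sum g (p n) (\<lambda>z. G z w)) \<and>
        (\<lambda>w. rs_sum g (p n) (\<lambda>z. G z w)) holomorphic_on ball w0 r"
      using continuous_on_rs_sum [OF G' p(1)] by (intro always_eventually) simp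
    then have "(\<lambda>w. path_integral g (\<lambda>z. G z w)) holomorphic_on ball w0 r"
      by (rule holomorphic_uniform_limit [OF _ rs_sum_uniform_limit [OF g compact_cball G' p] sequentially_bot])
    then show ?thesis using r(1) holomorphic_on_imp_differentiable_at by (metis centre_in_ball open_ball)
  qed
  then show ?thesis using S by (simp add: holomorphic_on_def field_differentiable_at_within)
qed

lemma path_integral_add:
  assumes "rectifiable_path g" "continuous_on (path_image g) F" "continuous_on (path_image g) G"
  shows "path_integral g (\<lambda>z. F z + G z) = path_integral g F + path_integral g G"
  by (intro path_integral_eqI has_path_integral_add has_path_integral_path_integral assms)

lemma path_integral_map:
  assumes "rectifiable_path g" "continuous_on (path_image g) F"
    "bounded_linear \<Psi>" "\<And>c x. \<Psi> (c *\<^sub>C x) = c *\<^sub>C \<Psi> x"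
  shows "path_integral g (\<lambda>z. \<Psi> (F z)) = \<Psi> (path_integral g F)"
  by (rule path_integral_eqI [OF has_path_integral_map [OF has_path_integral_path_integral [OF assms(1,2)] assms(3,4)]])

lemma path_integral_cong:
  "(\<And>z. z \<in> path_image g \<Longrightarrow> F z = G z) \<Longrightarrow> path_integral g F = path_integral g G"
  unfolding path_integral_def using has_path_integral_cong by metis

lemma path_integral_norm_le:
  assumes "rectifiable_path g" "variation_le g B" "continuous_on (path_image g) F"
    "\<And>z. z \<in> path_image g \<Longrightarrow> norm (F z) \<le> M"
  shows "norm (path_integral g F) \<le> M * B"
  using has_path_integral_norm_le has_path_integral_path_integral assms by blast

lemma path_integral_diff:
  assumes "rectifiable_path g" "continuous_on (path_image g) F" "continuous_on (path_image g) G"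
  shows "path_integral g (\<lambda>z. F z - G z) = path_integral g F - path_integral g G"
proof -
  have "path_integral g (\<lambda>z. - G z) = - path_integral g G"
    by (rule path_integral_map [OF assms(1,3)]) (auto intro: bounded_linear_minus bounded_linear_ident simp: scaleC_minus_right)
  then show ?thesis
    using path_integral_add [OF assms(1,2), of "\<lambda>z. - G z"] assms(3) by (simp add: continuous_on_minus)
qed

lemma path_integral_rs_sum:
  fixes G :: "complex \<Rightarrow> complex \<Rightarrow> 'b::complex_banach"
  assumes h: "rectifiable_path h" and p: "p tagged_division_of {0..1::real}"
    and G: "\<And>z. z \<in> path_image g \<Longrightarrow> continuous_on (path_image h) (G z)"
  shows "path_integral h (\<lambda>w. rs_sum g p (\<lambda>z. G z w)) = rs_sum g p (\<lambda>z. path_integral h (G z))"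
proof -
  have fin: "finite p" using p by blast
  have tag: "g t \<in> path_image g" if "(t, k) \<in> p" for t k
    using tag_in_interval [OF p that] by (auto simp: path_image_def)
  have "path_integral h (\<lambda>w. \<Sum>(t, k)\<in>q. (g (Sup k) - g (Inf k)) *\<^sub>C G (g t) w)
      = (\<Sum>(t, k)\<in>q. (g (Sup k) - g (Inf k)) *\<^sub>C path_integral h (G (g t)))" if "q \<subseteq> p" for q
    using finite_subset [OF that fin] that
  proof (induction q)
    case empty
    have "path_integral h (\<lambda>w. 0 :: 'b) = 0"
      using path_integral_map [OF h continuous_on_const, of "\<lambda>x. 0" 0] by simp
    then show ?case by simp
  next
    case (insert x q)
    obtain t k where x: "x = (t, k)" by (cases x)
    have c: "continuous_on (path_image h) (\<lambda>w. (g (Sup k) - g (Inf k)) *\<^sub>C G (g t) w)"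
      using insert.prems tag G x by (auto intro!: continuous_intros)
    have c': "continuous_on (path_image h) (\<lambda>w. \<Sum>(t, k)\<in>q. (g (Sup k) - g (Inf k)) *\<^sub>C G (g t) w)"
      unfolding case_prod_unfold using insert.prems tag G
      by (intro continuous_intros) (metis insertCI prod.collapse subsetD)
    have "path_integral h (\<lambda>w. (g (Sup k) - g (Inf k)) *\<^sub>C G (g t) w) =
        (g (Sup k) - g (Inf k)) *\<^sub>C path_integral h (G (g t))"
      using insert.prems tag G x
      by (intro path_integral_map [OF h]) (auto simp: bounded_linear_scaleC scaleC_scaleC mult.commute)
    then show ?case
      using insert.hyps insert.IH insert.prems path_integral_add [OF h c c'] x by simp
  qed
  then show ?thesis unfolding rs_sum_def by blast
qed

text \<open>Riemann-Stieltjes sums along \<open>g\<close> converge uniformly on the image of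
  \<open>h\<close>, so they may be integrated over \<open>h\<close> before passing to the limit. The
  sums obtained in this way are also Riemann-Stieltjes sums for the outer integral on the
  right.\<close>

lemma path_integral_swap:
  fixes G :: "complex \<Rightarrow> complex \<Rightarrow> 'b::complex_banach"
  assumes g: "rectifiable_path g" and h: "rectifiable_path h"
    and G: "continuous_on (path_image g \<times> path_image h) (\<lambda>(z, w). G z w)"
  shows "path_integral h (\<lambda>w. path_integral g (\<lambda>z. G z w)) = path_integral g (\<lambda>z. path_integral h (\<lambda>w. G z w))"
proof -
  obtain p where p: "\<And>n. p n tagged_division_of {0..1::real}"
    "\<And>n. (\<lambda>t. ball t (1 / real (Suc n))) fine p n" by (rule fine_tagged_sequence_exists) (rule that)
  have cg: "compact (path_image g)" and ch: "compact (path_image h)"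
    using g h rectifiable_pathD compact_path_image by blast+
  have Gz: "continuous_on (path_image h) (G z)" if "z \<in> path_image g" for z
    by (rule continuous_on_slice(2) [OF G that])
  have G': "continuous_on (path_image h \<times> path_image g) (\<lambda>(w, z). G z w)"
    by (rule continuous_on_swap_args [OF G])
  have lim1: "(\<lambda>n. rs_sum g (p n) (\<lambda>z. path_integral h (G z))) \<longlonglongrightarrow> path_integral g (\<lambda>z. path_integral h (\<lambda>w. G z w))"
    by (intro rs_sum_LIMSEQ [OF g _ p] path_integral_continuous_param [OF h cg G'])
  obtain B where B: "variation_le h B" using rectifiable_pathD [OF h] by blast
  have B0: "0 \<le> B" using B variation_le_nonneg by blast
  have lim2: "(\<lambda>n. path_integral h (\<lambda>w. rs_sum g (p n) (\<lambda>z. G z w))) \<longlonglongrightarrow> path_integral h (\<lambda>w. path_integral g (\<lambda>z. G z w))"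
  proof (rule tendstoI)
    fix e :: real assume "0 < e"
    then have e': "0 < e / (B + 1)" using B0 by simp
    show "\<forall>\<^sub>F n in sequentially. dist (path_integral h (\<lambda>w. rs_sum g (p n) (\<lambda>z. G z w)))
        (path_integral h (\<lambda>w. path_integral g (\<lambda>z. G z w))) < e"
      using uniform_limitD [OF rs_sum_uniform_limit [OF g ch G p] e']
    proof eventually_elim
      case (elim n)
      have c: "continuous_on (path_image h) (\<lambda>w. rs_sum g (p n) (\<lambda>z. G z w))"
        "continuous_on (path_image h) (\<lambda>w. path_integral g (\<lambda>z. G z w))"
        using continuous_on_rs_sum [OF G p(1)] path_integral_continuous_param [OF g ch G] by auto
      then have "norm (path_integral h (\<lambda>w. rs_sum g (p n) (\<lambda>z. G z w) - path_integral g (\<lambda>z. G z w))) \<le> e / (B + 1) * B"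
        using elim by (intro path_integral_norm_le [OF h B] continuous_intros) (auto simp: dist_norm less_imp_le)
      also have "\<dots> < e" using B0 \<open>0 < e\<close> by (simp add: field_simps)
      finally show ?case by (simp add: path_integral_diff [OF h c] dist_norm)
    qed
  qed
  have "path_integral h (\<lambda>w. rs_sum g (p n) (\<lambda>z. G z w)) = rs_sum g (p n) (\<lambda>z. path_integral h (G z))" for n
    by (rule path_integral_rs_sum [OF h p(1) Gz])
  with lim2 have "(\<lambda>n. rs_sum g (p n) (\<lambda>z. path_integral h (G z))) \<longlonglongrightarrow> path_integral h (\<lambda>w. path_integral g (\<lambda>z. G z w))"
    by simp
  then show ?thesis using lim1 LIMSEQ_unique by blast
qed

section \<open>Integrals over cycles\<close>

text \<open>With a continuous logarithm \<open>q\<close> of \<open>g - \<zeta>\<close>, each summand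
  equals \<open>exp (q b - q t) - exp (q c - q t)\<close>, which is \<open>q b - q c\<close> up to a
  small relative error, and the increments of \<open>q\<close> telescope. The variation of
  \<open>q\<close> is not known beforehand; its increments are bounded by those of \<open>g\<close>
  through the same estimate.\<close>

lemma path_integral_winding_number:
  assumes g: "rectifiable_path g" and \<zeta>: "\<zeta> \<notin> path_image g"
  shows "path_integral g (\<lambda>z. 1 / (z - \<zeta>)) = 2 * of_real pi * \<i> * winding_number g \<zeta>"
proof -
  obtain B where B: "variation_le g B" and path: "path g" using rectifiable_pathD [OF g] by blast
  have B0: "0 \<le> B" using B variation_le_nonneg by blast
  obtain q where q: "path q" "pathfinish q - pathstart q = 2 * of_real pi * \<i> * winding_number g \<zeta>"
      "\<And>t. t \<in> {0..1} \<Longrightarrow> g t = \<zeta> + exp (q t)"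
    using winding_number_as_continuous_log [OF path \<zeta>] by blast
  obtain p where p: "\<And>n. p n tagged_division_of {0..1::real}"
    "\<And>n. (\<lambda>t. ball t (1 / real (Suc n))) fine p n" by (rule fine_tagged_sequence_exists) (rule that)
  let ?F = "\<lambda>z. 1 / (z - \<zeta>)"
  have cF: "continuous_on (path_image g) ?F"
    using \<zeta> by (intro continuous_intros) auto
  have "bounded (?F ` path_image g)"
    using compact_continuous_image [OF cF] path compact_path_image compact_imp_bounded by blast
  then obtain R where R: "R > 0" "\<And>z. z \<in> path_image g \<Longrightarrow> cmod (?F z) \<le> R"
    unfolding bounded_pos by blast
  have "(\<lambda>n. rs_sum g (p n) ?F) \<longlonglongrightarrow> q 1 - q 0"
  proof (rule LIMSEQ_I)
    fix e :: real assume "0 < e"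
    \<comment> \<open>The bound 1/2 lets the relative error be absorbed. The other bound makes the
      total error \<open>\<epsilon> * (2 * R * B)\<close> smaller than \<open>e\<close>, where
      \<open>R\<close> bounds the kernel on the curve and \<open>B\<close> the variation.\<close>
    define \<epsilon> where "\<epsilon> = min (1/2) (e / (2 * R * (B + 1)))"
    have RB: "0 < 2 * R * (B + 1)" using R(1) B0 by simp
    have \<epsilon>: "0 < \<epsilon>" "\<epsilon> \<le> 1/2" "\<epsilon> \<le> e / (2 * R * (B + 1))"
      unfolding \<epsilon>_def using \<open>0 < e\<close> RB by (simp_all only: min_less_iff_conj min.cobounded1 min.cobounded2) simp
    have "\<epsilon> * (2 * R * (B + 1)) \<le> e"
      using \<epsilon>(3) RB by (simp only: pos_le_divide_eq)
    moreover have "\<epsilon> * (2 * R * B) < \<epsilon> * (2 * R * (B + 1))"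
      using \<epsilon> R(1) by (intro mult_strict_left_mono) auto
    ultimately have \<epsilon>': "\<epsilon> * (2 * R * B) < e" by linarith
    have "isCont exp (0::complex)" by simp
    then obtain \<eta> where \<eta>: "0 < \<eta>" "\<And>x::complex. dist x 0 < \<eta> \<Longrightarrow> dist (exp x) (exp 0) < \<epsilon>"
      unfolding continuous_at_eps_delta using \<epsilon>(1) by metis
    \<comment> \<open>Mean value inequality for \<open>exp x - x\<close>, whose derivative
      \<open>exp x - 1\<close> has modulus at most \<open>\<epsilon>\<close> near 0.\<close>
    have expm: "cmod (exp a - exp b - (a - b)) \<le> \<epsilon> * cmod (a - b)" if "cmod a < \<eta>" "cmod b < \<eta>" for a b
    proof -
      have "cmod ((exp a - a) - (exp b - b)) \<le> \<epsilon> * cmod (a - b)"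
      proof (rule field_differentiable_bound [of "ball 0 \<eta>" _ "\<lambda>x. exp x - 1"])
        show "((\<lambda>x. exp x - x) has_field_derivative exp z - 1) (at z within ball 0 \<eta>)" for z
          by (auto intro!: derivative_eq_intros)
        show "cmod (exp z - 1) \<le> \<epsilon>" if "z \<in> ball 0 \<eta>" for z
          using \<eta>(2) [of z] that by (simp add: dist_norm)
      qed (use that in auto)
      then show ?thesis by (simp add: algebra_simps)
    qed
    have "uniformly_continuous_on {0..1} q"
      using q(1) by (intro compact_uniformly_continuous) (auto simp: path_def)
    then obtain d where d: "0 < d" "\<And>x x'. x \<in> {0..1} \<Longrightarrow> x' \<in> {0..1} \<Longrightarrow> dist x' x < d \<Longrightarrow> dist (q x') (q x) < \<eta>"
      unfolding uniformly_continuous_on_def using \<eta>(1) by metis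
    obtain N where N: "1 / real (Suc N) < d" using d(1) nat_approx_posE by blast
    have "norm (rs_sum g (p n) ?F - (q 1 - q 0)) < e" if "N \<le> n" for n
    proof -
      have "1 / real (Suc n) \<le> 1 / real (Suc N)" using that by (simp add: frac_le)
      then have n: "1 / real (Suc n) < d" using N by linarith
      have "q 1 - q 0 = (\<Sum>(t, k)\<in>p n. q (Sup k) - q (Inf k))"
        by (rule additive_tagged_division_1 [OF _ p(1), symmetric]) simp
      then have "rs_sum g (p n) ?F - (q 1 - q 0)
          = (\<Sum>(t, k)\<in>p n. (g (Sup k) - g (Inf k)) * ?F (g t) - (q (Sup k) - q (Inf k)))"
        by (simp add: rs_sum_def scaleC_complex_def case_prod_unfold sum_subtractf)
      also have "norm \<dots> \<le> (\<Sum>(t, k)\<in>p n. \<epsilon> * (2 * R) * cmod (g (Sup k) - g (Inf k)))"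
      proof (intro sum_norm_le, clarify)
        fix t k assume tk: "(t, k) \<in> p n"
        obtain c b where k: "k = {c..b}" "c \<le> b" "0 \<le> c" "b \<le> 1" "t \<in> {c..b}"
          using tk by (rule tagged_division_of_real_interval [OF p(1)])
        have "k \<subseteq> ball t (1 / real (Suc n))" using fineD [OF p(2) tk] .
        then have "c \<in> ball t (1 / real (Suc n))" "b \<in> ball t (1 / real (Suc n))" unfolding k(1) using k(2) by (blast intro: atLeastAtMost_iff [THEN iffD2])+
        then have "dist c t < d" "dist b t < d" using n by (auto simp: dist_commute)
        then have small: "cmod (q b - q t) < \<eta>" "cmod (q c - q t) < \<eta>"
          using d(2) [of t b] d(2) [of t c] k by (auto simp: dist_norm)
        have "g t - \<zeta> = exp (q t)" "g b = \<zeta> + exp (q b)" "g c = \<zeta> + exp (q c)" using q(3) k by auto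
        then have inc: "(g b - g c) * ?F (g t) = exp (q b - q t) - exp (q c - q t)"
          by (simp add: exp_diff diff_divide_distrib)
        have *: "cmod ((g b - g c) * ?F (g t) - (q b - q c)) \<le> \<epsilon> * cmod (q b - q c)"
          using expm [OF small] unfolding inc by simp
        \<comment> \<open>The last term is at most half of the left-hand side, so the increment of
          \<open>q\<close> is at most twice the summand.\<close>
        have "cmod (q b - q c) \<le> cmod ((g b - g c) * ?F (g t)) + \<epsilon> * cmod (q b - q c)"
          using * norm_triangle_ineq4 [of "(g b - g c) * ?F (g t)" "(g b - g c) * ?F (g t) - (q b - q c)"] by simp
        moreover have "\<epsilon> * cmod (q b - q c) \<le> 1/2 * cmod (q b - q c)"
          using \<epsilon> by (intro mult_right_mono) auto
        ultimately have "cmod (q b - q c) \<le> 2 * cmod ((g b - g c) * ?F (g t))" by linarith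
        also have "\<dots> \<le> 2 * (cmod (g b - g c) * R)"
          unfolding norm_mult using R(2) [of "g t"] k by (intro mult_left_mono) (auto simp: path_image_def)
        finally have "\<epsilon> * cmod (q b - q c) \<le> \<epsilon> * (2 * (cmod (g b - g c) * R))"
          using \<epsilon> by (intro mult_left_mono) auto
        then show "norm ((g (Sup k) - g (Inf k)) * ?F (g t) - (q (Sup k) - q (Inf k)))
            \<le> \<epsilon> * (2 * R) * cmod (g (Sup k) - g (Inf k))"
          using * k by (simp add: mult_ac)
      qed
      also have "\<dots> = \<epsilon> * (2 * R) * (\<Sum>(t, k)\<in>p n. cmod (g (Sup k) - g (Inf k)))"
        by (simp add: sum_distrib_left case_prod_unfold)
      also have "\<dots> \<le> \<epsilon> * (2 * R) * B"
        using variation_le_tagged [OF B p(1)] \<epsilon> R(1) by (intro mult_left_mono) auto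
      also have "\<dots> < e" using \<epsilon>' by (simp add: mult_ac)
      finally show ?thesis .
    qed
    then show "\<exists>M. \<forall>n\<ge>M. norm (rs_sum g (p n) ?F - (q 1 - q 0)) < e" by blast
  qed
  then have "path_integral g ?F = q 1 - q 0"
    using rs_sum_LIMSEQ [OF g cF p] LIMSEQ_unique by blast
  then show ?thesis using q(2) by (simp add: pathstart_def pathfinish_def)
qed

definition cycle_image :: "(real \<Rightarrow> complex) set \<Rightarrow> complex set"
  where "cycle_image C = (\<Union>g\<in>C. path_image g)"

text \<open>The \<open>J\<close> of the overview, with values in any complex Banach space: scalars
  for Cauchy's formula, operators and vectors for the calculus.\<close>

definition cint :: "(real \<Rightarrow> complex) set \<Rightarrow> (complex \<Rightarrow> 'b::complex_banach) \<Rightarrow> 'b"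
  where "cint C F = (1 / (2 * complex_of_real pi * \<i>)) *\<^sub>C (\<Sum>g\<in>C. path_integral g F)"

locale rect_cycle =
  fixes C :: "(real \<Rightarrow> complex) set"
  assumes finite_cycle: "finite C"
    and rectifiable: "g \<in> C \<Longrightarrow> rectifiable_path g"
begin

lemma compact_cycle_image: "compact (cycle_image C)"
  unfolding cycle_image_def using finite_cycle rectifiable rectifiable_pathD(1) compact_path_image
  by (intro compact_UN) auto

lemma continuous_on_path_image:
  "continuous_on (cycle_image C) F \<Longrightarrow> g \<in> C \<Longrightarrow> continuous_on (path_image g) F"
  by (erule continuous_on_subset) (auto simp: cycle_image_def)

lemma continuous_on_path_image_Times:
  "continuous_on (cycle_image C \<times> S) F \<Longrightarrow> g \<in> C \<Longrightarrow> continuous_on (path_image g \<times> S) F"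
  by (erule continuous_on_subset) (auto simp: cycle_image_def)

lemma cint_add:
  assumes "continuous_on (cycle_image C) F" "continuous_on (cycle_image C) G"
  shows "cint C (\<lambda>z. F z + G z) = cint C F + cint C G"
  using assms by (simp add: cint_def path_integral_add rectifiable continuous_on_path_image sum.distrib scaleC_add_right)

lemma cint_diff:
  assumes "continuous_on (cycle_image C) F" "continuous_on (cycle_image C) G"
  shows "cint C (\<lambda>z. F z - G z) = cint C F - cint C G"
  using assms by (simp add: cint_def path_integral_diff rectifiable continuous_on_path_image sum_subtractf scaleC_diff_right)

lemma cint_map:
  assumes F: "continuous_on (cycle_image C) F" and \<Psi>: "bounded_linear \<Psi>" "\<And>c x. \<Psi> (c *\<^sub>C x) = c *\<^sub>C \<Psi> x"
  shows "cint C (\<lambda>z. \<Psi> (F z)) = \<Psi> (cint C F)"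
  by (simp add: cint_def path_integral_map [OF rectifiable continuous_on_path_image [OF F] \<Psi>] \<Psi>(2)
      linear_sum [OF bounded_linear.linear [OF \<Psi>(1)]])

lemma cint_scale:
  assumes F: "continuous_on (cycle_image C) F"
  shows "cint C (\<lambda>z. c *\<^sub>C F z) = c *\<^sub>C cint C F"
  by (rule cint_map [OF F bounded_linear_scaleC]) (simp add: scaleC_scaleC mult.commute)

lemma cint_scale_const:
  assumes F: "continuous_on (cycle_image C) F"
  shows "cint C (\<lambda>z. F z *\<^sub>C v) = cint C F *\<^sub>C v"
  by (rule cint_map [OF F bounded_bilinear.bounded_linear_left [OF bounded_bilinear_scaleC]])
    (simp add: scaleC_scaleC scaleC_complex_def)

lemma cint_cong: "(\<And>z. z \<in> cycle_image C \<Longrightarrow> F z = G z) \<Longrightarrow> cint C F = cint C G"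
  unfolding cint_def by (intro arg_cong [where f = "scaleC _"] sum.cong path_integral_cong) (auto simp: cycle_image_def)

text \<open>The constant comes from the variations of the curves alone and is fixed before the
  integrand, as the estimates of Cauchy transforms require.\<close>

lemma cint_bounded:
  "\<exists>M\<ge>0. \<forall>(F :: complex \<Rightarrow> 'b::complex_banach) b. continuous_on (cycle_image C) F \<longrightarrow>
     (\<forall>z\<in>cycle_image C. norm (F z) \<le> b) \<longrightarrow> norm (cint C F) \<le> M * b"
proof -
  have "\<forall>g\<in>C. \<exists>B. variation_le g B" using rectifiable rectifiable_pathD(2) by blast
  then obtain B where B: "\<And>g. g \<in> C \<Longrightarrow> variation_le g (B g)" by metis
  let ?c = "cmod (1 / (2 * complex_of_real pi * \<i>))"
  show ?thesis
  proof (intro exI [of _ "?c * (\<Sum>g\<in>C. B g)"] conjI allI impI)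
    show "0 \<le> ?c * (\<Sum>g\<in>C. B g)"
      using B variation_le_nonneg by (intro mult_nonneg_nonneg sum_nonneg) auto
    fix F :: "complex \<Rightarrow> 'b" and b
    assume F: "continuous_on (cycle_image C) F" "\<forall>z\<in>cycle_image C. norm (F z) \<le> b"
    have "norm (\<Sum>g\<in>C. path_integral g F) \<le> (\<Sum>g\<in>C. b * B g)"
      using F by (intro sum_norm_le path_integral_norm_le [OF rectifiable B] continuous_on_path_image)
        (auto simp: cycle_image_def)
    then have "norm (\<Sum>g\<in>C. path_integral g F) \<le> (\<Sum>g\<in>C. B g) * b"
      by (simp add: sum_distrib_left mult.commute)
    then show "norm (cint C F) \<le> ?c * (\<Sum>g\<in>C. B g) * b"
      unfolding cint_def norm_scaleC mult.assoc by (intro mult_left_mono) auto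
  qed
qed

lemma cint_continuous_param:
  fixes G :: "complex \<Rightarrow> 'c::metric_space \<Rightarrow> 'b::complex_banach"
  assumes S: "compact S" and G: "continuous_on (cycle_image C \<times> S) (\<lambda>(z, w). G z w)"
  shows "continuous_on S (\<lambda>w. cint C (\<lambda>z. G z w))"
  unfolding cint_def
  by (intro continuous_intros path_integral_continuous_param [OF rectifiable S] continuous_on_path_image_Times [OF G])

lemma cint_holomorphic_param:
  fixes G :: "complex \<Rightarrow> complex \<Rightarrow> complex"
  assumes S: "open S" and G: "continuous_on (cycle_image C \<times> S) (\<lambda>(z, w). G z w)"
    and hol: "\<And>z. z \<in> cycle_image C \<Longrightarrow> G z holomorphic_on S"
  shows "(\<lambda>w. cint C (\<lambda>z. G z w)) holomorphic_on S"
  unfolding cint_def scaleC_complex_def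
  by (intro holomorphic_intros path_integral_holomorphic_param [OF rectifiable S] continuous_on_path_image_Times [OF G] hol)
    (auto simp: cycle_image_def)

lemma cint_swap:
  fixes G :: "complex \<Rightarrow> complex \<Rightarrow> 'b::complex_banach"
  assumes G: "continuous_on (cycle_image C \<times> cycle_image C) (\<lambda>(z, w). G z w)"
  shows "cint C (\<lambda>w. cint C (\<lambda>z. G z w)) = cint C (\<lambda>z. cint C (\<lambda>w. G z w))"
proof -
  let ?c = "1 / (2 * complex_of_real pi * \<i>)"
  have G': "continuous_on (cycle_image C \<times> cycle_image C) (\<lambda>(w, z). G z w)"
    by (rule continuous_on_swap_args [OF G])
  have sub: "path_image g \<subseteq> cycle_image C" if "g \<in> C" for g using that by (auto simp: cycle_image_def)
  have inner: "path_integral h (\<lambda>w. cint C (\<lambda>z. G z w)) = ?c *\<^sub>C (\<Sum>g\<in>C. path_integral h (\<lambda>w. path_integral g (\<lambda>z. G z w)))"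
    if G: "continuous_on (cycle_image C \<times> cycle_image C) (\<lambda>(z, w). G z w)" and h: "h \<in> C" for h and G :: "complex \<Rightarrow> complex \<Rightarrow> 'b"
  proof -
    have c: "continuous_on (path_image h) (\<lambda>w. path_integral g (\<lambda>z. G z w))" if "g \<in> C" for g
      using h sub that by (intro continuous_on_path_image [OF _ h] path_integral_continuous_param [OF rectifiable compact_cycle_image])
        (auto intro: continuous_on_path_image_Times [OF G])
    have "has_path_integral (\<lambda>w. \<Sum>g\<in>A. path_integral g (\<lambda>z. G z w))
        (\<Sum>g\<in>A. path_integral h (\<lambda>w. path_integral g (\<lambda>z. G z w))) h" if "A \<subseteq> C" for A
      using finite_subset [OF that finite_cycle] that
    proof (induction A)
      case empty
      show ?case by (auto simp: has_path_integral_def intro: exI [of _ 1])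
    next
      case (insert g A)
      then show ?case
        using has_path_integral_add [OF has_path_integral_path_integral [OF rectifiable [OF h] c]] by simp
    qed
    then have "has_path_integral (\<lambda>w. ?c *\<^sub>C (\<Sum>g\<in>C. path_integral g (\<lambda>z. G z w)))
        (?c *\<^sub>C (\<Sum>g\<in>C. path_integral h (\<lambda>w. path_integral g (\<lambda>z. G z w)))) h"
      by (rule has_path_integral_map [where \<Psi> = "\<lambda>x. ?c *\<^sub>C x", OF _ bounded_linear_scaleC])
        (auto simp: scaleC_scaleC mult.commute)
    then show ?thesis unfolding cint_def by (rule path_integral_eqI)
  qed
  have swap: "path_integral h (\<lambda>w. path_integral g (\<lambda>z. G z w)) = path_integral g (\<lambda>z. path_integral h (\<lambda>w. G z w))"
    if "g \<in> C" "h \<in> C" for g h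
    by (intro path_integral_swap rectifiable that continuous_on_subset [OF G]) (use sub that in auto)
  have "cint C (\<lambda>w. cint C (\<lambda>z. G z w)) = ?c *\<^sub>C ?c *\<^sub>C (\<Sum>h\<in>C. \<Sum>g\<in>C. path_integral h (\<lambda>w. path_integral g (\<lambda>z. G z w)))"
    by (subst cint_def) (simp add: inner [OF G] scaleC.sum)
  also have "\<dots> = ?c *\<^sub>C ?c *\<^sub>C (\<Sum>g\<in>C. \<Sum>h\<in>C. path_integral g (\<lambda>z. path_integral h (\<lambda>w. G z w)))"
    by (subst sum.swap) (simp add: swap)
  also have "\<dots> = cint C (\<lambda>z. cint C (\<lambda>w. G z w))"
    by (simp add: cint_def [of C "\<lambda>z. cint C (G z)"] inner [OF G'] scaleC.sum)
  finally show ?thesis .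
qed

lemma cint_winding:
  assumes "\<zeta> \<notin> cycle_image C"
  shows "cint C (\<lambda>z. 1 / (z - \<zeta>)) = (\<Sum>g\<in>C. winding_number g \<zeta>)"
proof -
  have "(\<Sum>g\<in>C. path_integral g (\<lambda>z. 1 / (z - \<zeta>))) = (\<Sum>g\<in>C. 2 * of_real pi * \<i> * winding_number g \<zeta>)"
    using assms by (intro sum.cong path_integral_winding_number rectifiable) (auto simp: cycle_image_def)
  then show ?thesis
    by (simp add: cint_def scaleC_complex_def sum_distrib_left [symmetric])
qed

text \<open>If the curves lie in the disc of radius \<open>r\<close>, the kernel is at most
  \<open>1 / (norm w - r)\<close> on them. Both Liouville arguments take their behaviour at infinity
  from here.\<close>

lemma cint_cauchy_tendsto_0:
  fixes F :: "complex \<Rightarrow> 'b::complex_banach"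
  assumes F: "continuous_on (cycle_image C) F"
  shows "((\<lambda>w. cint C (\<lambda>z. (1 / (z - w)) *\<^sub>C F z)) \<longlongrightarrow> 0) at_infinity"
proof -
  obtain M where M: "M \<ge> 0" "\<And>(F :: complex \<Rightarrow> 'b) b. continuous_on (cycle_image C) F \<Longrightarrow>
     (\<forall>z\<in>cycle_image C. norm (F z) \<le> b) \<Longrightarrow> norm (cint C F) \<le> M * b"
    using cint_bounded by metis
  obtain b where b: "b > 0" "\<And>z. z \<in> cycle_image C \<Longrightarrow> norm (F z) \<le> b"
    using compact_imp_bounded [OF compact_continuous_image [OF F compact_cycle_image]] unfolding bounded_pos by auto
  obtain r where r: "r > 0" "\<And>z. z \<in> cycle_image C \<Longrightarrow> norm z \<le> r"
    using compact_imp_bounded [OF compact_cycle_image] unfolding bounded_pos by auto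
  have "\<forall>\<^sub>F w in at_infinity. norm (cint C (\<lambda>z. (1 / (z - w)) *\<^sub>C F z)) \<le> M * (inverse (- r + norm w) * b)"
  proof (rule eventually_at_infinityI)
    fix w :: complex assume w: "r + 1 \<le> norm w"
    have far: "norm w - r \<le> norm (z - w)" if "z \<in> cycle_image C" for z
      using r(2) [OF that] norm_triangle_ineq2 [of w z] by (simp add: norm_minus_commute)
    have "norm ((1 / (z - w)) *\<^sub>C F z) \<le> inverse (- r + norm w) * b" if "z \<in> cycle_image C" for z
    proof -
      have "norm (1 / (z - w)) \<le> inverse (- r + norm w)"
        using far [OF that] w by (simp add: norm_divide divide_simps)
      then show ?thesis
        unfolding norm_scaleC using b that w by (intro mult_mono) auto
    qed
    moreover have "w \<notin> cycle_image C" using r w by force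
    then have "continuous_on (cycle_image C) (\<lambda>z. (1 / (z - w)) *\<^sub>C F z)"
      by (intro continuous_intros F) auto
    ultimately show "norm (cint C (\<lambda>z. (1 / (z - w)) *\<^sub>C F z)) \<le> M * (inverse (- r + norm w) * b)"
      using M(2) by blast
  qed
  moreover have "filterlim (\<lambda>w::complex. - r + norm w) at_top at_infinity"
    by (intro filterlim_tendsto_add_at_top [OF tendsto_const] filterlim_at_infinity_imp_norm_at_top filterlim_ident)
  then have "((\<lambda>w::complex. M * (inverse (- r + norm w) * b)) \<longlongrightarrow> M * (0 * b)) at_infinity"
    by (intro tendsto_intros tendsto_inverse_0_at_top)
  ultimately show ?thesis
    using Lim_null_comparison by fastforce
qed

end

text \<open>Taking the derivative on the diagonal makes this jointly continuous for holomorphic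
  \<open>f\<close>, so that both variables may run along the same contour.\<close>

definition dquot :: "(complex \<Rightarrow> complex) \<Rightarrow> complex \<Rightarrow> complex \<Rightarrow> complex"
  where "dquot f z w = (if z = w then deriv f w else (f z - f w) / (z - w))"

lemma dquot_commute: "dquot f z w = dquot f w z"
  by (auto simp: dquot_def divide_simps) (simp add: algebra_simps)

lemma dquot_mult: "(z - w) * dquot f z w = f z - f w"
  by (auto simp: dquot_def)

text \<open>Off the diagonal this is a quotient of continuous functions. Near a diagonal point
  \<open>(a, a)\<close> the quotient is controlled by the mean value inequality for
  \<open>f z - deriv f a * z\<close>, whose derivative is small near \<open>a\<close>.\<close>

lemma continuous_on_dquot:
  assumes U: "open U" and f: "f holomorphic_on U"
  shows "continuous_on (U \<times> U) (\<lambda>(z, w). dquot f z w)"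
proof -
  have "isCont (\<lambda>(z, w). dquot f z w) (a, b)" if ab: "a \<in> U" "b \<in> U" for a b
  proof (cases "a = b")
    case False
    define W where "W = U \<times> U \<inter> {p. fst p \<noteq> snd p}"
    have W: "open W" "(a, b) \<in> W"
      unfolding W_def using U ab False
      by (auto intro!: open_Int open_Times open_Collect_neq continuous_intros)
    have cf: "continuous_on W (\<lambda>p. f (fst p))" "continuous_on W (\<lambda>p. f (snd p))"
      using holomorphic_on_imp_continuous_on [OF f]
      by (auto intro!: continuous_on_compose2 [of U f] continuous_intros simp: W_def)
    have "continuous_on W (\<lambda>p. (f (fst p) - f (snd p)) / (fst p - snd p))"
      by (intro continuous_intros cf) (auto simp: W_def)
    then have "continuous_on W (\<lambda>(z, w). dquot f z w)"
      by (rule continuous_on_cong [THEN iffD1, rotated 2]) (auto simp: W_def dquot_def)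
    then show ?thesis using W continuous_on_eq_continuous_at by blast
  next
    case True
    have "isCont (deriv f) a"
      using holomorphic_deriv [OF f U] U ab holomorphic_on_imp_continuous_on continuous_on_eq_continuous_at by blast
    show ?thesis
      unfolding continuous_at_eps_delta True [symmetric]
    proof (intro allI impI)
      fix e :: real assume "0 < e"
      then have "0 < e / 2" by simp
      then obtain d where d: "0 < d" "\<And>z. dist z a < d \<Longrightarrow> dist (deriv f z) (deriv f a) < e / 2"
        using \<open>isCont (deriv f) a\<close> unfolding continuous_at_eps_delta by blast
      obtain r where r: "0 < r" "ball a r \<subseteq> U" using U ab open_contains_ball by blast
      define s where "s = min d r"
      have s: "0 < s" "ball a s \<subseteq> U" "\<And>z. z \<in> ball a s \<Longrightarrow> cmod (deriv f z - deriv f a) \<le> e / 2"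
        using d r by (auto simp: s_def dist_norm norm_minus_commute less_imp_le subset_iff)
      have main: "cmod (dquot f z w - deriv f a) \<le> e / 2" if zw: "z \<in> ball a s" "w \<in> ball a s" for z w
      proof (cases "z = w")
        case True
        then show ?thesis using s(3) zw by (simp add: dquot_def)
      next
        case False
        have "cmod ((f z - deriv f a * z) - (f w - deriv f a * w)) \<le> e / 2 * cmod (z - w)"
        proof (rule field_differentiable_bound [of "ball a s" _ "\<lambda>x. deriv f x - deriv f a"])
          fix x assume "x \<in> ball a s"
          then have "(f has_field_derivative deriv f x) (at x within ball a s)"
            using s(2) f U holomorphic_derivI by blast
          then show "((\<lambda>z. f z - deriv f a * z) has_field_derivative deriv f x - deriv f a) (at x within ball a s)"
            by (auto intro!: derivative_eq_intros)
        qed (use s zw in auto)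
        moreover have "dquot f z w - deriv f a = ((f z - deriv f a * z) - (f w - deriv f a * w)) / (z - w)"
          using False by (simp add: dquot_def divide_simps) (simp add: algebra_simps)
        ultimately show ?thesis
          using False by (simp only: norm_divide) (simp add: pos_divide_le_eq)
      qed
      show "\<exists>d>0. \<forall>x'. dist x' (a, a) < d \<longrightarrow>
          dist (case x' of (z, w) \<Rightarrow> dquot f z w) (case (a, a) of (z, w) \<Rightarrow> dquot f z w) < e"
      proof (intro exI [of _ s] conjI allI impI s(1))
        fix x' assume x': "dist x' (a, a) < s"
        obtain z w where zw: "x' = (z, w)" by (cases x')
        have "z \<in> ball a s" "w \<in> ball a s"
          using x' dist_fst_le [of x' "(a, a)"] dist_snd_le [of x' "(a, a)"] by (auto simp: zw dist_commute)
        then show "dist (case x' of (z, w) \<Rightarrow> dquot f z w) (case (a, a) of (z, w) \<Rightarrow> dquot f z w) < e"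
          using main \<open>0 < e\<close> by (fastforce simp: zw dist_norm dquot_def [of f a a])
      qed
    qed
  qed
  then show ?thesis by (simp add: continuous_at_imp_continuous_on)
qed

lemma holomorphic_on_dquot:
  assumes U: "open U" and f: "f holomorphic_on U" and z: "z \<in> U"
  shows "dquot f z holomorphic_on U"
proof (rule no_isolated_singularity [of _ _ "{z}"])
  show "continuous_on U (dquot f z)"
    by (rule continuous_on_slice(2) [OF continuous_on_dquot [OF U f] z])
  have "(\<lambda>w. (f z - f w) / (z - w)) holomorphic_on U - {z}"
    using f by (intro holomorphic_intros) (auto intro: holomorphic_on_subset)
  then show "dquot f z holomorphic_on U - {z}"
    by (rule holomorphic_transform) (auto simp: dquot_def)
qed (use U in auto)

section \<open>Cauchy's formula on unbounded domains\<close>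

locale cauchy_domain =
  fixes D :: "complex set" and C :: "(real \<Rightarrow> complex) set"
  assumes cauchy_domain: "unbounded_cauchy_domain D C"
begin

sublocale rect_cycle C
  using cauchy_domain by unfold_locales (auto simp: unbounded_cauchy_domain_def)

lemma open_domain: "open D"
  using cauchy_domain by (auto simp: unbounded_cauchy_domain_def)

lemma eventually_domain: "\<forall>\<^sub>F z in at_infinity. z \<in> D"
  using cauchy_domain by (auto simp: unbounded_cauchy_domain_def)

lemma cycle_image_eq: "cycle_image C = frontier D"
  using cauchy_domain by (auto simp: unbounded_cauchy_domain_def cycle_image_def)

lemma cycle_image_subset: "cycle_image C \<subseteq> closure D" "cycle_image C \<inter> D = {}"
  using open_domain by (auto simp: cycle_image_eq frontier_def interior_open)

lemma not_in_cycle_image: "w \<in> D \<or> w \<notin> closure D \<Longrightarrow> w \<notin> cycle_image C"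
  using cycle_image_subset by blast

lemma cint_cauchy_kernel:
  shows "w \<in> D \<Longrightarrow> cint C (\<lambda>z. 1 / (z - w)) = 0"
    and "w \<notin> closure D \<Longrightarrow> cint C (\<lambda>z. 1 / (z - w)) = -1"
  using cauchy_domain cint_winding [OF not_in_cycle_image, of w]
  by (auto simp: unbounded_cauchy_domain_def)

text \<open>Dixon's argument: the left-hand side minus \<^term>\<open>f w\<close> extends to an entire function by the
  Cauchy transform of \<^term>\<open>f\<close> outside \<^term>\<open>closure D\<close>.\<close>

theorem cint_dquot:
  assumes U: "open U" "closure D \<subseteq> U" and f: "f holomorphic_on U"
    and lim: "(f \<longlongrightarrow> c) at_infinity" and w: "w \<in> U"
  shows "cint C (\<lambda>z. dquot f z w) = f w - c"
proof -
  define H2 where "H2 = (\<lambda>w. cint C (\<lambda>z. (1 / (z - w)) *\<^sub>C f z))"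
  define H where "H = (\<lambda>w. if w \<in> U then cint C (\<lambda>z. dquot f z w) - f w else H2 w)"
  have sub: "cycle_image C \<subseteq> U" using cycle_image_subset U by blast
  have cf: "continuous_on (cycle_image C) f"
    using holomorphic_on_imp_continuous_on [OF f] sub continuous_on_subset by blast
  have "(\<lambda>w. cint C (\<lambda>z. dquot f z w)) holomorphic_on U"
    using sub by (intro cint_holomorphic_param U holomorphic_on_dquot f
        continuous_on_subset [OF continuous_on_dquot [OF U(1) f]]) auto
  then have "(\<lambda>w. cint C (\<lambda>z. dquot f z w) - f w) holomorphic_on U"
    using f by (intro holomorphic_intros)
  then have H_U: "H holomorphic_on U"
    by (rule holomorphic_transform) (simp add: H_def)
  have dq: "cint C (\<lambda>z. dquot f z w) = H2 w - cint C (\<lambda>z. 1 / (z - w)) * f w" if "w \<notin> cycle_image C" for w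
  proof -
    have c: "continuous_on (cycle_image C) (\<lambda>z. 1 / (z - w))"
      using that by (intro continuous_intros) auto
    have "cint C (\<lambda>z. dquot f z w) = cint C (\<lambda>z. (1 / (z - w)) *\<^sub>C f z - (1 / (z - w)) *\<^sub>C f w)"
      using that by (intro cint_cong) (auto simp: dquot_def scaleC_complex_def diff_divide_distrib)
    also have "\<dots> = H2 w - cint C (\<lambda>z. 1 / (z - w)) *\<^sub>C f w"
      unfolding H2_def by (simp add: cint_diff cint_scale_const c cf continuous_on_scaleC)
    finally show ?thesis by (simp add: scaleC_complex_def)
  qed
  have "H2 holomorphic_on - closure D"
    unfolding H2_def
  proof (rule cint_holomorphic_param)
    show "continuous_on (cycle_image C \<times> - closure D) (\<lambda>(z, w). (1 / (z - w)) *\<^sub>C f z)"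
      unfolding case_prod_unfold using not_in_cycle_image
      by (intro continuous_intros continuous_on_compose2 [OF cf]) auto
    show "(\<lambda>w. (1 / (z - w)) *\<^sub>C f z) holomorphic_on - closure D" if "z \<in> cycle_image C" for z
      unfolding scaleC_complex_def using not_in_cycle_image that
      by (intro holomorphic_intros) auto
  qed auto
  \<comment> \<open>Here the kernel integral is -1, so the term \<open>f w\<close> that it
    contributes cancels the one subtracted in \<open>H\<close>.\<close>
  moreover have "H2 w = H w" if "w \<in> - closure D" for w
    using that dq [of w] cint_cauchy_kernel(2) [of w] not_in_cycle_image [of w] by (simp add: H_def)
  ultimately have "H holomorphic_on - closure D"
    using holomorphic_transform by blast
  then have "H holomorphic_on U \<union> - closure D"
    by (intro holomorphic_on_Un H_U U) auto
  moreover have "U \<union> - closure D = UNIV" using U by blast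
  ultimately have "H holomorphic_on UNIV" by simp
  \<comment> \<open>Points near infinity lie in \<open>D\<close>, where the kernel integral is 0, so
    there \<open>H\<close> is the Cauchy transform minus \<open>f\<close>.\<close>
  moreover have "(H \<longlongrightarrow> 0 - c) at_infinity"
  proof (rule Lim_transform_eventually)
    show "((\<lambda>w. H2 w - f w) \<longlongrightarrow> 0 - c) at_infinity"
      unfolding H2_def by (intro tendsto_intros lim cint_cauchy_tendsto_0 cf)
    show "\<forall>\<^sub>F w in at_infinity. H2 w - f w = H w"
      using eventually_domain
    proof eventually_elim
      case (elim w)
      moreover have "w \<in> U" using elim U closure_subset by blast
      ultimately show ?case
        using dq [of w] cint_cauchy_kernel(1) [of w] not_in_cycle_image [of w] by (simp add: H_def)
    qed
  qed
  ultimately have "H w = 0 - c" by (rule Liouville_weak)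
  then have "cint C (\<lambda>z. dquot f z w) - f w = - c" using w by (simp add: H_def)
  then show ?thesis by (metis add_diff_cancel_left' add_uminus_conv_diff diff_add_cancel)
qed

end

text \<open>A maximum of \<^term>\<open>norm (H w) + \<epsilon> * (norm w)\<^sup>2\<close> cannot lie in the interior of a disc: averaging
  \<^term>\<open>H\<close> over the four points \<^term>\<open>w + \<i> ^ k * r\<close> kills the first and second order terms.\<close>

lemma Liouville_third_order:
  fixes H :: "complex \<Rightarrow> 'b::complex_banach"
  assumes expand: "\<And>w. \<exists>a b M d. 0 < d \<and>
      (\<forall>h. cmod h < d \<longrightarrow> norm (H (w + h) - (H w + h *\<^sub>C a + h\<^sup>2 *\<^sub>C b)) \<le> M * cmod h ^ 3)"
    and lim: "(H \<longlongrightarrow> 0) at_infinity"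
  shows "H w = 0"
proof (rule ccontr)
  assume "H w \<noteq> 0"
  define m where "m = norm (H w)"
  have m: "0 < m" using \<open>H w \<noteq> 0\<close> by (simp add: m_def)
  have "isCont H v" for v
  proof -
    obtain a b M d where d: "0 < d"
      and *: "\<And>h. cmod h < d \<Longrightarrow> norm (H (v + h) - (H v + h *\<^sub>C a + h\<^sup>2 *\<^sub>C b)) \<le> M * cmod h ^ 3"
      using expand by metis
    have "((\<lambda>h. H (v + h) - (H v + h *\<^sub>C a + h\<^sup>2 *\<^sub>C b)) \<longlongrightarrow> 0) (at 0)"
    proof (rule Lim_null_comparison)
      show "\<forall>\<^sub>F h in at 0. norm (H (v + h) - (H v + h *\<^sub>C a + h\<^sup>2 *\<^sub>C b)) \<le> M * cmod h ^ 3"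
        using d by (auto simp: eventually_at dist_norm intro!: exI [of _ d] *)
      show "((\<lambda>h. M * cmod h ^ 3) \<longlongrightarrow> 0) (at 0)"
        by (auto intro!: tendsto_eq_intros)
    qed
    moreover have "((\<lambda>h. H v + h *\<^sub>C a + h\<^sup>2 *\<^sub>C b) \<longlongrightarrow> H v + 0 *\<^sub>C a + 0\<^sup>2 *\<^sub>C b) (at 0)"
      by (intro tendsto_intros)
    ultimately have "((\<lambda>h. (H (v + h) - (H v + h *\<^sub>C a + h\<^sup>2 *\<^sub>C b)) + (H v + h *\<^sub>C a + h\<^sup>2 *\<^sub>C b)) \<longlongrightarrow> 0 + (H v + 0 *\<^sub>C a + 0\<^sup>2 *\<^sub>C b)) (at 0)"
      by (rule tendsto_add)
    then show ?thesis by (simp add: isCont_iff)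
  qed
  then have cont: "continuous_on S H" for S by (simp add: continuous_at_imp_continuous_on)
  have "\<forall>\<^sub>F v in at_infinity. norm (H v) < m / 2"
    using tendstoD [OF lim, of "m / 2"] m by simp
  then obtain \<rho>' where \<rho>': "\<And>v. \<rho>' \<le> cmod v \<Longrightarrow> norm (H v) < m / 2"
    unfolding eventually_at_infinity by blast
  define \<rho> where "\<rho> = max \<rho>' (cmod w + 1)"
  have \<rho>: "cmod w < \<rho>" "\<And>v. \<rho> \<le> cmod v \<Longrightarrow> norm (H v) < m / 2" using \<rho>' by (auto simp: \<rho>_def)
  then have "0 < \<rho>" using norm_ge_zero [of w] by linarith
  \<comment> \<open>On the circle of radius \<open>\<rho>\<close> the quadratic term is exactly
    \<open>m / 2\<close> and \<open>norm (H v)\<close> is below \<open>m / 2\<close>, whereas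
    \<open>u w\<close> is at least \<open>m\<close>. This keeps the maximum off the
    boundary.\<close>
  define \<epsilon> where "\<epsilon> = m / (2 * \<rho>\<^sup>2)"
  have \<epsilon>: "0 < \<epsilon>" "\<epsilon> * \<rho>\<^sup>2 = m / 2" using m \<open>0 < \<rho>\<close> by (auto simp: \<epsilon>_def)
  define u where "u = (\<lambda>v. norm (H v) + \<epsilon> * (cmod v)\<^sup>2)"
  have "continuous_on (cball 0 \<rho>) u"
    unfolding u_def by (intro continuous_intros cont)
  then obtain v where v: "v \<in> cball 0 \<rho>" "\<And>x. x \<in> cball 0 \<rho> \<Longrightarrow> u x \<le> u v"
    using continuous_attains_sup [of "cball 0 \<rho>" u] \<open>0 < \<rho>\<close> by auto
  have "m \<le> u w" using \<epsilon> by (simp add: u_def m_def)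
  then have uv: "m \<le> u v" using v(2) [of w] \<rho>(1) by simp
  have "cmod v < \<rho>"
  proof (rule ccontr)
    assume "\<not> cmod v < \<rho>"
    then have "cmod v = \<rho>" using v(1) by simp
    then have "u v < m / 2 + m / 2" using \<rho>(2) [of v] \<epsilon>(2) by (simp add: u_def)
    then show False using uv by simp
  qed
  obtain a b M d where d: "0 < d"
    and *: "\<And>h. cmod h < d \<Longrightarrow> norm (H (v + h) - (H v + h *\<^sub>C a + h\<^sup>2 *\<^sub>C b)) \<le> M * cmod h ^ 3"
    using expand by metis
  \<comment> \<open>The first two bounds keep the four points within the range of the expansion and
    inside the disc. The third makes the cubic error \<open>M * r ^ 3\<close> at most half of the
    gain \<open>\<epsilon> * r\<^sup>2\<close>.\<close>
  define r where "r = min (d / 2) (min (\<rho> - cmod v) (\<epsilon> / (2 * (\<bar>M\<bar> + 1))))"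
  have r: "0 < r" "r < d" "r \<le> \<rho> - cmod v" "r \<le> \<epsilon> / (2 * (\<bar>M\<bar> + 1))"
    using d \<open>cmod v < \<rho>\<close> \<epsilon>(1) by (auto simp: r_def min_less_iff_conj)
  let ?e = "\<lambda>h. H (v + h) - (H v + h *\<^sub>C a + h\<^sup>2 *\<^sub>C b)"
  define R where "R = complex_of_real r"
  have e: "norm (?e h) \<le> M * r ^ 3" and uh: "norm (H (v + h)) \<le> u v - \<epsilon> * (cmod (v + h))\<^sup>2"
    if "h \<in> {R, - R, \<i> * R, - (\<i> * R)}" for h
  proof -
    have h: "cmod h = r" using that r(1) by (auto simp: R_def norm_mult)
    then show "norm (?e h) \<le> M * r ^ 3" using * [of h] r by simp
    have "v + h \<in> cball 0 \<rho>" using h r(3) norm_triangle_ineq [of v h] by simp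
    then show "norm (H (v + h)) \<le> u v - \<epsilon> * (cmod (v + h))\<^sup>2" using v(2) by (fastforce simp: u_def)
  qed
  have "4 *\<^sub>C H v = H (v + R) + H (v + - R) + H (v + \<i> * R) + H (v + - (\<i> * R))
      - (?e R + ?e (- R) + ?e (\<i> * R) + ?e (- (\<i> * R)))"
  proof -
    have "(4::complex) = 1 + 1 + 1 + 1" by simp
    then have "4 *\<^sub>C H v = H v + H v + H v + H v" by (simp only: scaleC_add_left scaleC_one)
    then show ?thesis by (simp add: scaleC_minus_left power2_eq_square algebra_simps)
  qed
  then have "norm (4 *\<^sub>C H v) \<le> norm (H (v + R)) + norm (H (v + - R)) + norm (H (v + \<i> * R)) + norm (H (v + - (\<i> * R)))
      + (norm (?e R) + norm (?e (- R)) + norm (?e (\<i> * R)) + norm (?e (- (\<i> * R))))"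
    by (smt (verit) norm_triangle_ineq norm_triangle_ineq4)
  also have "\<dots> \<le> 4 * u v - \<epsilon> * ((cmod (v + R))\<^sup>2 + (cmod (v + - R))\<^sup>2 + (cmod (v + \<i> * R))\<^sup>2 + (cmod (v + - (\<i> * R)))\<^sup>2) + 4 * (M * r ^ 3)"
    using e [of R] e [of "- R"] e [of "\<i> * R"] e [of "- (\<i> * R)"]
      uh [of R] uh [of "- R"] uh [of "\<i> * R"] uh [of "- (\<i> * R)"]
    by (simp add: distrib_left)
  \<comment> \<open>By the parallelogram law the four squares exceed
    \<open>4 * (cmod v)\<^sup>2\<close> by \<open>4 * r\<^sup>2\<close>: the second-order gain that
    contradicts the maximality of \<open>u v\<close>.\<close>
  also have "(cmod (v + R))\<^sup>2 + (cmod (v + - R))\<^sup>2 + (cmod (v + \<i> * R))\<^sup>2 + (cmod (v + - (\<i> * R)))\<^sup>2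
      = 4 * ((cmod v)\<^sup>2 + r\<^sup>2)"
    unfolding cmod_power2 by (simp add: R_def power2_eq_square algebra_simps)
  finally have "4 * norm (H v) \<le> 4 * u v - \<epsilon> * (4 * ((cmod v)\<^sup>2 + r\<^sup>2)) + 4 * (M * r ^ 3)"
    by (simp add: norm_scaleC)
  then have "\<epsilon> * r\<^sup>2 \<le> M * r ^ 3" by (simp add: u_def algebra_simps)
  then have "\<epsilon> * r\<^sup>2 \<le> (M * r) * r\<^sup>2" by (simp add: power2_eq_square power3_eq_cube mult_ac)
  then have "\<epsilon> \<le> M * r" using r(1) by simp
  also have "\<dots> \<le> (\<bar>M\<bar> + 1) * r" using r(1) by (intro mult_right_mono) auto
  also have "\<dots> \<le> (\<bar>M\<bar> + 1) * (\<epsilon> / (2 * (\<bar>M\<bar> + 1)))" using r(4) by (intro mult_left_mono) auto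
  also have "\<dots> = \<epsilon> / 2" by (simp add: field_simps)
  finally show False using \<epsilon>(1) by simp
qed

section \<open>Resolvents\<close>

definition complex_linear :: "('a::complex_banach \<Rightarrow>\<^sub>L 'b::complex_banach) \<Rightarrow> bool"
  where "complex_linear T \<longleftrightarrow> (\<forall>c x. blinfun_apply T (c *\<^sub>C x) = c *\<^sub>C blinfun_apply T x)"

lemma compose_scaleC_left: "(c *\<^sub>C S) o\<^sub>L T = c *\<^sub>C (S o\<^sub>L T)"
  by (rule blinfun_eqI) (simp add: blinfun_apply_scaleC)

lemma compose_scaleC_right: "complex_linear S \<Longrightarrow> S o\<^sub>L (c *\<^sub>C T) = c *\<^sub>C (S o\<^sub>L T)"
  by (rule blinfun_eqI) (simp add: blinfun_apply_scaleC complex_linear_def)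

lemmas compose_add_left = bounded_bilinear.add_left [OF bounded_bilinear_blinfun_compose]
lemmas compose_add_right = bounded_bilinear.add_right [OF bounded_bilinear_blinfun_compose]
lemmas compose_diff_left = bounded_bilinear.diff_left [OF bounded_bilinear_blinfun_compose]
lemmas compose_diff_right = bounded_bilinear.diff_right [OF bounded_bilinear_blinfun_compose]
lemmas compose_zero_right = bounded_bilinear.zero_right [OF bounded_bilinear_blinfun_compose]

lemma compose_assoc: "(S o\<^sub>L T) o\<^sub>L V = S o\<^sub>L (T o\<^sub>L V)"
  by (rule blinfun_eqI) simp

lemma compose_id [simp]: "T o\<^sub>L id_blinfun = T" "id_blinfun o\<^sub>L T = T"
  by (rule blinfun_eqI, simp)+

lemma resolvent_setI:
  fixes S :: "'a::complex_banach \<Rightarrow>\<^sub>L 'a"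
  assumes "\<And>x. S x \<in> D" "\<And>x. c *\<^sub>C S x - T (S x) = x" "\<And>x. x \<in> D \<Longrightarrow> S (c *\<^sub>C x - T x) = x"
  shows "c \<in> resolvent_set D T"
proof -
  have bij: "bij_betw (\<lambda>x. c *\<^sub>C x - T x) D UNIV"
    by (rule bij_betw_byWitness [where f' = S]) (use assms in auto)
  have "inv_into D (\<lambda>x. c *\<^sub>C x - T x) = S"
    using bij assms by (auto intro!: ext inv_into_f_eq simp: bij_betw_def)
  then show ?thesis
    using bij by (simp add: resolvent_set_def blinfun.bounded_linear_right)
qed

lemma resolvent_setD:
  assumes "c \<in> resolvent_set D T"
  shows "resolvent D T c x \<in> D"
    and "c *\<^sub>C resolvent D T c x - T (resolvent D T c x) = x"
    and "x \<in> D \<Longrightarrow> resolvent D T c (c *\<^sub>C x - T x) = x"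
proof -
  have bij: "bij_betw (\<lambda>x. c *\<^sub>C x - T x) D UNIV"
    and bl: "bounded_linear (inv_into D (\<lambda>x. c *\<^sub>C x - T x))"
    using assms by (auto simp: resolvent_set_def)
  then have eq: "resolvent D T c x = inv_into D (\<lambda>x. c *\<^sub>C x - T x) x" for x
    by (simp add: resolvent_def bounded_linear_Blinfun_apply)
  show "resolvent D T c x \<in> D"
    unfolding eq using bij by (metis UNIV_I bij_betw_def inv_into_into)
  show "c *\<^sub>C resolvent D T c x - T (resolvent D T c x) = x"
    unfolding eq using bij bij_betw_inv_into_right [OF bij, of x] by simp
  show "x \<in> D \<Longrightarrow> resolvent D T c (c *\<^sub>C x - T x) = x"
    unfolding eq using bij_betw_inv_into_left [OF bij, of x] by simp
qed

locale closed_op =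
  fixes domA :: "'a::complex_banach set" and A :: "'a \<Rightarrow> 'a"
  assumes closed_operator: "closed_operator domA A"
begin

abbreviation "R \<equiv> resolvent domA A"
abbreviation "\<rho> \<equiv> resolvent_set domA A"

lemma zero_dom: "0 \<in> domA"
  and add_dom: "x \<in> domA \<Longrightarrow> y \<in> domA \<Longrightarrow> x + y \<in> domA"
  and add_op: "x \<in> domA \<Longrightarrow> y \<in> domA \<Longrightarrow> A (x + y) = A x + A y"
  and scale_dom: "x \<in> domA \<Longrightarrow> c *\<^sub>C x \<in> domA"
  and scale_op: "x \<in> domA \<Longrightarrow> A (c *\<^sub>C x) = c *\<^sub>C A x"
  using closed_operator by (auto simp: closed_operator_def)

lemma diff_dom: "x \<in> domA \<Longrightarrow> y \<in> domA \<Longrightarrow> x - y \<in> domA"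
  using add_dom [of x "(-1) *\<^sub>C y"] scale_dom [of y "-1"] by (simp add: scaleC_minus_left)

lemma resolvent_eqI: "c \<in> \<rho> \<Longrightarrow> y \<in> domA \<Longrightarrow> c *\<^sub>C y - A y = x \<Longrightarrow> R c x = y"
  using resolvent_setD(3) by metis

lemma complex_linear_resolvent: "c \<in> \<rho> \<Longrightarrow> complex_linear (R c)"
  unfolding complex_linear_def
proof (intro allI)
  fix k x assume c: "c \<in> \<rho>"
  note R = resolvent_setD(1,2) [OF c, of x]
  show "R c (k *\<^sub>C x) = k *\<^sub>C R c x"
  proof (rule resolvent_eqI [OF c scale_dom [OF R(1)]])
    have "c *\<^sub>C k *\<^sub>C R c x - A (k *\<^sub>C R c x) = k *\<^sub>C (c *\<^sub>C R c x - A (R c x))"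
      by (simp add: scale_op R(1) scaleC_diff_right scaleC_scaleC mult.commute)
    then show "c *\<^sub>C k *\<^sub>C R c x - A (k *\<^sub>C R c x) = k *\<^sub>C x" by (simp add: R(2))
  qed
qed

lemma resolvent_identity:
  assumes c: "c \<in> \<rho>" and d: "d \<in> \<rho>"
  shows "R c - R d = (d - c) *\<^sub>C (R c o\<^sub>L R d)"
proof (rule blinfun_eqI)
  fix x
  define y where "y = R d x"
  have y: "y \<in> domA" "d *\<^sub>C y - A y = x" using resolvent_setD [OF d] by (auto simp: y_def)
  then have "x = (c *\<^sub>C y - A y) + (d - c) *\<^sub>C y" by (simp add: scaleC_diff_left)
  then have "R c x = R c (c *\<^sub>C y - A y) + R c ((d - c) *\<^sub>C y)" by (metis blinfun.add_right)
  also have "\<dots> = y + (d - c) *\<^sub>C R c y"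
    using resolvent_setD(3) [OF c y(1)] complex_linear_resolvent [OF c] by (simp add: complex_linear_def)
  finally show "blinfun_apply (R c - R d) x = blinfun_apply ((d - c) *\<^sub>C (R c o\<^sub>L R d)) x"
    by (simp add: blinfun.diff_left blinfun_apply_scaleC y_def)
qed

lemma resolvent_commute:
  assumes c: "c \<in> \<rho>" and d: "d \<in> \<rho>"
  shows "R c o\<^sub>L R d = R d o\<^sub>L R c"
proof (cases "c = d")
  case False
  have "(d - c) *\<^sub>C (R c o\<^sub>L R d) = - ((c - d) *\<^sub>C (R d o\<^sub>L R c))"
    unfolding resolvent_identity [OF c d, symmetric] resolvent_identity [OF d c, symmetric] by simp
  also have "\<dots> = (d - c) *\<^sub>C (R d o\<^sub>L R c)" by (simp flip: scaleC_minus_left)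
  finally have "(d - c) *\<^sub>C ((R c o\<^sub>L R d) - (R d o\<^sub>L R c)) = 0" by (simp add: scaleC_diff_right)
  then have "d - c = 0 \<or> (R c o\<^sub>L R d) - (R d o\<^sub>L R c) = 0" by (simp only: scaleC_eq_0_iff)
  then show ?thesis using False by (metis eq_iff_diff_eq_0)
qed simp

lemma resolvent_inj: "c \<in> \<rho> \<Longrightarrow> R c x = 0 \<Longrightarrow> x = 0"
  using resolvent_setD(2) [of c domA A x] resolvent_eqI [of c 0] scale_op [OF zero_dom, of 0] by simp

text \<open>The equation \<open>d *\<^sub>C x - A x = y\<close> is equivalent to
  \<open>x = R c (y - (d - c) *\<^sub>C x)\<close>, whose right-hand side contracts by 1/2. The
  fixed point takes the place of the Neumann series, and its uniqueness gives linearity of the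
  solution.\<close>

lemma resolvent_set_ball:
  assumes c: "c \<in> \<rho>" and d: "cmod (d - c) * norm (R c) \<le> 1 / 2"
  shows "d \<in> \<rho>"
proof -
  define h where "h = d - c"
  have h: "cmod h * norm (R c) \<le> 1 / 2" using d by (simp add: h_def)
  have contr: "norm (h *\<^sub>C R c x) \<le> 1 / 2 * norm x" for x
  proof -
    have "norm (h *\<^sub>C R c x) \<le> cmod h * (norm (R c) * norm x)"
      unfolding norm_scaleC by (intro mult_left_mono norm_blinfun) auto
    also have "\<dots> \<le> 1 / 2 * norm x" using mult_right_mono [OF h, of "norm x"] by (simp add: mult_ac)
    finally show ?thesis .
  qed
  have Rlin: "R c (k *\<^sub>C x) = k *\<^sub>C R c x" for k x
    using complex_linear_resolvent [OF c] by (simp add: complex_linear_def)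
  have "\<exists>!x. R c (y - h *\<^sub>C x) = x" for y
  proof (rule banach_fix_type [of "1/2"])
    show "\<forall>x x'. dist (R c (y - h *\<^sub>C x)) (R c (y - h *\<^sub>C x')) \<le> 1 / 2 * dist x x'"
    proof (intro allI)
      fix x x'
      have "R c (y - h *\<^sub>C x) - R c (y - h *\<^sub>C x') = - (h *\<^sub>C R c (x - x'))"
        by (simp add: blinfun.diff_right Rlin scaleC_diff_right)
      then show "dist (R c (y - h *\<^sub>C x)) (R c (y - h *\<^sub>C x')) \<le> 1 / 2 * dist x x'"
        using contr [of "x - x'"] by (simp add: dist_norm)
    qed
  qed auto
  then obtain S where S: "\<And>y. R c (y - h *\<^sub>C S y) = S y"
    and S_unique: "\<And>x y. R c (y - h *\<^sub>C x) = x \<Longrightarrow> S y = x" by metis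
  have "bounded_linear S"
  proof (rule bounded_linear_intro [where K = "2 * norm (R c)"])
    fix x y :: 'a and k :: real
    show "S (x + y) = S x + S y"
    proof (rule S_unique)
      have "R c (x + y - h *\<^sub>C (S x + S y)) = R c (x - h *\<^sub>C S x) + R c (y - h *\<^sub>C S y)"
        by (simp add: scaleC_add_right algebra_simps flip: blinfun.add_right)
      then show "R c (x + y - h *\<^sub>C (S x + S y)) = S x + S y" by (simp add: S)
    qed
    show "S (k *\<^sub>R x) = k *\<^sub>R S x"
    proof (rule S_unique)
      have "R c (k *\<^sub>R x - h *\<^sub>C (k *\<^sub>R S x)) = k *\<^sub>R R c (x - h *\<^sub>C S x)"
        by (simp add: scaleC_scaleR_commute scaleR_diff_right flip: blinfun.scaleR_right)
      then show "R c (k *\<^sub>R x - h *\<^sub>C (k *\<^sub>R S x)) = k *\<^sub>R S x" by (simp add: S)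
    qed
    have "S x = R c x - h *\<^sub>C R c (S x)" using S [of x] by (simp add: blinfun.diff_right Rlin)
    then have "norm (S x) \<le> norm (R c x) + norm (h *\<^sub>C R c (S x))" by (metis norm_triangle_ineq4)
    also have "\<dots> \<le> norm (R c) * norm x + 1 / 2 * norm (S x)" by (intro add_mono norm_blinfun contr)
    finally show "norm (S x) \<le> norm x * (2 * norm (R c))" by (simp add: mult_ac)
  qed
  then have Sb: "blinfun_apply (Blinfun S) = S" by (simp add: bounded_linear_Blinfun_apply)
  show ?thesis
  proof (rule resolvent_setI [of "Blinfun S"], unfold Sb)
    fix x
    show dom: "S x \<in> domA" using resolvent_setD(1) [OF c, of "x - h *\<^sub>C S x"] by (simp add: S)
    show "d *\<^sub>C S x - A (S x) = x"
      using resolvent_setD(2) [OF c, of "x - h *\<^sub>C S x"] unfolding S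
      by (simp add: h_def scaleC_diff_left algebra_simps)
  next
    fix x assume x: "x \<in> domA"
    have "d *\<^sub>C x - A x - h *\<^sub>C x = c *\<^sub>C x - A x" by (simp add: h_def scaleC_diff_left)
    then show "S (d *\<^sub>C x - A x) = x" using resolvent_setD(3) [OF c x] by (intro S_unique) (simp only:)
  qed
qed

text \<open>In \<open>R d = R c - (d - c) *\<^sub>C (R c o\<^sub>L R d)\<close> the last term has at
  most half the norm of \<open>R d\<close> and is absorbed.\<close>

lemma resolvent_norm_near:
  assumes c: "c \<in> \<rho>" and d: "cmod (d - c) * norm (R c) \<le> 1 / 2"
  shows "norm (R d) \<le> 2 * norm (R c)"
proof -
  have "R d = R c - (d - c) *\<^sub>C (R c o\<^sub>L R d)"
    using resolvent_identity [OF c resolvent_set_ball [OF assms]] by (metis diff_diff_eq2 add_diff_cancel_left')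
  then have "norm (R d) \<le> norm (R c) + norm ((d - c) *\<^sub>C (R c o\<^sub>L R d))" by (metis norm_triangle_ineq4)
  also have "norm ((d - c) *\<^sub>C (R c o\<^sub>L R d)) \<le> cmod (d - c) * (norm (R c) * norm (R d))"
    unfolding norm_scaleC by (intro mult_left_mono norm_blinfun_compose) auto
  also have "\<dots> \<le> 1 / 2 * norm (R d)" using mult_right_mono [OF d, of "norm (R d)"] by (simp add: mult_ac)
  finally show ?thesis by simp
qed

lemma resolvent_near_radius:
  assumes "c \<in> \<rho>"
  obtains r where "0 < r" "\<And>h. cmod h < r \<Longrightarrow> cmod h * norm (R c) \<le> 1 / 2"
proof
  have p: "0 < 2 * (norm (R c) + 1)" by (intro mult_pos_pos add_nonneg_pos) auto
  then show "0 < 1 / (2 * (norm (R c) + 1))" by simp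
  fix h assume "cmod h < 1 / (2 * (norm (R c) + 1))"
  then have "cmod h * (2 * (norm (R c) + 1)) < 1" using p by (simp only: pos_less_divide_eq)
  then have "2 * cmod h + 2 * (cmod h * norm (R c)) < 1" by (simp add: algebra_simps)
  then show "cmod h * norm (R c) \<le> 1 / 2" using norm_ge_zero [of h] by linarith
qed

text \<open>Three applications of the resolvent identity give an exact remainder,
  \<open>h ^ 3\<close> times operators that stay bounded near \<open>c\<close>. The form is the one
  that \<open>Liouville_third_order\<close> asks for.\<close>

lemma resolvent_expansion:
  assumes c: "c \<in> \<rho>"
  shows "\<exists>a b M r. 0 < r \<and> (\<forall>h. cmod h < r \<longrightarrow>
      c + h \<in> \<rho> \<and> norm (R (c + h) - (R c + h *\<^sub>C a + h\<^sup>2 *\<^sub>C b)) \<le> M * cmod h ^ 3)"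
proof -
  obtain r where r: "0 < r" "\<And>h. cmod h < r \<Longrightarrow> cmod h * norm (R c) \<le> 1 / 2"
    using resolvent_near_radius [OF c] by metis
  let ?R2 = "R c o\<^sub>L R c"
  let ?R3 = "R c o\<^sub>L ?R2"
  have "c + h \<in> \<rho> \<and> norm (R (c + h) - (R c + h *\<^sub>C (- ?R2) + h\<^sup>2 *\<^sub>C ?R3)) \<le> (norm ?R3 * (2 * norm (R c))) * cmod h ^ 3"
    if h: "cmod h < r" for h
  proof
    show mem: "c + h \<in> \<rho>" using resolvent_set_ball [OF c, of "c + h"] r(2) [OF h] by simp
    let ?S = "R (c + h)"
    note lin = complex_linear_resolvent [OF c]
    have 1: "?S = R c - h *\<^sub>C (R c o\<^sub>L ?S)"
      using resolvent_identity [OF c mem] by (simp add: algebra_simps)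
    have 2: "R c o\<^sub>L ?S = ?R2 - h *\<^sub>C (R c o\<^sub>L (R c o\<^sub>L ?S))"
      by (subst 1) (simp add: compose_diff_right compose_scaleC_right [OF lin])
    have 3: "R c o\<^sub>L (R c o\<^sub>L ?S) = ?R3 - h *\<^sub>C (?R3 o\<^sub>L ?S)"
      by (subst 2) (simp add: compose_diff_right compose_scaleC_right [OF lin] compose_assoc)
    have "?S - (R c + h *\<^sub>C (- ?R2) + h\<^sup>2 *\<^sub>C ?R3) = - (h ^ 3 *\<^sub>C (?R3 o\<^sub>L ?S))"
    proof -
      have "?S = R c - h *\<^sub>C (?R2 - h *\<^sub>C (?R3 - h *\<^sub>C (?R3 o\<^sub>L ?S)))"
        using 1 2 3 by simp
      then show ?thesis
        by (simp add: scaleC_diff_right scaleC_add_right scaleC_minus_right scaleC_scaleC power2_eq_square power3_eq_cube algebra_simps)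
    qed
    then have "norm (?S - (R c + h *\<^sub>C (- ?R2) + h\<^sup>2 *\<^sub>C ?R3)) = cmod h ^ 3 * norm (?R3 o\<^sub>L ?S)"
      by (simp add: norm_scaleC norm_power)
    also have "\<dots> \<le> cmod h ^ 3 * (norm ?R3 * (2 * norm (R c)))"
      using resolvent_norm_near [OF c, of "c + h"] r(2) [OF h]
      by (intro mult_left_mono order_trans [OF norm_blinfun_compose]) auto
    finally show "norm (?S - (R c + h *\<^sub>C (- ?R2) + h\<^sup>2 *\<^sub>C ?R3)) \<le> (norm ?R3 * (2 * norm (R c))) * cmod h ^ 3"
      by (simp add: mult_ac)
  qed
  then show ?thesis using r(1) by blast
qed

lemma continuous_on_resolvent:
  assumes "S \<subseteq> \<rho>"
  shows "continuous_on S R"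
proof -
  have "isCont R c" if c: "c \<in> \<rho>" for c
    unfolding isCont_iff
  proof (rule LIM_zero_cancel, rule Lim_null_comparison)
    obtain r where r: "0 < r" "\<And>h. cmod h < r \<Longrightarrow> cmod h * norm (R c) \<le> 1 / 2"
      using resolvent_near_radius [OF c] by metis
    have "norm (R (c + h) - R c) \<le> cmod h * (norm (R c) * (2 * norm (R c)))" if "cmod h < r" for h
    proof -
      have h: "cmod (c + h - c) * norm (R c) \<le> 1 / 2" using r(2) [OF that] by simp
      have "norm (R (c + h) - R c) = cmod h * norm (R c o\<^sub>L R (c + h))"
        using resolvent_identity [OF c resolvent_set_ball [OF c h]]
        by (metis add_diff_cancel_left' norm_minus_commute norm_scaleC)
      also have "\<dots> \<le> cmod h * (norm (R c) * (2 * norm (R c)))"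
        by (intro mult_left_mono order_trans [OF norm_blinfun_compose] resolvent_norm_near [OF c h]) auto
      finally show ?thesis .
    qed
    then show "\<forall>\<^sub>F h in at 0. norm (R (c + h) - R c) \<le> cmod h * (norm (R c) * (2 * norm (R c)))"
      using r(1) by (auto simp: eventually_at dist_norm intro!: exI [of _ r])
    show "((\<lambda>h. cmod h * (norm (R c) * (2 * norm (R c)))) \<longlongrightarrow> 0) (at 0)"
      by (auto intro!: tendsto_eq_intros)
  qed
  then show ?thesis using assms by (auto intro: continuous_at_imp_continuous_on)
qed

end

section \<open>The operational calculus\<close>

locale taylor_setting = closed_op domA A + cauchy_domain D C
  for domA :: "'a::complex_banach set" and A :: "'a \<Rightarrow> 'a" and D :: "complex set" and C :: "(real \<Rightarrow> complex) set" +
  assumes resolvent_ne: "resolvent_set domA A \<noteq> {}"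
    and spectrum_subset: "spectrum domA A \<subseteq> D"
begin

lemma not_domain_resolvent: "w \<notin> D \<Longrightarrow> w \<in> \<rho>"
  using spectrum_subset by (auto simp: spectrum_def)

lemma cycle_image_resolvent: "z \<in> cycle_image C \<Longrightarrow> z \<in> \<rho>"
  using cycle_image_subset(2) not_domain_resolvent by blast

lemma continuous_on_cycle_resolvent: "continuous_on (cycle_image C) R"
  using continuous_on_resolvent cycle_image_resolvent by blast

text \<open>Dividing the resolvent identity by \<open>z - w\<close> and integrating over
  \<open>z\<close> expresses the Cauchy transform of the resolvent through \<open>R w\<close> and
  the single operator \<open>cint C R\<close>, which is to be shown to vanish.\<close>

lemma cint_kernel_resolvent:
  assumes w: "w \<in> \<rho>" "w \<notin> cycle_image C"
  shows "cint C (\<lambda>z. (1 / (z - w)) *\<^sub>C R z) = cint C (\<lambda>z. 1 / (z - w)) *\<^sub>C R w - (R w o\<^sub>L cint C R)"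
proof -
  have c: "continuous_on (cycle_image C) (\<lambda>z. 1 / (z - w))"
    using w by (intro continuous_intros) auto
  have "R w o\<^sub>L cint C R = cint C (\<lambda>z. R w o\<^sub>L R z)"
    using complex_linear_resolvent [OF w(1)]
    by (intro cint_map [symmetric] continuous_on_cycle_resolvent
        bounded_bilinear.bounded_linear_right [OF bounded_bilinear_blinfun_compose] compose_scaleC_right)
  also have "\<dots> = cint C (\<lambda>z. (1 / (z - w)) *\<^sub>C R w - (1 / (z - w)) *\<^sub>C R z)"
  proof (rule cint_cong)
    fix z assume z: "z \<in> cycle_image C"
    have "(1 / (z - w)) *\<^sub>C (R w - R z) = R w o\<^sub>L R z"
      using resolvent_identity [OF w(1) cycle_image_resolvent [OF z]] z w(2) by (auto simp: scaleC_scaleC)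
    then show "(R w o\<^sub>L R z) = (1 / (z - w)) *\<^sub>C R w - (1 / (z - w)) *\<^sub>C R z"
      by (simp add: scaleC_diff_right)
  qed
  also have "\<dots> = cint C (\<lambda>z. 1 / (z - w)) *\<^sub>C R w - cint C (\<lambda>z. (1 / (z - w)) *\<^sub>C R z)"
    by (simp add: cint_diff cint_scale_const c continuous_on_scaleC continuous_on_cycle_resolvent)
  finally show ?thesis by simp
qed

text \<open>The geometric series of \<open>1 / (z - w - h)\<close> in \<open>h\<close> is cut off
  after the quadratic term; the remainder is
  \<open>h ^ 3 / ((z - w) ^ 3 * (z - w - h))\<close>.\<close>

lemma cauchy_transform_expansion:
  fixes F :: "complex \<Rightarrow> 'b::complex_banach"
  assumes F: "continuous_on (cycle_image C) F" and w: "w \<in> D"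
  shows "\<exists>a b M r. 0 < r \<and> (\<forall>h. cmod h < r \<longrightarrow> w + h \<in> D \<and>
      norm (cint C (\<lambda>z. (1 / (z - (w + h))) *\<^sub>C F z) - (cint C (\<lambda>z. (1 / (z - w)) *\<^sub>C F z) + h *\<^sub>C a + h\<^sup>2 *\<^sub>C b))
        \<le> M * cmod h ^ 3)"
proof -
  obtain M where M: "M \<ge> 0" "\<And>(F :: complex \<Rightarrow> 'b) b. continuous_on (cycle_image C) F \<Longrightarrow>
     (\<forall>z\<in>cycle_image C. norm (F z) \<le> b) \<Longrightarrow> norm (cint C F) \<le> M * b"
    using cint_bounded by metis
  obtain B where B: "B > 0" "\<And>z. z \<in> cycle_image C \<Longrightarrow> norm (F z) \<le> B"
    using compact_imp_bounded [OF compact_continuous_image [OF F compact_cycle_image]] unfolding bounded_pos by auto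
  \<comment> \<open>A disc of twice the radius is kept free of the curves, so that
    \<open>z - (w + h)\<close> still has modulus at least \<open>r\<close>.\<close>
  obtain r where r: "0 < r" "ball w (2 * r) \<subseteq> D"
  proof -
    obtain s where "0 < s" "ball w s \<subseteq> D" using open_domain w by (meson open_contains_ball)
    then show ?thesis using that [of "s / 2"] by simp
  qed
  have far: "2 * r \<le> cmod (z - w)" if "z \<in> cycle_image C" for z
  proof (rule ccontr)
    assume "\<not> 2 * r \<le> cmod (z - w)"
    then have "z \<in> ball w (2 * r)" by (simp add: dist_norm norm_minus_commute)
    then show False using r(2) that cycle_image_subset(2) by blast
  qed
  define a b where "a = cint C (\<lambda>z. (1 / (z - w)\<^sup>2) *\<^sub>C F z)" and "b = cint C (\<lambda>z. (1 / (z - w) ^ 3) *\<^sub>C F z)"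
  have nz: "z - w \<noteq> 0" if "z \<in> cycle_image C" for z using far [OF that] r(1) by auto
  have "w + h \<in> D \<and> norm (cint C (\<lambda>z. (1 / (z - (w + h))) *\<^sub>C F z) - (cint C (\<lambda>z. (1 / (z - w)) *\<^sub>C F z) + h *\<^sub>C a + h\<^sup>2 *\<^sub>C b))
        \<le> (M * (1 / (r ^ 3 * r) * B)) * cmod h ^ 3" if h: "cmod h < r" for h
  proof
    show wh: "w + h \<in> D" using h r by (intro subsetD [OF r(2)]) (simp add: dist_norm)
    have far2: "r \<le> cmod (z - (w + h))" if "z \<in> cycle_image C" for z
      using far [OF that] h norm_triangle_ineq2 [of "z - w" h] by (simp add: diff_diff_eq)
    have nz2: "z - (w + h) \<noteq> 0" if "z \<in> cycle_image C" for z using far2 [OF that] r(1) by auto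
    have c0: "continuous_on (cycle_image C) (\<lambda>z. (1 / (z - (w + h))) *\<^sub>C F z)"
      and c1: "continuous_on (cycle_image C) (\<lambda>z. (1 / (z - w)) *\<^sub>C F z)"
      and c2: "continuous_on (cycle_image C) (\<lambda>z. (1 / (z - w)\<^sup>2) *\<^sub>C F z)"
      and c3: "continuous_on (cycle_image C) (\<lambda>z. (1 / (z - w) ^ 3) *\<^sub>C F z)"
      using nz nz2 by (auto intro!: continuous_intros F)
    define G where "G = (\<lambda>z. (1 / (z - (w + h))) *\<^sub>C F z - ((1 / (z - w)) *\<^sub>C F z + h *\<^sub>C ((1 / (z - w)\<^sup>2) *\<^sub>C F z) + h\<^sup>2 *\<^sub>C ((1 / (z - w) ^ 3) *\<^sub>C F z)))"
    have cG: "continuous_on (cycle_image C) G"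
      unfolding G_def by (intro continuous_intros c0 c1 c2 c3)
    have "cint C G = cint C (\<lambda>z. (1 / (z - (w + h))) *\<^sub>C F z) - (cint C (\<lambda>z. (1 / (z - w)) *\<^sub>C F z) + h *\<^sub>C a + h\<^sup>2 *\<^sub>C b)"
      unfolding G_def a_def b_def
      by (simp add: cint_diff cint_add cint_scale c0 c1 c2 c3 continuous_on_add continuous_on_scaleC)
    moreover have "norm (cint C G) \<le> M * (cmod h ^ 3 * (1 / (r ^ 3 * r)) * B)"
    proof (intro M(2) cG ballI)
      fix z assume z: "z \<in> cycle_image C"
      have "1 / (z - (w + h)) - (1 / (z - w) + h * (1 / (z - w)\<^sup>2) + h\<^sup>2 * (1 / (z - w) ^ 3))
          = h ^ 3 * (1 / ((z - w) ^ 3 * (z - (w + h))))"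
      proof -
        define x where "x = z - w"
        have x: "x \<noteq> 0" "x - h \<noteq> 0" using nz [OF z] nz2 [OF z] by (auto simp: x_def algebra_simps)
        have "1 / (x - h) - (1 / x + h * (1 / x\<^sup>2) + h\<^sup>2 * (1 / x ^ 3)) = h ^ 3 * (1 / (x ^ 3 * (x - h)))"
          using x by (simp add: field_simps power2_eq_square power3_eq_cube)
        then show ?thesis by (simp add: x_def diff_diff_eq)
      qed
      then have "G z = (h ^ 3 * (1 / ((z - w) ^ 3 * (z - (w + h))))) *\<^sub>C F z"
        by (simp add: G_def scaleC_scaleC flip: scaleC_add_left scaleC_diff_left)
      then have "norm (G z) = cmod h ^ 3 * (1 / (cmod (z - w) ^ 3 * cmod (z - (w + h)))) * norm (F z)"
        by (simp add: norm_scaleC norm_mult norm_divide norm_power)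
      also have "\<dots> \<le> cmod h ^ 3 * (1 / (r ^ 3 * r)) * B"
      proof (intro mult_mono B(2) z)
        have "r ^ 3 \<le> cmod (z - w) ^ 3" using far [OF z] r(1) by (intro power_mono) auto
        then have "r ^ 3 * r \<le> cmod (z - w) ^ 3 * cmod (z - (w + h))"
          using far2 [OF z] r(1) by (intro mult_mono) auto
        then show "1 / (cmod (z - w) ^ 3 * cmod (z - (w + h))) \<le> 1 / (r ^ 3 * r)"
          using r(1) by (intro divide_left_mono mult_pos_pos) (use nz [OF z] nz2 [OF z] in auto)
      qed (use r(1) B(1) in auto)
      finally show "norm (G z) \<le> cmod h ^ 3 * (1 / (r ^ 3 * r)) * B" .
    qed
    ultimately show "norm (cint C (\<lambda>z. (1 / (z - (w + h))) *\<^sub>C F z) - (cint C (\<lambda>z. (1 / (z - w)) *\<^sub>C F z) + h *\<^sub>C a + h\<^sup>2 *\<^sub>C b))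
        \<le> (M * (1 / (r ^ 3 * r) * B)) * cmod h ^ 3"
      by (simp add: mult_ac)
  qed
  then show ?thesis using r(1) by blast
qed

text \<open>Again by gluing: \<^term>\<open>- (R w o\<^sub>L cint C R)\<close> and the Cauchy transform of the resolvent agree
  where both are defined.\<close>

lemma cint_resolvent: "cint C R = 0"
proof -
  let ?K = "cint C R"
  let ?T = "\<lambda>w. cint C (\<lambda>z. (1 / (z - w)) *\<^sub>C R z)"
  define H where "H = (\<lambda>w. if w \<in> D then ?T w else - (R w o\<^sub>L ?K))"
  \<comment> \<open>At resolvent points inside \<open>D\<close> the kernel integral is 0, so
    \<open>cint_kernel_resolvent\<close> identifies the two branches of \<open>H\<close>.\<close>
  have H_res: "H w = - (R w o\<^sub>L ?K)" if "w \<in> \<rho>" for w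
    using that cint_kernel_resolvent [OF that not_in_cycle_image] cint_cauchy_kernel(1) [of w]
    by (simp add: H_def)
  have "H w = 0" for w
  proof (rule Liouville_third_order)
    show "\<exists>a b M d. 0 < d \<and> (\<forall>h. cmod h < d \<longrightarrow> norm (H (w + h) - (H w + h *\<^sub>C a + h\<^sup>2 *\<^sub>C b)) \<le> M * cmod h ^ 3)" for w
    proof (cases "w \<in> D")
      case True
      from cauchy_transform_expansion [OF continuous_on_cycle_resolvent True]
      obtain a b M r where "0 < r" and *: "\<forall>h. cmod h < r \<longrightarrow> w + h \<in> D \<and>
          norm (?T (w + h) - (?T w + h *\<^sub>C a + h\<^sup>2 *\<^sub>C b)) \<le> M * cmod h ^ 3"
        by (elim exE conjE) (rule that)
      show ?thesis
        using \<open>0 < r\<close> * True by (intro exI [of _ a] exI [of _ b] exI [of _ M] exI [of _ r]) (simp add: H_def)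
    next
      case False
      then have w: "w \<in> \<rho>" by (rule not_domain_resolvent)
      from resolvent_expansion [OF w]
      obtain a b M r where "0 < r" and *: "\<forall>h. cmod h < r \<longrightarrow> w + h \<in> \<rho> \<and>
          norm (R (w + h) - (R w + h *\<^sub>C a + h\<^sup>2 *\<^sub>C b)) \<le> M * cmod h ^ 3"
        by (elim exE conjE) (rule that)
      \<comment> \<open>The point \<open>w + h\<close> may lie in \<open>D\<close>, where
        \<open>H\<close> is defined by the other branch; \<open>H_res\<close> covers it because it
        is a resolvent point.\<close>
      have "norm (H (w + h) - (H w + h *\<^sub>C (- (a o\<^sub>L ?K)) + h\<^sup>2 *\<^sub>C (- (b o\<^sub>L ?K)))) \<le> (M * norm ?K) * cmod h ^ 3"
        if h: "cmod h < r" for h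
      proof -
        have "H (w + h) - (H w + h *\<^sub>C (- (a o\<^sub>L ?K)) + h\<^sup>2 *\<^sub>C (- (b o\<^sub>L ?K)))
            = - ((R (w + h) - (R w + h *\<^sub>C a + h\<^sup>2 *\<^sub>C b)) o\<^sub>L ?K)"
          using * [rule_format, OF h] w
          by (simp add: H_res compose_diff_left compose_add_left compose_scaleC_left scaleC_minus_right)
        then have "norm (H (w + h) - (H w + h *\<^sub>C (- (a o\<^sub>L ?K)) + h\<^sup>2 *\<^sub>C (- (b o\<^sub>L ?K))))
            \<le> norm (R (w + h) - (R w + h *\<^sub>C a + h\<^sup>2 *\<^sub>C b)) * norm ?K"
          by (simp add: norm_blinfun_compose)
        also have "\<dots> \<le> (M * cmod h ^ 3) * norm ?K" using * [rule_format, OF h] by (intro mult_right_mono) auto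
        finally show ?thesis by (simp add: mult_ac)
      qed
      then show ?thesis using \<open>0 < r\<close> by blast
    qed
    show "(H \<longlongrightarrow> 0) at_infinity"
    proof (rule Lim_transform_eventually)
      show "(?T \<longlongrightarrow> 0) at_infinity" by (rule cint_cauchy_tendsto_0 [OF continuous_on_cycle_resolvent])
      show "\<forall>\<^sub>F w in at_infinity. ?T w = H w"
        using eventually_domain by eventually_elim (simp add: H_def)
    qed
  qed
  moreover obtain w where "w \<in> \<rho>" using resolvent_ne by blast
  ultimately have "R w o\<^sub>L ?K = 0" using H_res [of w] by simp
  then have "R w (?K x) = 0" for x by (metis blinfun_apply_blinfun_compose zero_blinfun.rep_eq)
  then show ?thesis using resolvent_inj [OF \<open>w \<in> \<rho>\<close>] by (intro blinfun_eqI) simp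
qed

text \<open>Up to sign this exhibits the resolvent as a value of the calculus. Outside the closure
  of \<open>D\<close> the kernel integral is -1, and the second term of
  \<open>cint_kernel_resolvent\<close> vanishes by \<open>cint_resolvent\<close>.\<close>

lemma cint_pole_resolvent:
  assumes "\<mu> \<notin> closure D"
  shows "cint C (\<lambda>z. (1 / (z - \<mu>)) *\<^sub>C R z) = - R \<mu>"
proof -
  have "\<mu> \<in> \<rho>" using assms closure_subset not_domain_resolvent by blast
  then show ?thesis
    using cint_kernel_resolvent [of \<mu>] assms not_in_cycle_image
    by (simp add: cint_resolvent cint_cauchy_kernel(2) scaleC_minus_left compose_zero_right)
qed

definition calc :: "(complex \<Rightarrow> complex) \<Rightarrow> complex \<Rightarrow> 'a \<Rightarrow>\<^sub>L 'a"
  where "calc f c = c *\<^sub>C id_blinfun + cint C (\<lambda>z. f z *\<^sub>C R z)"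

lemma taylor_calculus_eq: "taylor_calculus domA A f c C = calc f c"
  by (simp add: taylor_calculus_def calc_def cint_def)

lemma calc_cong: "(\<And>z. z \<in> cycle_image C \<Longrightarrow> f z = g z) \<Longrightarrow> calc f c = calc g c"
  unfolding calc_def by (simp cong: cint_cong)

lemma complex_linear_calc:
  assumes f: "continuous_on (cycle_image C) f"
  shows "complex_linear (calc f c)"
proof -
  have cF: "continuous_on (cycle_image C) (\<lambda>z. f z *\<^sub>C R z)"
    by (intro continuous_intros f continuous_on_cycle_resolvent)
  have ev: "blinfun_apply (cint C (\<lambda>z. f z *\<^sub>C R z)) x = cint C (\<lambda>z. f z *\<^sub>C R z x)" for x
    using cint_map [OF cF blinfun.bounded_linear_left [of x]] by (simp add: blinfun_apply_scaleC)
  have "cint C (\<lambda>z. f z *\<^sub>C R z (k *\<^sub>C x)) = k *\<^sub>C cint C (\<lambda>z. f z *\<^sub>C R z x)" for k x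
  proof -
    have "cint C (\<lambda>z. f z *\<^sub>C R z (k *\<^sub>C x)) = cint C (\<lambda>z. k *\<^sub>C (f z *\<^sub>C R z x))"
      using complex_linear_resolvent [OF cycle_image_resolvent]
      by (intro cint_cong) (simp add: complex_linear_def scaleC_scaleC mult.commute)
    also have "\<dots> = k *\<^sub>C cint C (\<lambda>z. f z *\<^sub>C R z x)"
      by (intro cint_scale continuous_intros f continuous_on_cycle_resolvent)
    finally show ?thesis .
  qed
  then show ?thesis
    by (simp add: complex_linear_def calc_def blinfun.add_left blinfun_apply_scaleC ev scaleC_add_right scaleC_scaleC mult.commute)
qed

lemma calc_minus_const:
  assumes f: "continuous_on (cycle_image C) f"
  shows "calc (\<lambda>z. f z - k) (c - k) = calc f c - k *\<^sub>C id_blinfun"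
  by (simp add: calc_def scaleC_diff_left cint_diff continuous_on_scaleC f continuous_on_cycle_resolvent
      cint_scale cint_resolvent)

lemma calc_one: "calc (\<lambda>z. 1) 1 = id_blinfun"
  by (simp add: calc_def cint_resolvent)

text \<open>As the closure of \<open>D\<close> contains a neighbourhood of infinity, a finite limit
  there amounts to holomorphy at infinity with value \<open>c\<close>, by removable singularities.
  Limits pass easily through products and quotients.\<close>

definition admissible :: "(complex \<Rightarrow> complex) \<Rightarrow> complex \<Rightarrow> complex set \<Rightarrow> bool"
  where "admissible f c U \<longleftrightarrow> open U \<and> closure D \<subseteq> U \<and> f holomorphic_on U \<and> (f \<longlongrightarrow> c) at_infinity"

lemma admissibleD:
  assumes "admissible f c U"
  shows "open U" "closure D \<subseteq> U" "f holomorphic_on U" "(f \<longlongrightarrow> c) at_infinity"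
    "cycle_image C \<subseteq> U" "continuous_on (cycle_image C) f"
proof -
  show *: "open U" "closure D \<subseteq> U" "f holomorphic_on U" "(f \<longlongrightarrow> c) at_infinity"
    using assms by (auto simp: admissible_def)
  then show "cycle_image C \<subseteq> U" using cycle_image_subset by blast
  then show "continuous_on (cycle_image C) f"
    using * holomorphic_on_imp_continuous_on continuous_on_subset by blast
qed

text \<open>Write \<open>f z\<close> as \<open>f w\<close> plus
  \<open>(z - w) * dquot f z w\<close>. In the second part the factor \<open>z - w\<close> turns the
  product of resolvents into \<open>R w - R z\<close>; the first part integrates to 0 by
  \<open>cint_resolvent\<close>; and \<open>cint_dquot\<close> supplies the coefficient of
  \<open>R w\<close>. Since \<open>dquot\<close> is regular on the diagonal, \<open>w\<close> may
  lie on the contour.\<close>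

lemma calc_resolvent:
  assumes f: "admissible f c U" and w: "w \<in> cycle_image C"
  shows "calc f c o\<^sub>L R w = f w *\<^sub>C R w - cint C (\<lambda>z. dquot f z w *\<^sub>C R z)"
proof -
  note fD = admissibleD [OF f]
  have wU: "w \<in> U" using w fD by blast
  have cd: "continuous_on (cycle_image C) (\<lambda>z. dquot f z w)"
    by (rule continuous_on_subset [OF continuous_on_slice(1) [OF continuous_on_dquot [OF fD(1,3)] wU] fD(5)])
  note cR = continuous_on_cycle_resolvent
  have bl: "bounded_linear (\<lambda>S. S o\<^sub>L R w)"
    by (rule bounded_bilinear.bounded_linear_left [OF bounded_bilinear_blinfun_compose])
  have cRw: "continuous_on (cycle_image C) (\<lambda>z. R z o\<^sub>L R w)"
    by (rule bounded_linear.continuous_on [OF bl cR])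
  have "cint C (\<lambda>z. f z *\<^sub>C R z) o\<^sub>L R w = cint C (\<lambda>z. (f z *\<^sub>C R z) o\<^sub>L R w)"
    by (intro cint_map [symmetric] bl compose_scaleC_left continuous_intros fD cR)
  also have "\<dots> = cint C (\<lambda>z. dquot f z w *\<^sub>C R w - dquot f z w *\<^sub>C R z + f w *\<^sub>C (R z o\<^sub>L R w))"
  proof (rule cint_cong)
    fix z assume z: "z \<in> cycle_image C"
    have "R w - R z = (z - w) *\<^sub>C (R z o\<^sub>L R w)"
      using resolvent_identity [of w z] resolvent_commute [of w z] cycle_image_resolvent z w by simp
    then have "dquot f z w *\<^sub>C (R w - R z) = (f z - f w) *\<^sub>C (R z o\<^sub>L R w)"
      by (simp add: scaleC_scaleC dquot_mult mult.commute)
    then show "(f z *\<^sub>C R z) o\<^sub>L R w = dquot f z w *\<^sub>C R w - dquot f z w *\<^sub>C R z + f w *\<^sub>C (R z o\<^sub>L R w)"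
      by (simp add: compose_scaleC_left scaleC_diff_left scaleC_diff_right)
  qed
  also have "\<dots> = cint C (\<lambda>z. dquot f z w) *\<^sub>C R w - cint C (\<lambda>z. dquot f z w *\<^sub>C R z) + f w *\<^sub>C cint C (\<lambda>z. R z o\<^sub>L R w)"
    by (simp add: cint_add cint_diff cint_scale cint_scale_const cd cR cRw continuous_on_diff continuous_on_scaleC)
  also have "cint C (\<lambda>z. R z o\<^sub>L R w) = cint C R o\<^sub>L R w"
    by (intro cint_map bl compose_scaleC_left cR)
  also have "cint C R o\<^sub>L R w = 0" by (simp add: cint_resolvent)
  also have "cint C (\<lambda>z. dquot f z w) = f w - c" by (rule cint_dquot [OF fD(1-4) wU])
  finally have "cint C (\<lambda>z. f z *\<^sub>C R z) o\<^sub>L R w = (f w - c) *\<^sub>C R w - cint C (\<lambda>z. dquot f z w *\<^sub>C R z)"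
    by simp
  then show ?thesis
    by (simp add: calc_def compose_add_left compose_scaleC_left scaleC_diff_left)
qed

text \<open>Leibniz rule for divided differences. It writes \<open>g w * dquot f w z\<close> in
  terms whose integrals over \<open>w\<close> are known from \<open>cint_dquot\<close>.\<close>

lemma dquot_times:
  assumes "open U" "f holomorphic_on U" "g holomorphic_on U" "z \<in> U"
  shows "g w * dquot f w z = dquot (\<lambda>z. f z * g z) w z - f z * dquot g w z"
proof (cases "w = z")
  case True
  have "deriv (\<lambda>z. f z * g z) z = f z * deriv g z + deriv f z * g z"
    using assms holomorphic_on_imp_differentiable_at by (intro deriv_mult) auto
  then show ?thesis using True by (simp add: dquot_def)
next
  case False
  have "g w * ((f w - f z) / (w - z)) = (f w * g w - f z * g z) / (w - z) - f z * ((g w - g z) / (w - z))"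
    unfolding times_divide_eq_right diff_divide_distrib [symmetric] by (simp add: algebra_simps)
  with False show ?thesis by (simp add: dquot_def)
qed

text \<open>The formula of \<open>calc_resolvent\<close> is multiplied by \<open>g w\<close> and
  integrated over \<open>w\<close> along the same contour. The double integral that appears has a
  continuous integrand, and after the interchange its inner integral can be evaluated.\<close>

theorem calc_mult:
  assumes f: "admissible f cf U" and g: "admissible g cg U"
  shows "calc f cf o\<^sub>L calc g cg = calc (\<lambda>z. f z * g z) (cf * cg)"
proof -
  note fD = admissibleD [OF f] and gD = admissibleD [OF g]
  note cR = continuous_on_cycle_resolvent
  have fg: "admissible (\<lambda>z. f z * g z) (cf * cg) U"
    using f g by (auto simp: admissible_def intro!: holomorphic_intros tendsto_intros)
  note fgD = admissibleD [OF fg]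
  have linf: "complex_linear (calc f cf)" by (rule complex_linear_calc [OF fD(6)])
  have cdq: "continuous_on (cycle_image C \<times> cycle_image C) (\<lambda>(z, w). dquot f z w)"
    by (rule continuous_on_subset [OF continuous_on_dquot [OF fD(1,3)]]) (use fD(5) in auto)
  have cgR: "continuous_on (cycle_image C) (\<lambda>w. g w *\<^sub>C R w)"
    by (intro continuous_intros gD cR)
  define G where "G = (\<lambda>z w. (g w * dquot f z w) *\<^sub>C R z)"
  have cG: "continuous_on (cycle_image C \<times> cycle_image C) (\<lambda>(z, w). G z w)"
    unfolding G_def case_prod_unfold
    using cdq by (intro continuous_intros continuous_on_compose2 [OF gD(6)] continuous_on_compose2 [OF cR])
      (auto simp: case_prod_unfold)
  have cdR: "continuous_on (cycle_image C) (\<lambda>z. dquot f z w *\<^sub>C R z)" if "w \<in> cycle_image C" for w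
    by (intro continuous_intros cR continuous_on_slice(1) [OF cdq that])
  have "calc f cf o\<^sub>L cint C (\<lambda>w. g w *\<^sub>C R w) = cint C (\<lambda>w. calc f cf o\<^sub>L (g w *\<^sub>C R w))"
    by (intro cint_map [symmetric] cgR compose_scaleC_right linf
        bounded_bilinear.bounded_linear_right [OF bounded_bilinear_blinfun_compose])
  also have "\<dots> = cint C (\<lambda>w. (f w * g w) *\<^sub>C R w - cint C (\<lambda>z. G z w))"
  proof (rule cint_cong)
    fix w assume w: "w \<in> cycle_image C"
    have "calc f cf o\<^sub>L (g w *\<^sub>C R w) = g w *\<^sub>C (f w *\<^sub>C R w - cint C (\<lambda>z. dquot f z w *\<^sub>C R z))"
      by (simp add: compose_scaleC_right [OF linf] calc_resolvent [OF f w])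
    also have "\<dots> = (f w * g w) *\<^sub>C R w - cint C (\<lambda>z. g w *\<^sub>C (dquot f z w *\<^sub>C R z))"
      by (subst cint_scale [OF cdR [OF w]]) (simp add: scaleC_diff_right scaleC_scaleC mult.commute)
    finally show "calc f cf o\<^sub>L (g w *\<^sub>C R w) = (f w * g w) *\<^sub>C R w - cint C (\<lambda>z. G z w)"
      by (simp add: G_def scaleC_scaleC)
  qed
  also have "\<dots> = cint C (\<lambda>w. (f w * g w) *\<^sub>C R w) - cint C (\<lambda>w. cint C (\<lambda>z. G z w))"
    by (intro cint_diff continuous_intros fD gD cR cint_continuous_param [OF compact_cycle_image cG])
  also have "cint C (\<lambda>w. cint C (\<lambda>z. G z w)) = cint C (\<lambda>z. cint C (\<lambda>w. G z w))"
    by (rule cint_swap [OF cG])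
  also have "\<dots> = cint C (\<lambda>z. cg *\<^sub>C (f z *\<^sub>C R z) - (cg * cf) *\<^sub>C R z)"
  proof (rule cint_cong)
    fix z assume z: "z \<in> cycle_image C"
    then have zU: "z \<in> U" using fD by blast
    have c1: "continuous_on (cycle_image C) (\<lambda>w. dquot h w z)" if "admissible h c U" for h c
      using admissibleD [OF that]
      by (intro continuous_on_subset [OF continuous_on_slice(1) [OF continuous_on_dquot zU]])
    have "cint C (\<lambda>w. G z w) = cint C (\<lambda>w. g w * dquot f z w) *\<^sub>C R z"
      unfolding G_def by (intro cint_scale_const continuous_intros gD continuous_on_slice(2) [OF cdq z])
    also have "cint C (\<lambda>w. g w * dquot f z w) = cint C (\<lambda>w. dquot (\<lambda>z. f z * g z) w z - f z *\<^sub>C dquot g w z)"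
      using dquot_times [OF fD(1,3) gD(3) zU] by (simp add: dquot_commute [of f z] scaleC_complex_def)
    \<comment> \<open>The products \<open>f z * g z\<close> cancel, leaving a multiple of
      \<open>f z\<close> and a constant; the constant drops out when integrated against the
      resolvent.\<close>
    also have "\<dots> = (f z * g z - cf * cg) - f z *\<^sub>C (g z - cg)"
      by (simp add: cint_diff cint_scale c1 [OF fg] c1 [OF g] continuous_on_scaleC
          cint_dquot [OF fgD(1-4) zU] cint_dquot [OF gD(1-4) zU])
    also have "\<dots> = cg * f z - cg * cf" by (simp add: scaleC_complex_def algebra_simps)
    finally show "cint C (\<lambda>w. G z w) = cg *\<^sub>C (f z *\<^sub>C R z) - (cg * cf) *\<^sub>C R z"
      by (simp add: scaleC_diff_left scaleC_scaleC)
  qed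
  also have "\<dots> = cg *\<^sub>C cint C (\<lambda>z. f z *\<^sub>C R z)"
    by (simp add: cint_diff cint_scale continuous_on_scaleC fD cR cint_resolvent)
  finally have "calc f cf o\<^sub>L cint C (\<lambda>w. g w *\<^sub>C R w)
      = cint C (\<lambda>w. (f w * g w) *\<^sub>C R w) - cg *\<^sub>C cint C (\<lambda>z. f z *\<^sub>C R z)" .
  moreover have "calc f cf o\<^sub>L calc g cg = cg *\<^sub>C calc f cf + (calc f cf o\<^sub>L cint C (\<lambda>w. g w *\<^sub>C R w))"
    by (simp add: calc_def [of g] compose_add_right compose_scaleC_right [OF linf])
  ultimately show ?thesis
    by (simp add: calc_def scaleC_add_right scaleC_scaleC mult.commute)
qed

end

section \<open>Inverses, ascent and descent\<close>

text \<open>The Baire step of the open mapping theorem. It leaves an error of one half, which the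
  iteration in \<open>bounded_inverse\<close> removes.\<close>

lemma approximate_preimage:
  fixes T :: "'a::banach \<Rightarrow>\<^sub>L 'b::banach"
  assumes "surj T"
  shows "\<exists>c\<ge>0. \<forall>y. \<exists>x. norm x \<le> c * norm y \<and> norm (y - T x) \<le> norm y / 2"
proof -
  define F where "F = (\<lambda>n. closure (blinfun_apply T ` cball 0 (real n)))"
  have cover: "(\<Union>n. F n) = UNIV"
  proof -
    have "y \<in> (\<Union>n. F n)" for y
    proof -
      obtain x where x: "y = T x" using assms by (metis surjD)
      obtain n where "norm x \<le> real n" using real_arch_simple by blast
      then have "y \<in> T ` cball 0 (real n)" using x by (intro image_eqI) auto
      then have "y \<in> F n" unfolding F_def by (rule subsetD [OF closure_subset])
      then show ?thesis by blast
    qed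
    then show ?thesis by blast
  qed
  have "\<exists>n. interior (F n) \<noteq> {}"
  proof (rule ccontr)
    assume "\<nexists>n. interior (F n) \<noteq> {}"
    then have "euclidean interior_of \<Union>(range F) = {}"
      by (intro Baire_category_alt disjI1 completely_metrizable_space_euclidean) (auto simp: F_def)
    then show False using cover by simp
  qed
  then obtain n y0 r where r: "0 < r" "ball y0 r \<subseteq> F n"
    by (metis ex_in_conv mem_interior)
  \<comment> \<open>The ball inside \<open>F n\<close> need not be centred at 0. Subtracting
    approximate preimages of \<open>y0\<close> and \<open>y0 + y\<close> moves it there at the price
    of the factor 2.\<close>
  have approx: "\<exists>x. norm x \<le> 2 * real n \<and> norm (y - T x) < e" if y: "norm y < r" and e: "0 < e" for y e
  proof -
    have "y0 \<in> F n" "y0 + y \<in> F n" using r y by (auto simp: dist_norm intro!: subsetD [OF r(2)])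
    moreover have "0 < e / 2" using e by simp
    ultimately obtain u v where u: "norm u \<le> real n" "dist (T u) y0 < e / 2"
      and v: "norm v \<le> real n" "dist (T v) (y0 + y) < e / 2"
      unfolding F_def closure_approachable by (metis (no_types, lifting) imageE mem_cball_0)
    have "y - T (v - u) = (T u - y0) - (T v - (y0 + y))" by (simp add: blinfun.diff_right)
    then have "norm (y - T (v - u)) \<le> norm (T u - y0) + norm (T v - (y0 + y))" by (metis norm_triangle_ineq4)
    then have "norm (y - T (v - u)) < e" using u v by (simp add: dist_norm)
    moreover have "norm (v - u) \<le> 2 * real n" using u v norm_triangle_ineq4 [of v u] by simp
    ultimately show ?thesis by blast
  qed
  \<comment> \<open>A nonzero \<open>y\<close> is scaled to norm \<open>r / 2\<close> and
    approximated within \<open>r / 4\<close>. Undoing the scaling multiplies by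
    \<open>2 * norm y / r\<close>, which gives the error \<open>norm y / 2\<close> and turns
    \<open>2 * real n\<close> into \<open>c * norm y\<close>.\<close>
  define c where "c = 4 * real n / r"
  have "\<exists>x. norm x \<le> c * norm y \<and> norm (y - T x) \<le> norm y / 2" for y
  proof (cases "y = 0")
    case True
    then show ?thesis by (intro exI [of _ 0]) simp
  next
    case False
    define s where "s = r / (2 * norm y)"
    have s: "0 < s" "s * norm y = r / 2" using False r by (auto simp: s_def)
    have "norm (s *\<^sub>R y) < r" "0 < r / 4" using s r by auto
    then obtain x where x: "norm x \<le> 2 * real n" "norm (s *\<^sub>R y - T x) < r / 4" using approx by blast
    have "y - T (inverse s *\<^sub>R x) = inverse s *\<^sub>R (s *\<^sub>R y - T x)"
      using s by (simp add: blinfun.scaleR_right scaleR_diff_right)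
    then have "norm (y - T (inverse s *\<^sub>R x)) = inverse s * norm (s *\<^sub>R y - T x)" using s by simp
    also have "\<dots> \<le> inverse s * (r / 4)" using s x by (intro mult_left_mono) auto
    also have "\<dots> = norm y / 2" using False r by (simp add: s_def)
    finally have "norm (y - T (inverse s *\<^sub>R x)) \<le> norm y / 2" .
    moreover have "norm (inverse s *\<^sub>R x) \<le> inverse s * (2 * real n)"
      using s x by (simp add: mult_left_mono)
    then have "norm (inverse s *\<^sub>R x) \<le> c * norm y"
      using False r by (simp add: s_def c_def field_simps)
    ultimately show ?thesis by blast
  qed
  moreover have "0 \<le> c" using r by (simp add: c_def)
  ultimately show ?thesis by blast
qed

text \<open>The remainders \<open>Y k\<close> at least halve at each step, so the approximate
  preimages \<open>\<phi> (Y k)\<close> sum to the preimage of \<open>y\<close>, with norm at most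
  \<open>2 * c * norm y\<close>.\<close>

lemma bounded_inverse:
  fixes T :: "'a::banach \<Rightarrow>\<^sub>L 'b::banach"
  assumes "bij T"
  obtains S :: "'b \<Rightarrow>\<^sub>L 'a" where "\<And>x. S (T x) = x" "\<And>y. T (S y) = y"
proof -
  obtain c where c: "0 \<le> c" "\<forall>y. \<exists>x. norm x \<le> c * norm y \<and> norm (y - T x) \<le> norm y / 2"
    using approximate_preimage [OF bij_is_surj [OF assms]] by blast
  then obtain \<phi> where \<phi>: "\<And>y. norm (\<phi> y) \<le> c * norm y" "\<And>y. norm (y - T (\<phi> y)) \<le> norm y / 2" by metis
  have bound: "norm (inv T y) \<le> norm y * (2 * c)" for y
  proof -
    define Y where "Y = (\<lambda>k. ((\<lambda>y. y - T (\<phi> y)) ^^ k) y)"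
    have Y0: "Y 0 = y" and YS: "Y (Suc k) = Y k - T (\<phi> (Y k))" for k by (auto simp: Y_def)
    have nY: "norm (Y k) \<le> norm y * (1 / 2) ^ k" for k
    proof (induction k)
      case (Suc k)
      have "norm (Y (Suc k)) \<le> norm (Y k) / 2" unfolding YS by (rule \<phi>)
      then show ?case using Suc by simp
    qed (simp add: Y0)
    have "(\<lambda>k. norm y * (1 / 2) ^ k) \<longlonglongrightarrow> norm y * 0"
      by (intro tendsto_mult_left LIMSEQ_power_zero) simp
    then have Ylim: "Y \<longlonglongrightarrow> 0"
      using nY by (intro Lim_null_comparison [of Y]) auto
    have n\<phi>: "norm (\<phi> (Y k)) \<le> (c * norm y) * (1 / 2) ^ k" for k
      using \<phi>(1) [of "Y k"] mult_left_mono [OF nY c(1), of k] by (simp add: mult.assoc)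
    have geo: "(\<lambda>k. (c * norm y) * (1 / 2) ^ k) sums ((c * norm y) * 2)"
      using sums_mult [OF geometric_sums [of "1 / 2 :: real"], of "c * norm y"] by simp
    have sumn: "summable (\<lambda>k. norm (\<phi> (Y k)))"
      by (rule summable_comparison_test' [OF sums_summable [OF geo], of 0]) (use n\<phi> in auto)
    define x where "x = (\<Sum>k. \<phi> (Y k))"
    have "(\<Sum>k<n. T (\<phi> (Y k))) = y - Y n" for n
      by (induction n) (auto simp: Y0 YS)
    then have "(\<lambda>n. \<Sum>k<n. T (\<phi> (Y k))) \<longlonglongrightarrow> y"
      using tendsto_diff [OF tendsto_const [of y] Ylim] by simp
    then have "(\<Sum>k. T (\<phi> (Y k))) = y" by (simp add: sums_def sums_unique [symmetric])
    moreover have "T x = (\<Sum>k. T (\<phi> (Y k)))"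
      unfolding x_def
      by (rule bounded_linear.suminf [OF blinfun.bounded_linear_right summable_norm_cancel [OF sumn]])
    ultimately have "inv T y = x" using assms by (metis bij_inv_eq_iff)
    moreover have "norm x \<le> (c * norm y) * 2"
      unfolding x_def using summable_norm [OF sumn] suminf_le [OF n\<phi> sumn sums_summable [OF geo]] sums_unique [OF geo] by simp
    ultimately show ?thesis by (simp add: mult_ac)
  qed
  have TS: "T (inv T y) = y" and ST: "inv T (T x) = x" for x y
    using assms by (auto simp: bij_def surj_f_inv_f inv_f_f)
  have "bounded_linear (inv T)"
  proof (rule bounded_linear_intro [OF _ _ bound])
    show "inv T (x + y) = inv T x + inv T y" for x y
      by (metis ST TS blinfun.add_right)
    show "inv T (r *\<^sub>R x) = r *\<^sub>R inv T x" for r x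
      by (metis ST TS blinfun.scaleR_right)
  qed
  then have "blinfun_apply (Blinfun (inv T)) = inv T" by (rule bounded_linear_Blinfun_apply)
  then show ?thesis using that [of "Blinfun (inv T)"] ST TS by simp
qed

section \<open>Null spaces and ranges of powers\<close>

lemma pow_dom_UNIV [simp]: "pow_dom UNIV T n = UNIV"
  by (simp add: pow_dom_def)

lemma pow_dom_0 [simp]: "pow_dom D T 0 = UNIV"
  by (simp add: pow_dom_def)

lemma pow_dom_Suc: "x \<in> pow_dom D T (Suc n) \<longleftrightarrow> x \<in> D \<and> T x \<in> pow_dom D T n"
  unfolding pow_dom_def by (auto simp: All_less_Suc2 funpow_swap1)

lemma pow_dom_Suc_subset: "pow_dom D T (Suc n) \<subseteq> pow_dom D T n"
  by (auto simp: pow_dom_def)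

lemma pow_null_Suc: "x \<in> pow_null D T (Suc n) \<longleftrightarrow> x \<in> D \<and> T x \<in> pow_null D T n"
  unfolding pow_null_def by (auto simp: pow_dom_Suc funpow_swap1)

lemma funpow_commute:
  assumes "\<And>x. f (g x) = g (f x)"
  shows "f ((g ^^ n) x) = (g ^^ n) (f x)"
  by (induction n) (auto simp: assms)

lemma drazin_invertible_cong:
  assumes "\<And>n. pow_null D T n = pow_null D' T' n" "\<And>n. pow_range D T n = pow_range D' T' n"
  shows "drazin_invertible D T \<longleftrightarrow> drazin_invertible D' T'"
  by (simp add: drazin_invertible_def ascent_def descent_def assms)

text \<open>By commutation the \<open>n\<close>-th power is \<open>G ^^ n\<close> after
  \<open>N ^^ n\<close> and also \<open>N ^^ n\<close> after \<open>G ^^ n\<close>. The first form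
  shows that null spaces are unchanged, the second that ranges are.\<close>

lemma drazin_invertible_comp_bij:
  fixes G N :: "'a::zero \<Rightarrow> 'a"
  assumes comm: "\<And>x. G (N x) = N (G x)" and G: "bij G" "G 0 = 0"
  shows "drazin_invertible UNIV (\<lambda>x. G (N x)) \<longleftrightarrow> drazin_invertible UNIV N"
proof (rule drazin_invertible_cong)
  fix n
  have pow: "((\<lambda>x. G (N x)) ^^ n) x = (G ^^ n) ((N ^^ n) x)" for n x
    by (induction n) (simp_all add: funpow_commute [of N G, OF comm [symmetric]])
  have pow': "((\<lambda>x. G (N x)) ^^ n) x = (N ^^ n) ((G ^^ n) x)" for x
    unfolding pow using funpow_commute [of "G ^^ n" N n x] funpow_commute [of N G n] comm by metis
  have Gn: "bij (G ^^ n)" using bij_fn [OF G(1)] .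
  have "(G ^^ n) 0 = 0" by (induction n) (auto simp: G)
  then have "(G ^^ n) y = 0 \<longleftrightarrow> y = 0" for y using Gn by (metis bij_is_inj injD)
  then show "pow_null UNIV (\<lambda>x. G (N x)) n = pow_null UNIV N n"
    by (simp add: pow_null_def pow)
  have "range (\<lambda>x. (N ^^ n) ((G ^^ n) x)) = (N ^^ n) ` range (G ^^ n)" by (simp add: image_image)
  then show "pow_range UNIV (\<lambda>x. G (N x)) n = pow_range UNIV N n"
    using bij_is_surj [OF Gn] by (simp add: pow_range_def pow' [abs_def])
qed

text \<open>Finite descent gives \<open>(T ^^ n) y = (T ^^ n) (T x)\<close> for some
  \<open>x\<close>, and injectivity cancels the power.\<close>

lemma drazin_invertible_inj_imp_surj:
  assumes inj: "inj T" and "drazin_invertible UNIV T"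
  shows "surj T"
proof -
  have "\<exists>n. pow_range UNIV T n = pow_range UNIV T (Suc n)"
  proof (rule ccontr)
    assume "\<nexists>n. pow_range UNIV T n = pow_range UNIV T (Suc n)"
    then have "{enat n |n. pow_range UNIV T n = pow_range UNIV T (Suc n)} = {}" by simp
    then have "descent UNIV T = Inf {}" by (simp only: descent_def)
    then show False using assms(2) by (simp add: drazin_invertible_def top_enat_def)
  qed
  then obtain n where n: "range (T ^^ n) = range (T ^^ Suc n)"
    by (auto simp: pow_range_def)
  have "y \<in> range T" for y
  proof -
    obtain x where "(T ^^ n) y = (T ^^ Suc n) x" using n by (metis rangeE rangeI)
    then have "(T ^^ n) y = (T ^^ n) (T x)" by (simp add: funpow_swap1)
    then have "y = T x" using inj_fn [OF inj, of n] by (meson injD)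
    then show ?thesis by simp
  qed
  then show ?thesis by blast
qed

section \<open>Reduction of the unbounded operator \<open>A - \<kappa>\<close> to a bounded
  one\<close>

context closed_op
begin

text \<open>\<open>N\<close> is \<open>A - \<kappa>\<close> composed with the resolvent at
  \<open>\<mu>\<close>, rewritten so that it is visibly bounded and defined everywhere.\<close>

context
  fixes \<mu> \<kappa> :: complex and N :: "'a \<Rightarrow> 'a"
  assumes \<mu>: "\<mu> \<in> \<rho>"
  defines "N \<equiv> \<lambda>x. (\<mu> - \<kappa>) *\<^sub>C R \<mu> x - x"
begin

lemma op_resolvent: "A (R \<mu> x) - \<kappa> *\<^sub>C R \<mu> x = N x"
  using resolvent_setD(2) [OF \<mu>, of x] by (simp add: N_def scaleC_diff_left algebra_simps)

lemma resolvent_op: "x \<in> domA \<Longrightarrow> R \<mu> (A x - \<kappa> *\<^sub>C x) = N x"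
proof -
  assume x: "x \<in> domA"
  have "A x - \<kappa> *\<^sub>C x = (\<mu> - \<kappa>) *\<^sub>C x - (\<mu> *\<^sub>C x - A x)" by (simp add: scaleC_diff_left)
  then show ?thesis
    using resolvent_setD(3) [OF \<mu> x] complex_linear_resolvent [OF \<mu>]
    by (simp only: blinfun.diff_right) (simp add: complex_linear_def N_def)
qed

lemma N_resolvent: "N (R \<mu> x) = R \<mu> (N x)"
  using complex_linear_resolvent [OF \<mu>] by (simp add: N_def complex_linear_def blinfun.diff_right)

text \<open>For null spaces, injectivity of the resolvent carries the equation from one operator to
  the other, and the equation itself forces \<open>x\<close> into the domain. For ranges, the domain
  of the \<open>n\<close>-th power of \<open>A - \<kappa>\<close> is the range of the
  \<open>n\<close>-th power of the resolvent, and composing the two powers gives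
  \<open>N ^^ n\<close>.\<close>

lemma drazin_invertible_shift:
  "drazin_invertible domA (\<lambda>x. A x - \<kappa> *\<^sub>C x) \<longleftrightarrow> drazin_invertible UNIV N"
proof (rule drazin_invertible_cong)
  define B where "B = (\<lambda>x. A x - \<kappa> *\<^sub>C x)"
  let ?R = "blinfun_apply (R \<mu>)"
  have BR: "B (?R x) = N x" for x by (simp add: B_def op_resolvent)
  have RB: "?R (B x) = N x" if "x \<in> domA" for x using that by (simp add: B_def resolvent_op)
  have NR: "(N ^^ n) (?R x) = ?R ((N ^^ n) x)" for n x
    by (rule funpow_commute [symmetric]) (simp add: N_resolvent)
  have RN: "(?R ^^ n) (N x) = N ((?R ^^ n) x)" for n x
    by (rule funpow_commute [symmetric]) (simp add: N_resolvent)
  have dom: "?R x \<in> domA" for x by (rule resolvent_setD(1) [OF \<mu>])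
  have N0: "N 0 = 0" by (simp add: N_def)
  show "pow_null domA (\<lambda>x. A x - \<kappa> *\<^sub>C x) n = pow_null UNIV N n" for n
    unfolding B_def [symmetric]
  proof (induction n)
    case 0
    show ?case by (simp add: pow_null_def)
  next
    case (Suc n)
    have null: "x \<in> pow_null UNIV N n \<longleftrightarrow> (N ^^ n) x = 0" for x by (simp add: pow_null_def)
    have "x \<in> domA \<and> (N ^^ n) (B x) = 0 \<longleftrightarrow> (N ^^ n) (N x) = 0" for x
    proof
      assume x: "x \<in> domA \<and> (N ^^ n) (B x) = 0"
      then have "(N ^^ n) (N x) = ?R ((N ^^ n) (B x))" by (simp add: NR flip: RB)
      then show "(N ^^ n) (N x) = 0" using x by simp
    next
      assume *: "(N ^^ n) (N x) = 0"
      \<comment> \<open>Regularity of null vectors: for \<open>n = 0\<close> the vector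
        \<open>N x\<close> is 0, otherwise the induction hypothesis places it in the domain. Then
        \<open>x\<close> is a combination of \<open>N x\<close> and a value of the
        resolvent.\<close>
      have "N x \<in> domA"
      proof (cases n)
        case 0
        then show ?thesis using * zero_dom by simp
      next
        case (Suc k)
        have "N x \<in> pow_null domA B n" using * Suc.IH null by simp
        then show ?thesis using Suc pow_null_Suc by blast
      qed
      moreover have "x = (\<mu> - \<kappa>) *\<^sub>C ?R x - N x" by (simp add: N_def)
      ultimately have x: "x \<in> domA" using diff_dom scale_dom dom by metis
      then have "?R ((N ^^ n) (B x)) = 0" using * by (simp add: RB flip: NR)
      then show "x \<in> domA \<and> (N ^^ n) (B x) = 0" using x resolvent_inj [OF \<mu>] by blast
    qed
    then show ?case
      using Suc.IH null by (auto simp: pow_null_Suc)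
  qed
  show "pow_range domA (\<lambda>x. A x - \<kappa> *\<^sub>C x) n = pow_range UNIV N n" for n
    unfolding B_def [symmetric]
  proof -
    have lin: "(?R ^^ n) (k *\<^sub>C v - u) = k *\<^sub>C (?R ^^ n) v - (?R ^^ n) u" for n k v u
      using complex_linear_resolvent [OF \<mu>]
      by (induction n) (auto simp: blinfun.diff_right complex_linear_def)
    have pd: "pow_dom domA B n = range (?R ^^ n)" for n
    proof (induction n)
      case (Suc n)
      show ?case
      proof (intro equalityI subsetI)
        \<comment> \<open>One more resolvent is gained by solving for \<open>x\<close>: it is the
          resolvent applied to \<open>(\<mu> - \<kappa>) *\<^sub>C x - B x\<close>, and both terms
          lie in the range of the \<open>n\<close>-th power.\<close>
        fix x assume x: "x \<in> pow_dom domA B (Suc n)"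
        have "x \<in> range (?R ^^ n)" using subsetD [OF pow_dom_Suc_subset x] by (simp only: Suc.IH)
        then obtain v where v: "x = (?R ^^ n) v" by (rule imageE)
        have xd: "x \<in> domA" and "B x \<in> range (?R ^^ n)" using x by (simp_all add: pow_dom_Suc Suc.IH)
        from this(2) obtain u where u: "B x = (?R ^^ n) u" by (rule imageE)
        have "x = ?R (\<mu> *\<^sub>C x - A x)" using resolvent_setD(3) [OF \<mu> xd] by simp
        also have "\<mu> *\<^sub>C x - A x = (\<mu> - \<kappa>) *\<^sub>C x - B x" by (simp add: B_def scaleC_diff_left)
        also have "\<dots> = (?R ^^ n) ((\<mu> - \<kappa>) *\<^sub>C v - u)" by (simp add: lin u flip: v)
        finally have "x = (?R ^^ Suc n) ((\<mu> - \<kappa>) *\<^sub>C v - u)" by simp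
        then show "x \<in> range (?R ^^ Suc n)" by (rule range_eqI)
      next
        fix x assume "x \<in> range (?R ^^ Suc n)"
        then obtain u where u: "x = ?R ((?R ^^ n) u)" by auto
        then have "B x = (?R ^^ n) (N u)" by (simp add: BR RN)
        then show "x \<in> pow_dom domA B (Suc n)" using u dom by (auto simp: pow_dom_Suc Suc.IH)
      qed
    qed simp
    have BnRn: "(B ^^ n) ((?R ^^ n) u) = (N ^^ n) u" for n u
    proof (induction n arbitrary: u)
      case (Suc n)
      have "(B ^^ Suc n) ((?R ^^ Suc n) u) = (B ^^ n) (B (?R ((?R ^^ n) u)))"
        by (simp only: funpow_Suc_right comp_apply) (simp add: funpow_swap1)
      also have "\<dots> = (B ^^ n) ((?R ^^ n) (N u))" by (simp add: BR RN)
      also have "\<dots> = (N ^^ Suc n) u" by (simp add: Suc.IH funpow_swap1)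
      finally show ?case .
    qed simp
    show "pow_range domA B n = pow_range UNIV N n"
      by (simp add: pow_range_def pd image_image BnRn)
  qed
qed

text \<open>Since \<open>G\<close> is invertible, \<open>c\<close> is a resolvent point of
  \<open>F\<close> exactly when \<open>N\<close> has a bounded inverse, and that inverse and the
  resolvent at \<open>\<kappa>\<close> can be computed from each other.\<close>

lemma resolvent_set_shift:
  fixes F G Gi :: "'a \<Rightarrow>\<^sub>L 'a"
  assumes F: "\<And>x. F x - c *\<^sub>C x = G (N x)" and comm: "\<And>x. G (N x) = N (G x)"
    and G: "\<And>x. G (Gi x) = x" "\<And>x. Gi (G x) = x"
  shows "c \<in> resolvent_set UNIV F \<longleftrightarrow> \<kappa> \<in> \<rho>"
proof
  assume \<kappa>: "\<kappa> \<in> \<rho>"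
  define k where "k = \<mu> - \<kappa>"
  \<comment> \<open>The inverse of \<open>(A - \<kappa>) (\<mu> - A)\<^sup>-\<^sup>1\<close> is
    \<open>(\<mu> - A) (A - \<kappa>)\<^sup>-\<^sup>1\<close>; writing \<open>\<mu> - A\<close> as
    \<open>(\<kappa> - A) + k\<close> gives this formula.\<close>
  define Ni where "Ni = - (id_blinfun + k *\<^sub>C R \<kappa>)"
  have Nx: "N x = k *\<^sub>C R \<mu> x - x" for x by (simp add: N_def k_def)
  have Nix: "Ni x = - (x + k *\<^sub>C R \<kappa> x)" for x
    by (simp add: Ni_def blinfun.minus_left blinfun.add_left blinfun.diff_left blinfun_apply_scaleC)
  have id: "R \<kappa> x - R \<mu> x = k *\<^sub>C R \<kappa> (R \<mu> x)" for x
    using arg_cong [OF resolvent_identity [OF \<kappa> \<mu>], of "\<lambda>T. blinfun_apply T x"]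
    by (simp add: blinfun.diff_left blinfun_apply_scaleC k_def)
  have cm: "R \<mu> (R \<kappa> x) = R \<kappa> (R \<mu> x)" for x
    using arg_cong [OF resolvent_commute [OF \<kappa> \<mu>], of "\<lambda>T. blinfun_apply T x"] by simp
  have lin: "R z (k *\<^sub>C x) = k *\<^sub>C R z x" if "z \<in> \<rho>" for z x
    using complex_linear_resolvent [OF that] by (simp add: complex_linear_def)
  have key: "k *\<^sub>C R \<kappa> x - k *\<^sub>C R \<mu> x = k *\<^sub>C k *\<^sub>C R \<kappa> (R \<mu> x)" for x
    by (simp flip: id add: scaleC_diff_right)
  have NNi: "N (Ni x) = x" for x
  proof -
    have "R \<mu> (Ni x) = - (R \<mu> x + k *\<^sub>C R \<kappa> (R \<mu> x))"
      by (simp only: Nix blinfun.minus_right blinfun.add_right lin [OF \<mu>] cm)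
    then have "N (Ni x) = (k *\<^sub>C R \<kappa> x - k *\<^sub>C R \<mu> x) - k *\<^sub>C k *\<^sub>C R \<kappa> (R \<mu> x) + x"
      by (simp add: Nx Nix scaleC_minus_right scaleC_add_right scaleC_diff_right)
    then show ?thesis by (simp add: key)
  qed
  have NiN: "Ni (N x) = x" for x
    using key [of x] by (simp add: Nx Nix blinfun.diff_right lin \<kappa> scaleC_diff_right algebra_simps)
  show "c \<in> resolvent_set UNIV F"
  proof (rule resolvent_setI [of "- (Ni o\<^sub>L Gi)"])
    fix x
    have "c *\<^sub>C y - F y = - G (N y)" for y using F [of y] by (metis minus_diff_eq)
    then show "c *\<^sub>C blinfun_apply (- (Ni o\<^sub>L Gi)) x - F (blinfun_apply (- (Ni o\<^sub>L Gi)) x) = x"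
      using NNi [of "- Gi x"] by (simp add: blinfun.minus_left G flip: blinfun.minus_right)
    show "blinfun_apply (- (Ni o\<^sub>L Gi)) (c *\<^sub>C x - F x) = x"
      using \<open>\<And>y. c *\<^sub>C y - F y = - G (N y)\<close>
      by (simp add: blinfun.minus_left blinfun.minus_right G NiN)
  qed auto
next
  assume c: "c \<in> resolvent_set UNIV F"
  define S where "S = resolvent UNIV F c"
  have T: "c *\<^sub>C y - F y = - G (N y)" for y using F [of y] by (metis minus_diff_eq)
  have S: "- G (N (S x)) = x" "S (- G (N x)) = x" for x
    using resolvent_setD(2,3) [OF c] unfolding S_def [symmetric] T by auto
  \<comment> \<open>\<open>S\<close> inverts the negative of \<open>G\<close> after
    \<open>N\<close>, so composing it with \<open>G\<close> cancels that factor and leaves the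
    negative of the inverse of \<open>N\<close>.\<close>
  define Ni where "Ni = - (S o\<^sub>L G)"
  have NiN: "Ni (N x) = x" for x
    using S(2) [of x] by (simp add: Ni_def blinfun.minus_left blinfun.minus_right)
  have Nminus: "N (- x) = - N x" for x by (simp add: N_def blinfun.minus_right scaleC_minus_right)
  have NNi: "N (Ni x) = x" for x
  proof -
    have "G (N (Ni x)) = G x"
      using S(1) [of "G x"] by (simp add: Ni_def blinfun.minus_left Nminus blinfun.minus_right)
    then show ?thesis using G(2) by metis
  qed
  have NiR: "Ni (R \<mu> x) = R \<mu> (Ni x)" for x
    using NiN NNi N_resolvent by metis
  show "\<kappa> \<in> \<rho>"
  \<comment> \<open>\<open>N\<close> is \<open>A - \<kappa>\<close> after \<open>R \<mu>\<close>, so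
    \<open>R \<mu>\<close> after the inverse of \<open>N\<close> inverts
    \<open>A - \<kappa>\<close>; the sign turns this into \<open>\<kappa> - A\<close>.\<close>
  proof (rule resolvent_setI [of "- (R \<mu> o\<^sub>L Ni)"])
    fix x
    have e: "blinfun_apply (- (R \<mu> o\<^sub>L Ni)) x = R \<mu> (- Ni x)" for x
      by (simp add: blinfun.minus_left blinfun.minus_right)
    show "blinfun_apply (- (R \<mu> o\<^sub>L Ni)) x \<in> domA"
      unfolding e by (rule resolvent_setD(1) [OF \<mu>])
    have "\<kappa> *\<^sub>C R \<mu> y - A (R \<mu> y) = - N y" for y using op_resolvent [of y] by (metis minus_diff_eq)
    then show "\<kappa> *\<^sub>C blinfun_apply (- (R \<mu> o\<^sub>L Ni)) x - A (blinfun_apply (- (R \<mu> o\<^sub>L Ni)) x) = x"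
      unfolding e by (simp add: Nminus NNi)
    assume x: "x \<in> domA"
    have "blinfun_apply (- (R \<mu> o\<^sub>L Ni)) (\<kappa> *\<^sub>C x - A x) = R \<mu> (Ni (A x - \<kappa> *\<^sub>C x))"
      by (simp add: blinfun.minus_left flip: blinfun.minus_right)
    also have "\<dots> = x" by (simp add: resolvent_op [OF x] NiN flip: NiR)
    finally show "blinfun_apply (- (R \<mu> o\<^sub>L Ni)) (\<kappa> *\<^sub>C x - A x) = x" .
  qed
qed

end

end

section \<open>Factorisation of univalent functions of A\<close>

lemma holomorphic_at_infinity_tendsto:
  assumes "holomorphic_at_infinity f c"
  shows "(f \<longlongrightarrow> c) at_infinity"
proof -
  let ?\<phi> = "\<lambda>w. if w = 0 then c else f (inverse w)"
  have "isCont ?\<phi> 0"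
    using assms analytic_at_imp_isCont unfolding holomorphic_at_infinity_def by blast
  then have "?\<phi> \<midarrow>0\<rightarrow> c" by (simp add: isCont_def)
  then have "(\<lambda>w. f (inverse w)) \<midarrow>0\<rightarrow> c"
    by (rule Lim_transform_eventually) (auto simp: eventually_at_filter)
  then show ?thesis by (simp add: lim_at_infinity_0 comp_def)
qed

text \<open>The limit is the derivative at 0 of \<open>f\<close> in the chart \<open>1 / z\<close>.
  Injectivity in this chart includes the point 0, which is where \<open>c\<close> not being a value
  of \<open>f\<close> is used, and it makes the derivative nonzero.\<close>

lemma holomorphic_at_infinity_univalent:
  assumes f: "holomorphic_at_infinity f c" and U: "\<forall>\<^sub>F z in at_infinity. z \<in> U"
    and inj: "inj_on f U" "c \<notin> f ` U"
  obtains l where "l \<noteq> 0" "((\<lambda>z. (f z - c) * z) \<longlongrightarrow> l) at_infinity"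
proof -
  define \<phi> where "\<phi> = (\<lambda>w. if w = 0 then c else f (inverse w))"
  obtain r1 where r1: "0 < r1" "\<phi> holomorphic_on ball 0 r1"
    using f unfolding holomorphic_at_infinity_def \<phi>_def analytic_on_def by auto
  obtain b where b: "\<And>z. b \<le> norm z \<Longrightarrow> z \<in> U" using U unfolding eventually_at_infinity by blast
  define r where "r = min r1 (1 / (\<bar>b\<bar> + 1))"
  have r: "0 < r" "ball 0 r \<subseteq> ball (0::complex) r1" using r1 by (auto simp: r_def)
  have inU: "inverse w \<in> U" if "w \<noteq> 0" "w \<in> ball 0 r" for w
  proof (rule b)
    have "norm w < 1 / (\<bar>b\<bar> + 1)" using that(2) by (simp add: r_def)
    then have "\<bar>b\<bar> + 1 < inverse (norm w)" using that(1) by (simp add: field_simps)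
    then have "\<bar>b\<bar> + 1 < norm (inverse w)" by (simp only: norm_inverse)
    then show "b \<le> norm (inverse w)" by linarith
  qed
  have "inj_on \<phi> (ball 0 r)"
  proof (rule inj_onI)
    fix v w assume vw: "v \<in> ball 0 r" "w \<in> ball 0 r" "\<phi> v = \<phi> w"
    show "v = w"
    proof (cases "v = 0 \<or> w = 0")
      case True
      show ?thesis
      proof (rule ccontr)
        assume "v \<noteq> w"
        then obtain u where u: "u \<noteq> 0" "u \<in> ball 0 r" "c = f (inverse u)"
          using True vw by (metis \<phi>_def)
        then show False using inU [OF u(1,2)] inj(2) by blast
      qed
    next
      case False
      then have "f (inverse v) = f (inverse w)" "inverse v \<in> U" "inverse w \<in> U"
        using vw(3) inU [OF _ vw(1)] inU [OF _ vw(2)] by (simp_all add: \<phi>_def)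
      then have "inverse v = inverse w" by (rule inj_onD [OF inj(1)])
      then show ?thesis by (simp only: inverse_eq_iff_eq)
    qed
  qed
  moreover have hol: "\<phi> holomorphic_on ball 0 r" using r1(2) r(2) holomorphic_on_subset by blast
  ultimately have "deriv \<phi> 0 \<noteq> 0"
    using r(1) by (intro holomorphic_injective_imp_regular [of \<phi> "ball 0 r"]) auto
  moreover have "(\<phi> has_field_derivative deriv \<phi> 0) (at 0)"
    using hol r(1) by (intro holomorphic_derivI [of _ "ball 0 r"]) auto
  then have "(\<lambda>w. (\<phi> w - \<phi> 0) / (w - 0)) \<midarrow>0\<rightarrow> deriv \<phi> 0"
    by (simp add: has_field_derivative_iff)
  then have "(\<lambda>w. (f (inverse w) - c) * inverse w) \<midarrow>0\<rightarrow> deriv \<phi> 0"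
    by (rule Lim_transform_eventually) (auto simp: eventually_at_filter \<phi>_def divide_inverse)
  then have "((\<lambda>z. (f z - c) * z) \<longlongrightarrow> deriv \<phi> 0) at_infinity"
    by (simp add: lim_at_infinity_0 comp_def)
  ultimately show ?thesis using that by blast
qed

lemma tendsto_pole_at_infinity: "((\<lambda>z::complex. k / (z - \<mu>)) \<longlongrightarrow> 0) at_infinity"
  by (intro tendsto_divide_0 [OF tendsto_const] tendsto_add_filterlim_at_infinity'
      [OF filterlim_ident tendsto_const, of "- \<mu>", simplified])

context taylor_setting
begin

text \<open>The function \<open>1 / g\<close> is admissible once \<open>U\<close> is shrunk to the
  points where \<open>g\<close> does not vanish; \<open>c \<noteq> 0\<close> is the same condition
  at infinity. Then \<open>calc_mult\<close> applies in both orders.\<close>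

lemma calc_inverse:
  assumes g: "admissible g c U" and nz: "c \<noteq> 0" "\<And>z. z \<in> closure D \<Longrightarrow> g z \<noteq> 0"
  shows "calc g c o\<^sub>L calc (\<lambda>z. 1 / g z) (1 / c) = id_blinfun"
    and "calc (\<lambda>z. 1 / g z) (1 / c) o\<^sub>L calc g c = id_blinfun"
proof -
  note gD = admissibleD [OF g]
  define V where "V = {z \<in> U. g z \<noteq> 0}"
  have "open V"
  proof -
    have "V = U \<inter> g -` (- {0})" by (auto simp: V_def)
    then show ?thesis
      using continuous_open_preimage [OF holomorphic_on_imp_continuous_on [OF gD(3)] gD(1), of "- {0}"] by auto
  qed
  moreover have "closure D \<subseteq> V" using gD(2) nz(2) by (auto simp: V_def)
  moreover have "g holomorphic_on V" using gD(3) by (rule holomorphic_on_subset) (auto simp: V_def)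
  ultimately have V: "admissible g c V" "admissible (\<lambda>z. 1 / g z) (1 / c) V"
    using gD(4) nz(1) by (auto simp: admissible_def V_def intro!: holomorphic_intros tendsto_intros)
  have one: "calc (\<lambda>z. g z * (1 / g z)) 1 = id_blinfun" "calc (\<lambda>z. 1 / g z * g z) 1 = id_blinfun"
    unfolding calc_one [symmetric] using nz(2) cycle_image_subset(1) by (intro calc_cong; auto)+
  show "calc g c o\<^sub>L calc (\<lambda>z. 1 / g z) (1 / c) = id_blinfun"
    "calc (\<lambda>z. 1 / g z) (1 / c) o\<^sub>L calc g c = id_blinfun"
    using calc_mult [OF V] calc_mult [OF V(2,1)] one nz(1) by simp_all
qed

lemma calc_commute:
  assumes "admissible f c U" "admissible g d U"
  shows "calc f c o\<^sub>L calc g d = calc g d o\<^sub>L calc f c"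
  unfolding calc_mult [OF assms] calc_mult [OF assms(2,1)] by (simp add: mult.commute)

text \<open>A crude half of the spectral mapping theorem, with the closure of \<open>D\<close> in
  place of the spectrum. It writes every spectral point other than \<open>c\<close> as a value
  \<open>f \<kappa>\<close> at which the factorisation below is available.\<close>

lemma resolvent_set_calc:
  assumes f: "admissible f c U" and \<nu>: "\<nu> \<noteq> c" "\<nu> \<notin> f ` closure D"
  shows "\<nu> \<in> resolvent_set UNIV (calc f c)"
proof -
  let ?g = "\<lambda>z. f z - \<nu>"
  have g: "admissible ?g (c - \<nu>) U"
    using f by (auto simp: admissible_def intro!: holomorphic_intros tendsto_intros)
  have "c - \<nu> \<noteq> 0" "\<And>z. z \<in> closure D \<Longrightarrow> ?g z \<noteq> 0" using \<nu> by auto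
  note inv = calc_inverse [OF g this]
  have gx: "blinfun_apply (calc ?g (c - \<nu>)) x = calc f c x - \<nu> *\<^sub>C x" for x
    by (simp add: calc_minus_const [OF admissibleD(6) [OF f]] blinfun.diff_left blinfun_apply_scaleC)
  define S where "S = calc (\<lambda>z. 1 / ?g z) (1 / (c - \<nu>))"
  have S: "calc f c (S x) - \<nu> *\<^sub>C S x = x" "S (calc f c x - \<nu> *\<^sub>C x) = x" for x
    using arg_cong [OF inv(1), of "\<lambda>T. blinfun_apply T x"] arg_cong [OF inv(2), of "\<lambda>T. blinfun_apply T x"]
    by (simp_all add: gx S_def)
  show ?thesis
  proof (rule resolvent_setI [of "- S"])
    fix x
    show "\<nu> *\<^sub>C blinfun_apply (- S) x - calc f c (blinfun_apply (- S) x) = x"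
      using S(1) [of x] by (simp add: blinfun.minus_left blinfun.minus_right scaleC_minus_right)
    have "\<nu> *\<^sub>C x - calc f c x = - (calc f c x - \<nu> *\<^sub>C x)" by simp
    then show "blinfun_apply (- S) (\<nu> *\<^sub>C x - calc f c x) = x"
      using S(2) [of x] by (simp only: blinfun.minus_left blinfun.minus_right) simp
  qed auto
qed

context
  fixes f :: "complex \<Rightarrow> complex" and c \<mu> :: complex and U :: "complex set"
  assumes f: "admissible f c U" and inj: "inj_on f U" and c: "c \<notin> f ` U" and \<mu>: "\<mu> \<notin> closure D"
begin

lemma admissible_punctured: "admissible h d U \<Longrightarrow> admissible h d (U - {\<mu>})"
  using \<mu> by (auto simp: admissible_def intro: holomorphic_on_subset)

text \<open>Covers both factors split off below: \<open>(z - \<kappa>) / (z - \<mu>)\<close>, with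
  \<open>k = 1\<close> and \<open>l = \<mu> - \<kappa>\<close>, and \<open>1 / (z - \<mu>)\<close>,
  with \<open>k = 0\<close> and \<open>l = 1\<close>.\<close>

lemma admissible_moebius: "admissible (\<lambda>z. k + l / (z - \<mu>)) k (U - {\<mu>})"
proof -
  have "((\<lambda>z. k + l / (z - \<mu>)) \<longlongrightarrow> k + 0) at_infinity"
    by (intro tendsto_add tendsto_const tendsto_pole_at_infinity)
  then show ?thesis
    using admissible_punctured [OF f] by (auto simp: admissible_def intro!: holomorphic_intros)
qed

lemma calc_moebius: "calc (\<lambda>z. k + l / (z - \<mu>)) k = k *\<^sub>C id_blinfun - l *\<^sub>C R \<mu>"
proof -
  have c: "continuous_on (cycle_image C) (\<lambda>z. (1 / (z - \<mu>)) *\<^sub>C R z)"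
    using \<mu> not_in_cycle_image by (intro continuous_intros continuous_on_cycle_resolvent) auto
  have "(k + l / (z - \<mu>)) *\<^sub>C R z = k *\<^sub>C R z + l *\<^sub>C ((1 / (z - \<mu>)) *\<^sub>C R z)" for z
    by (simp add: scaleC_add_left scaleC_scaleC)
  then show ?thesis
    by (simp add: calc_def cint_add cint_scale c continuous_on_scaleC continuous_on_cycle_resolvent
        cint_resolvent cint_pole_resolvent [OF \<mu>] scaleC_minus_right)
qed

lemma factor_at_point:
  assumes k: "\<kappa> \<in> closure D"
  obtains G Gi :: "'a \<Rightarrow>\<^sub>L 'a" where
    "\<And>x. calc f c x - f \<kappa> *\<^sub>C x = G ((\<mu> - \<kappa>) *\<^sub>C R \<mu> x - x)"
    "\<And>x. G ((\<mu> - \<kappa>) *\<^sub>C R \<mu> x - x) = (\<mu> - \<kappa>) *\<^sub>C R \<mu> (G x) - G x"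
    "\<And>x. G (Gi x) = x" "\<And>x. Gi (G x) = x"
proof -
  note fD = admissibleD [OF f]
  have kU: "\<kappa> \<in> U" using k fD by blast
  \<comment> \<open>The divided difference has no zero in \<open>U\<close> but vanishes at infinity.
    The factor \<open>z - \<mu>\<close> repairs this and produces the nonzero limit
    \<open>c - f \<kappa>\<close>.\<close>
  define g where "g = (\<lambda>z. dquot f z \<kappa> * (z - \<mu>))"
  define m where "m = (\<lambda>z. 1 + (\<mu> - \<kappa>) / (z - \<mu>))"
  let ?V = "U - {\<mu>}"
  have gm: "g z * m z = f z - f \<kappa>" if "z \<noteq> \<mu>" for z
  proof -
    have "(z - \<mu>) * m z = z - \<kappa>" using that by (simp add: m_def field_simps)
    then have "g z * m z = (z - \<kappa>) * dquot f z \<kappa>" by (simp add: g_def mult_ac)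
    then show ?thesis by (simp only: dquot_mult)
  qed
  have "(g \<longlongrightarrow> (c - f \<kappa>) * (1 + 0)) at_infinity"
  proof (rule Lim_transform_eventually)
    show "((\<lambda>z. (f z - f \<kappa>) * (1 + (\<kappa> - \<mu>) / (z - \<kappa>))) \<longlongrightarrow> (c - f \<kappa>) * (1 + 0)) at_infinity"
      by (intro tendsto_intros fD tendsto_pole_at_infinity)
    have "\<forall>\<^sub>F z in at_infinity. z \<noteq> \<kappa>"
      unfolding eventually_at_infinity by (intro exI [of _ "norm \<kappa> + 1"]) auto
    then show "\<forall>\<^sub>F z in at_infinity. (f z - f \<kappa>) * (1 + (\<kappa> - \<mu>) / (z - \<kappa>)) = g z"
    proof eventually_elim
      case (elim z)
      then have "1 + (\<kappa> - \<mu>) / (z - \<kappa>) = (z - \<mu>) / (z - \<kappa>)" by (simp add: field_simps)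
      then show ?case using elim by (simp add: g_def dquot_def)
    qed
  qed
  moreover have "g holomorphic_on U"
    unfolding g_def dquot_commute [of f _ \<kappa>]
    using holomorphic_on_dquot [OF fD(1,3) kU] by (intro holomorphic_intros)
  ultimately have "admissible g (c - f \<kappa>) U" using fD by (simp add: admissible_def)
  then have g: "admissible g (c - f \<kappa>) ?V" by (rule admissible_punctured)
  have m: "admissible m 1 ?V" unfolding m_def by (rule admissible_moebius)
  \<comment> \<open>Univalence enters twice: as injectivity away from \<open>\<kappa>\<close> and as
    a nonvanishing derivative at \<open>\<kappa>\<close>.\<close>
  have "dquot f z \<kappa> \<noteq> 0" if "z \<in> U" for z
    using holomorphic_injective_imp_regular [OF fD(3,1) inj kU] inj_onD [OF inj _ that kU]
    by (auto simp: dquot_def)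
  then have "g z \<noteq> 0" if "z \<in> closure D" for z using that fD(2) \<mu> by (auto simp: g_def)
  moreover have "c - f \<kappa> \<noteq> 0" using c kU by auto
  ultimately have inv: "calc g (c - f \<kappa>) o\<^sub>L calc (\<lambda>z. 1 / g z) (1 / (c - f \<kappa>)) = id_blinfun"
    "calc (\<lambda>z. 1 / g z) (1 / (c - f \<kappa>)) o\<^sub>L calc g (c - f \<kappa>) = id_blinfun"
    using calc_inverse [OF g] by blast+
  \<comment> \<open>\<open>calc m 1\<close> is the negative of the operator \<open>N\<close> of the
    reduction lemmas, hence the minus signs in the witnesses for \<open>G\<close> and
    \<open>Gi\<close>.\<close>
  have mx: "calc m 1 x = - ((\<mu> - \<kappa>) *\<^sub>C R \<mu> x - x)" for x
    unfolding m_def calc_moebius by (simp add: blinfun.diff_left blinfun_apply_scaleC)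
  have "calc f c - f \<kappa> *\<^sub>C id_blinfun = calc (\<lambda>z. f z - f \<kappa>) (c - f \<kappa>)"
    using calc_minus_const [OF fD(6)] by simp
  also have "\<dots> = calc (\<lambda>z. g z * m z) ((c - f \<kappa>) * 1)"
    using gm \<mu> not_in_cycle_image by (simp, intro calc_cong) metis
  also have "\<dots> = calc g (c - f \<kappa>) o\<^sub>L calc m 1" by (rule calc_mult [OF g m, symmetric])
  finally have gm_calc: "calc f c - f \<kappa> *\<^sub>C id_blinfun = calc g (c - f \<kappa>) o\<^sub>L calc m 1" .
  have fact: "calc f c x - f \<kappa> *\<^sub>C x = calc g (c - f \<kappa>) (calc m 1 x)" for x
    using arg_cong [OF gm_calc, of "\<lambda>T. blinfun_apply T x"] by (simp add: blinfun.diff_left blinfun_apply_scaleC)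
  have comm: "calc g (c - f \<kappa>) (calc m 1 x) = calc m 1 (calc g (c - f \<kappa>) x)" for x
    using arg_cong [OF calc_commute [OF g m], of "\<lambda>T. blinfun_apply T x"] by simp
  show ?thesis
  proof (rule that [of "- calc g (c - f \<kappa>)" "- calc (\<lambda>z. 1 / g z) (1 / (c - f \<kappa>))"])
    fix x
    show "calc f c x - f \<kappa> *\<^sub>C x = blinfun_apply (- calc g (c - f \<kappa>)) ((\<mu> - \<kappa>) *\<^sub>C R \<mu> x - x)"
      unfolding fact mx by (simp only: blinfun.minus_left blinfun.minus_right)
    show "blinfun_apply (- calc g (c - f \<kappa>)) ((\<mu> - \<kappa>) *\<^sub>C R \<mu> x - x)
        = (\<mu> - \<kappa>) *\<^sub>C R \<mu> (blinfun_apply (- calc g (c - f \<kappa>)) x) - blinfun_apply (- calc g (c - f \<kappa>)) x"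
      using comm [of x] unfolding mx
      by (simp only: blinfun.minus_left blinfun.minus_right scaleC_minus_right minus_minus) simp
    show "blinfun_apply (- calc g (c - f \<kappa>)) (blinfun_apply (- calc (\<lambda>z. 1 / g z) (1 / (c - f \<kappa>))) x) = x"
      "blinfun_apply (- calc (\<lambda>z. 1 / g z) (1 / (c - f \<kappa>))) (blinfun_apply (- calc g (c - f \<kappa>)) x) = x"
      using arg_cong [OF inv(1), of "\<lambda>T. blinfun_apply T x"] arg_cong [OF inv(2), of "\<lambda>T. blinfun_apply T x"]
      by (simp_all add: blinfun.minus_left blinfun.minus_right)
  qed
qed

lemma calc_at_infinity:
  assumes hol: "holomorphic_at_infinity f c" and U: "\<forall>\<^sub>F z in at_infinity. z \<in> U"
    and drazin: "drazin_invertible UNIV (\<lambda>x. calc f c x - c *\<^sub>C x)"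
  shows "c \<in> resolvent_set UNIV (calc f c)"
proof -
  note fD = admissibleD [OF f]
  obtain l where l: "l \<noteq> 0" "((\<lambda>z. (f z - c) * z) \<longlongrightarrow> l) at_infinity"
    by (rule holomorphic_at_infinity_univalent [OF hol U inj c])
  \<comment> \<open>By univalence the zero of \<open>f - c\<close> at infinity is simple;
    multiplying by \<open>z - \<mu>\<close> removes it and leaves the nonzero limit
    \<open>l\<close>.\<close>
  define g where "g = (\<lambda>z. (f z - c) * (z - \<mu>))"
  have "((\<lambda>z. (f z - c) * z - (f z - c) * \<mu>) \<longlongrightarrow> l - (c - c) * \<mu>) at_infinity"
    by (intro tendsto_intros l fD)
  then have "(g \<longlongrightarrow> l) at_infinity" by (simp add: g_def right_diff_distrib)
  moreover have "g holomorphic_on U" unfolding g_def using fD(3) by (intro holomorphic_intros)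
  ultimately have "admissible g l U" using fD by (simp add: admissible_def)
  then have g: "admissible g l (U - {\<mu>})" by (rule admissible_punctured)
  have "g z \<noteq> 0" if "z \<in> closure D" for z using that fD(2) c \<mu> by (auto simp: g_def)
  then have inv: "calc (\<lambda>z. 1 / g z) (1 / l) o\<^sub>L calc g l = id_blinfun"
    using calc_inverse(2) [OF g l(1)] by blast
  have "calc f c - c *\<^sub>C id_blinfun = calc (\<lambda>z. f z - c) (c - c)"
    by (rule calc_minus_const [OF fD(6), symmetric])
  also have "\<dots> = calc (\<lambda>z. g z * (0 + 1 / (z - \<mu>))) (l * 0)"
    using \<mu> not_in_cycle_image by (simp add: g_def, intro calc_cong) auto
  also have "\<dots> = calc g l o\<^sub>L calc (\<lambda>z. 0 + 1 / (z - \<mu>)) 0"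
    by (rule calc_mult [OF g admissible_moebius, symmetric])
  also have "\<dots> = calc g l o\<^sub>L (- R \<mu>)" by (simp only: calc_moebius) simp
  finally have T: "calc f c - c *\<^sub>C id_blinfun = calc g l o\<^sub>L (- R \<mu>)" .
  define T where "T = calc f c - c *\<^sub>C id_blinfun"
  have Tx: "T x = calc f c x - c *\<^sub>C x" for x
    by (simp add: T_def blinfun.diff_left blinfun_apply_scaleC)
  have "\<mu> \<in> \<rho>" using \<mu> closure_subset not_domain_resolvent by blast
  have "x = 0" if "T x = 0" for x
  proof -
    have "calc g l (- R \<mu> x) = 0" using that by (simp add: T_def T blinfun.minus_left)
    then have "calc (\<lambda>z. 1 / g z) (1 / l) (calc g l (- R \<mu> x)) = 0" by simp
    then have "- R \<mu> x = 0"
      using arg_cong [OF inv, of "\<lambda>S. blinfun_apply S (- R \<mu> x)"] by simp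
    then show ?thesis using resolvent_inj [OF \<open>\<mu> \<in> \<rho>\<close>] by simp
  qed
  then have "inj T"
    using blinfun.diff_right [of T] by (intro injI) (metis eq_iff_diff_eq_0)
  moreover have "drazin_invertible UNIV T" using drazin by (simp add: Tx [abs_def])
  \<comment> \<open>Bijectivity is all that finite descent provides; the bounded inverse theorem
    then yields the bounded operator \<open>S\<close> needed for a resolvent point.\<close>
  ultimately have "bij T" using drazin_invertible_inj_imp_surj by (blast intro: bijI)
  then obtain S where S: "\<And>x. blinfun_apply S (T x) = x" "\<And>y. T (blinfun_apply S y) = y"
    by (rule bounded_inverse) (rule that)
  have cx: "c *\<^sub>C x - calc f c x = - T x" for x by (simp add: Tx)
  show ?thesis
    by (rule resolvent_setI [of "- S"], unfold cx) (simp_all add: blinfun.minus_left blinfun.minus_right S)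
qed

end

end

theorem theorem3p6:
  fixes domA :: "'a::complex_banach set" and A :: "'a \<Rightarrow> 'a"
    and U :: "complex set" and f :: "complex \<Rightarrow> complex" and finf :: complex
    and D :: "complex set" and C :: "(real \<Rightarrow> complex) set"
  assumes "closed_operator domA A"
    and "resolvent_set domA A \<noteq> {}"
    and "open U" and "spectrum domA A \<subseteq> U" and "\<forall>\<^sub>F z in at_infinity. z \<in> U"
    and "f holomorphic_on U" and "holomorphic_at_infinity f finf"
    and "inj_on f U" and "finf \<notin> f ` U"
    and "unbounded_cauchy_domain D C"
    and "spectrum domA A \<subseteq> D" and "closure D \<subseteq> U"
  shows "b_discrete_spectrum UNIV (blinfun_apply (taylor_calculus domA A f finf C)) =
    f ` b_discrete_spectrum domA A"
proof -
  interpret taylor_setting domA A D C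
    using assms by unfold_locales auto
  have lim: "(f \<longlongrightarrow> finf) at_infinity" by (rule holomorphic_at_infinity_tendsto [OF assms(7)])
  have f: "admissible f finf U" using assms lim by (simp add: admissible_def)
  have "closure D \<noteq> UNIV"
  proof
    assume "closure D = UNIV"
    then have "U = UNIV" using assms(12) by auto
    then have "f 0 = finf" using Liouville_weak [OF _ lim] assms(6) by blast
    then show False using assms(9) \<open>U = UNIV\<close> by blast
  qed
  then obtain \<mu> where \<mu>: "\<mu> \<notin> closure D" by blast
  have \<mu>_res: "\<mu> \<in> \<rho>" using \<mu> closure_subset not_domain_resolvent by blast
  define F where "F = calc f finf"
  \<comment> \<open>Stated for the whole closure of \<open>D\<close>, since a preimage of a spectral
    point of \<open>F\<close> is at first only known to lie there.\<close>
  have transfer: "f \<kappa> \<in> b_discrete_spectrum UNIV F \<longleftrightarrow> \<kappa> \<in> b_discrete_spectrum domA A"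
    if \<kappa>: "\<kappa> \<in> closure D" for \<kappa>
  proof -
    let ?N = "\<lambda>x. (\<mu> - \<kappa>) *\<^sub>C R \<mu> x - x"
    obtain G Gi :: "'a \<Rightarrow>\<^sub>L 'a" where fact: "\<And>x. F x - f \<kappa> *\<^sub>C x = G (?N x)"
      and comm: "\<And>x. G (?N x) = ?N (G x)" and G: "\<And>x. G (Gi x) = x" "\<And>x. Gi (G x) = x"
      unfolding F_def using factor_at_point [OF f assms(8,9) \<mu> \<kappa>] by metis
    have "f \<kappa> \<in> resolvent_set UNIV F \<longleftrightarrow> \<kappa> \<in> \<rho>"
      by (rule resolvent_set_shift [OF \<mu>_res fact comm G])
    moreover have "bij G" using G by (metis bijI')
    then have "drazin_invertible UNIV (\<lambda>x. F x - f \<kappa> *\<^sub>C x) \<longleftrightarrow> drazin_invertible domA (\<lambda>x. A x - \<kappa> *\<^sub>C x)"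
      unfolding fact drazin_invertible_shift [OF \<mu>_res]
      by (intro drazin_invertible_comp_bij comm) simp_all
    ultimately show ?thesis
      by (simp add: b_discrete_spectrum_def spectrum_def drazin_spectrum_def)
  qed
  have "b_discrete_spectrum UNIV F = f ` b_discrete_spectrum domA A"
  proof (intro equalityI subsetI)
    fix \<nu> assume \<nu>: "\<nu> \<in> b_discrete_spectrum UNIV F"
    then have "\<nu> \<notin> resolvent_set UNIV F" "drazin_invertible UNIV (\<lambda>x. F x - \<nu> *\<^sub>C x)"
      by (auto simp: b_discrete_spectrum_def spectrum_def drazin_spectrum_def)
    \<comment> \<open>At \<open>finf\<close> Drazin invertibility would already give a resolvent
      point, and any other point outside the image of the closure of \<open>D\<close> is a resolvent
      point as well.\<close>
    then have "\<nu> \<noteq> finf" "\<nu> = finf \<or> \<nu> \<in> f ` closure D"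
      unfolding F_def using calc_at_infinity [OF f assms(8,9) \<mu> assms(7,5)] resolvent_set_calc [OF f] by blast+
    then show "\<nu> \<in> f ` b_discrete_spectrum domA A" using transfer \<nu> by blast
  next
    fix \<nu> assume "\<nu> \<in> f ` b_discrete_spectrum domA A"
    then obtain \<kappa> where \<kappa>: "\<nu> = f \<kappa>" "\<kappa> \<in> b_discrete_spectrum domA A" by blast
    then have "\<kappa> \<in> closure D"
      using assms(11) closure_subset by (auto simp: b_discrete_spectrum_def)
    then show "\<nu> \<in> b_discrete_spectrum UNIV F" using transfer \<kappa> by simp
  qed
  then show ?thesis by (simp add: F_def taylor_calculus_eq)
qed

end
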